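(* Let $n\ge 2$ and $$C_n=\frac{n!\left(1+n-(n-2)\,{}_2F_1\!\left[\tfrac12,1;\tfrac{3+n}{2};-1\right]\right)}{2^{3n/2}\,\Gamma\!\left(\tfrac{1+n}{2}\right)\Gamma\!\left(\tfrac{3+n}{2}\right)}.$$ If $u:B^n\to B^n$ is a harmonic mapping of the unit ball into itself such that $u(0)=0$, then for every $x\in B^n$ $$\frac{1-\|u(x)\|}{1-\|x\|}\ge C_n.$$ The inequality is sharp, i.e. $C_n$ is the largest constant for which it holds for all such $u$ and all $x\in B^n$.
   Context: $\|\cdot\|$ is the Euclidean norm on $\mathbb{R}^n$ and $B^n=\{x\in\mathbb{R}^n:\|x\|<1\}$. A harmonic mapping is a map into $\mathbb{R}^n$ all of whose coordinate functions are (real) harmonic functions. $\Gamma$ is the Gamma function, and ${}_2F_1[a,b;c;x]$ is the Gauss hypergeometric function, ${}_2F_1[a,b;c;x]=\sum_{k=0}^\infty\frac{(a)_k(b)_k}{(c)_k\,k!}x^k$ for $|x|<1$ with $(y)_k=y(y+1)\cdots(y+k-1)$, extended by continuity to $x=-1$. *)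

theory Defs
  imports "HOL-Analysis.Analysis"
begin

definition partial_deriv :: "'a::euclidean_space \<Rightarrow> ('a \<Rightarrow> real) \<Rightarrow> 'a \<Rightarrow> real" where
  "partial_deriv b f x = deriv (\<lambda>t. f (x + t *\<^sub>R b)) 0"

definition laplacian :: "('a::euclidean_space \<Rightarrow> real) \<Rightarrow> 'a \<Rightarrow> real" where
  "laplacian f x = (\<Sum>b\<in>Basis. partial_deriv b (partial_deriv b f) x)"

definition twice_cont_diff_on :: "('a::euclidean_space \<Rightarrow> real) \<Rightarrow> 'a set \<Rightarrow> bool" where
  "twice_cont_diff_on f S \<longleftrightarrow>
     (\<exists>(f' :: 'a \<Rightarrow> 'a \<Rightarrow>\<^sub>L real) (f'' :: 'a \<Rightarrow> 'a \<Rightarrow>\<^sub>L 'a \<Rightarrow>\<^sub>L real).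
        (\<forall>x\<in>S. (f has_derivative blinfun_apply (f' x)) (at x)) \<and>
        (\<forall>x\<in>S. (f' has_derivative blinfun_apply (f'' x)) (at x)) \<and>
        continuous_on S f'')"

definition harmonic_on :: "('a::euclidean_space \<Rightarrow> real) \<Rightarrow> 'a set \<Rightarrow> bool" where
  "harmonic_on f S \<longleftrightarrow>
     open S \<and> twice_cont_diff_on f S \<and> (\<forall>x\<in>S. laplacian f x = 0)"

definition harmonic_map_on :: "('a::euclidean_space \<Rightarrow> real ^ 'm) \<Rightarrow> 'a set \<Rightarrow> bool" where
  "harmonic_map_on u S \<longleftrightarrow> (\<forall>i. harmonic_on (\<lambda>x. u x $ i) S)"

text \<open>
  Inside the unit interval this is the power series. At the endpoints it is the limit from
  inside, so that the value at \<open>-1\<close> is the extension by continuity.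
  Values are unspecified wherever that limit does not exist or \<open>\<bar>x\<bar> > 1\<close>.
\<close>

definition hyp2F1 :: "real \<Rightarrow> real \<Rightarrow> real \<Rightarrow> real \<Rightarrow> real" where
  "hyp2F1 a b c x =
     (if \<bar>x\<bar> < 1 then eval_fps (fps_hypergeo [a, b] [c] 1) x
      else Lim (at x within {-1<..<1}) (eval_fps (fps_hypergeo [a, b] [c] 1)))"

definition schwarz_const :: "nat \<Rightarrow> real" where
  "schwarz_const n =
     fact n * (1 + real n - (real n - 2) * hyp2F1 (1 / 2) 1 ((3 + real n) / 2) (-1)) /
     (2 powr (3 * real n / 2) * Gamma ((1 + real n) / 2) * Gamma ((3 + real n) / 2))"

end

theory Submission
  imports Defs
begin

text \<open>
  Composing the map with a linear functional reduces the inequality to a real harmonic function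
  \<open>f\<close> on the ball with \<open>\<bar>f\<bar> \<le> 1\<close> and \<open>f 0 = 0\<close>. By the Poisson formula \<open>f x\<close> is the mean of
  the Poisson kernel times the boundary values, and these have mean 0. So the constant value that the
  kernel takes on the equator orthogonal to \<open>x\<close> can be subtracted from it, and the extremal boundary values
  are 1 on the hemisphere around \<open>x\<close> and -1 on the opposite one
  (\<open>harmonic_schwarz_bound\<close>). Writing \<open>\<omega>\<close> for the harmonic measure of the far hemisphere,
  this is \<open>1 - f x \<ge> 2 * \<omega> x\<close>.

  Only the values of \<open>\<omega>\<close> on an axis matter. In the coordinate \<open>t\<close> = slope of a point of the sphere over
  the equatorial plane, the surface measure has density proportional to \<open>(1 + t^2) powr (- n / 2)\<close>
  (\<open>nn_integral_zonal\<close>), and along the axis \<open>\<omega>\<close> equals \<open>1 - r^2\<close> times a constant multiple of the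
  integral over \<open>t \<ge> 0\<close> of
  \<open>(1 + (t + r * sqrt (1 + t^2))^2) powr (- n / 2)\<close>. The quotient of \<open>2 * \<omega>\<close> by \<open>1 - r\<close> is
  therefore \<open>2 * (1 + r)\<close> times this integral, and the heart of the matter is that it is smallest
  at \<open>r = 1\<close>. After the dilation \<open>t = 2 / (1 + r) * u\<close>, which absorbs the factor \<open>1 + r\<close>, this holds even
  pointwise under the integral (\<open>chord_slope_dilation\<close>).

  At \<open>r = 1\<close> the integral can be computed. Two integrations by parts and the Euler integral of the
  hypergeometric function identify the limit with the constant of the theorem
  (\<open>schwarz_const_eq\<close>).

  The constant is optimal because the extremal function is a limit of admissible ones: the Poisson integrals
  of odd continuous approximations of the sign function attain the bound \<open>2 * \<omega>\<close> in the limit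
  (\<open>schwarz_map_limit\<close>), and then \<open>r\<close> tends to 1.

  Surface measure is obtained from Lebesgue measure on a shell by radial projection. The Poisson formula
  follows from the maximum principle: the Poisson integral of continuous data is harmonic by
  differentiation under the integral sign and has the right boundary values, and the kernel has mean 1 because this
  mean is a radial harmonic function.
\<close>

section \<open>Harmonic functions and the maximum principle\<close>

lemma DERIV_along_line:
  fixes f :: "'a::euclidean_space \<Rightarrow> real"
  assumes "(f has_derivative D) (at (x + t *\<^sub>R b))"
  shows "((\<lambda>t. f (x + t *\<^sub>R b)) has_real_derivative D b) (at t)"
proof -
  have "((\<lambda>t. f (x + t *\<^sub>R b)) has_derivative (\<lambda>h. D (h *\<^sub>R b))) (at t)"
    by (rule has_derivative_compose[where f = "\<lambda>t. x + t *\<^sub>R b", OF _ assms]) (auto intro!: derivative_eq_intros)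
  moreover have "(\<lambda>h. D (h *\<^sub>R b)) = (\<lambda>h. D b * h)"
    using linear_scale[OF has_derivative_linear[OF assms]] by (auto simp: mult.commute)
  ultimately show ?thesis by (simp add: has_field_derivative_def)
qed

lemma DERIV_along_line_blinfun:
  fixes f' :: "'a::euclidean_space \<Rightarrow> 'a \<Rightarrow>\<^sub>L real"
  assumes "(f' has_derivative blinfun_apply D) (at (x + t *\<^sub>R b))"
  shows "((\<lambda>t. blinfun_apply (f' (x + t *\<^sub>R b)) b) has_real_derivative D b b) (at t)"
proof -
  have "((\<lambda>y. blinfun_apply (f' y) b) has_derivative (\<lambda>h. D h b)) (at (x + t *\<^sub>R b))"
    using assms by (auto intro!: derivative_eq_intros)
  from DERIV_along_line[OF this] show ?thesis .
qed

lemma eventually_line_in_open: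
  fixes x :: "'a::euclidean_space"
  assumes "open S" "x \<in> S"
  shows "\<forall>\<^sub>F t in nhds 0. x + t *\<^sub>R b \<in> S"
proof -
  have "isCont (\<lambda>t::real. x + t *\<^sub>R b) 0" by (intro continuous_intros)
  then have "((\<lambda>t::real. x + t *\<^sub>R b) \<longlongrightarrow> x) (nhds 0)"
    using tendsto_at_iff_tendsto_nhds[of "\<lambda>t::real. x + t *\<^sub>R b" 0] by (simp add: isCont_def)
  then show ?thesis using assms topological_tendstoD by blast
qed

text \<open>
  The pointwise Laplacian only sees iterated one-variable derivatives along the axes. On an open set
  where two Frechet derivatives exist it is the trace of the second one, and harmonicity is used
  below only in the form of a trace condition.
\<close>
lemma laplacian_eq_trace:
  assumes S: "open S" "x \<in> S"
    and f': "\<And>y. y \<in> S \<Longrightarrow> (f has_derivative blinfun_apply (f' y)) (at y)"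
    and f'': "\<And>y. y \<in> S \<Longrightarrow> (f' has_derivative blinfun_apply (f'' y)) (at y)"
  shows "laplacian f x = (\<Sum>b\<in>Basis. f'' x b b)"
  unfolding laplacian_def
proof (rule sum.cong[OF refl])
  fix b :: 'a
  have 1: "partial_deriv b f y = f' y b" if "y \<in> S" for y
    unfolding partial_deriv_def
    by (rule DERIV_imp_deriv) (use DERIV_along_line[of f "f' y" y 0 b] f'[OF that] in simp)
  have "\<forall>\<^sub>F t in nhds 0. partial_deriv b f (x + t *\<^sub>R b) = f' (x + t *\<^sub>R b) b"
    using eventually_line_in_open[OF S] by (rule eventually_mono) (rule 1)
  then have "partial_deriv b (partial_deriv b f) x = deriv (\<lambda>t. f' (x + t *\<^sub>R b) b) 0"
    unfolding partial_deriv_def[of b "partial_deriv b f"] by (rule deriv_cong_ev) simp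
  also have "\<dots> = f'' x b b"
    by (rule DERIV_imp_deriv) (use DERIV_along_line_blinfun[of f' "f'' x" x 0 b] f''[OF S(2)] in simp)
  finally show "partial_deriv b (partial_deriv b f) x = f'' x b b" .
qed

lemma harmonic_onI:
  assumes S: "open S"
    and f': "\<And>y. y \<in> S \<Longrightarrow> (f has_derivative blinfun_apply (f' y)) (at y)"
    and f'': "\<And>y. y \<in> S \<Longrightarrow> (f' has_derivative blinfun_apply (f'' y)) (at y)"
    and cont: "continuous_on S f''"
    and tr: "\<And>y. y \<in> S \<Longrightarrow> (\<Sum>b\<in>Basis. f'' y b b) = 0"
  shows "harmonic_on f S"
  unfolding harmonic_on_def twice_cont_diff_on_def
  using assms laplacian_eq_trace[OF S _ f' f''] by auto

lemma harmonic_onE: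
  assumes "harmonic_on f S"
  obtains f' f'' where "open S"
    "\<And>y. y \<in> S \<Longrightarrow> (f has_derivative blinfun_apply (f' y)) (at y)"
    "\<And>y. y \<in> S \<Longrightarrow> (f' has_derivative blinfun_apply (f'' y)) (at y)"
    "continuous_on S f''"
    "\<And>y. y \<in> S \<Longrightarrow> (\<Sum>b\<in>Basis. blinfun_apply (blinfun_apply (f'' y) b) b) = 0"
proof -
  from assms obtain f' f'' where *: "open S"
    "\<And>y. y \<in> S \<Longrightarrow> (f has_derivative blinfun_apply (f' y)) (at y)"
    "\<And>y. y \<in> S \<Longrightarrow> (f' has_derivative blinfun_apply (f'' y)) (at y)"
    "continuous_on S f''" "\<And>y. y \<in> S \<Longrightarrow> laplacian f y = 0"
    unfolding harmonic_on_def twice_cont_diff_on_def by blast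
  show thesis
    by (rule that[OF *(1-4)]) (use *(5) laplacian_eq_trace[OF *(1) _ *(2,3)] in auto)
qed

lemma harmonic_on_imp_continuous_on:
  assumes "harmonic_on f S" shows "continuous_on S f"
proof (rule harmonic_onE[OF assms])
  fix f' :: "'a \<Rightarrow> 'a \<Rightarrow>\<^sub>L real"
  assume "\<And>y. y \<in> S \<Longrightarrow> (f has_derivative blinfun_apply (f' y)) (at y)"
  then show ?thesis
    by (meson continuous_at_imp_continuous_on has_derivative_continuous)
qed

lemma harmonic_on_cong:
  assumes "\<And>x. x \<in> S \<Longrightarrow> f x = g x"
  shows "harmonic_on f S \<longleftrightarrow> harmonic_on g S"
proof -
  have "harmonic_on g S" if f: "harmonic_on f S" and eq: "\<And>x. x \<in> S \<Longrightarrow> f x = g x" for f g :: "'a \<Rightarrow> real"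
  proof (rule harmonic_onE[OF f])
    fix f' f''
    assume *: "open S" "\<And>y. y \<in> S \<Longrightarrow> (f has_derivative blinfun_apply (f' y)) (at y)"
      "\<And>y. y \<in> S \<Longrightarrow> (f' has_derivative blinfun_apply (f'' y)) (at y)"
      "continuous_on S f''"
      "\<And>y. y \<in> S \<Longrightarrow> (\<Sum>b\<in>Basis. blinfun_apply (blinfun_apply (f'' y) b) b) = 0"
    show ?thesis
    proof (rule harmonic_onI[OF *(1) _ *(3-5)])
      show "(g has_derivative blinfun_apply (f' y)) (at y)" if "y \<in> S" for y
        using has_derivative_transform_within_open[OF *(2)[OF that] *(1) that] eq by auto
    qed
  qed
  then show ?thesis using assms by metis
qed

lemma harmonic_on_diff:
  assumes "harmonic_on f S" "harmonic_on g S"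
  shows "harmonic_on (\<lambda>x. f x - g x) S"
proof (rule harmonic_onE[OF assms(1)], rule harmonic_onE[OF assms(2)])
  fix f' f'' g' g''
  assume *: "open S"
    "\<And>y. y \<in> S \<Longrightarrow> (f has_derivative blinfun_apply (f' y)) (at y)"
    "\<And>y. y \<in> S \<Longrightarrow> (f' has_derivative blinfun_apply (f'' y)) (at y)"
    "continuous_on S f''"
    "\<And>y. y \<in> S \<Longrightarrow> (\<Sum>b\<in>Basis. blinfun_apply (blinfun_apply (f'' y) b) b) = 0"
    "\<And>y. y \<in> S \<Longrightarrow> (g has_derivative blinfun_apply (g' y)) (at y)"
    "\<And>y. y \<in> S \<Longrightarrow> (g' has_derivative blinfun_apply (g'' y)) (at y)"
    "continuous_on S g''"
    "\<And>y. y \<in> S \<Longrightarrow> (\<Sum>b\<in>Basis. blinfun_apply (blinfun_apply (g'' y) b) b) = 0"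
  show ?thesis
  proof (rule harmonic_onI[where f' = "\<lambda>y. f' y - g' y" and f'' = "\<lambda>y. f'' y - g'' y"])
    show "((\<lambda>x. f x - g x) has_derivative blinfun_apply (f' y - g' y)) (at y)" if "y \<in> S" for y
      using has_derivative_diff[OF *(2,6)[OF that]] by (simp add: blinfun.diff_left[abs_def])
    show "((\<lambda>x. f' x - g' x) has_derivative blinfun_apply (f'' y - g'' y)) (at y)" if "y \<in> S" for y
      using has_derivative_diff[OF *(3,7)[OF that]] by (simp add: blinfun.diff_left[abs_def])
    show "continuous_on S (\<lambda>y. f'' y - g'' y)" using * by (intro continuous_intros)
    show "(\<Sum>b\<in>Basis. blinfun_apply (blinfun_apply (f'' y - g'' y) b) b) = 0" if "y \<in> S" for y
      using *(5,9)[OF that] by (simp add: blinfun.diff_left sum_subtractf)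
  qed (fact *)
qed

lemma harmonic_on_add:
  assumes "harmonic_on f S" "harmonic_on g S"
  shows "harmonic_on (\<lambda>x. f x + g x) S"
proof -
  have "harmonic_on (\<lambda>x. f x - ((g x - g x) - g x)) S"
    by (intro harmonic_on_diff assms)
  then show ?thesis by simp
qed

lemma harmonic_on_cmult:
  assumes "harmonic_on f S"
  shows "harmonic_on (\<lambda>x. c * f x) S"
proof (rule harmonic_onE[OF assms])
  fix f' f''
  assume *: "open S"
    "\<And>y. y \<in> S \<Longrightarrow> (f has_derivative blinfun_apply (f' y)) (at y)"
    "\<And>y. y \<in> S \<Longrightarrow> (f' has_derivative blinfun_apply (f'' y)) (at y)"
    "continuous_on S f''"
    "\<And>y. y \<in> S \<Longrightarrow> (\<Sum>b\<in>Basis. blinfun_apply (blinfun_apply (f'' y) b) b) = 0"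
  show ?thesis
  proof (rule harmonic_onI[where f' = "\<lambda>y. c *\<^sub>R f' y" and f'' = "\<lambda>y. c *\<^sub>R f'' y"])
    show "((\<lambda>x. c * f x) has_derivative blinfun_apply (c *\<^sub>R f' y)) (at y)" if "y \<in> S" for y
      using has_derivative_scaleR_right[OF *(2)[OF that], of c] by (simp add: blinfun.scaleR_left[abs_def])
    show "((\<lambda>x. c *\<^sub>R f' x) has_derivative blinfun_apply (c *\<^sub>R f'' y)) (at y)" if "y \<in> S" for y
      using has_derivative_scaleR_right[OF *(3)[OF that], of c] by (simp add: blinfun.scaleR_left[abs_def])
    show "continuous_on S (\<lambda>y. c *\<^sub>R f'' y)" using * by (intro continuous_intros)
    show "(\<Sum>b\<in>Basis. blinfun_apply (blinfun_apply (c *\<^sub>R f'' y) b) b) = 0" if "y \<in> S" for y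
      using *(5)[OF that] by (simp add: blinfun.scaleR_left flip: sum_distrib_left)
  qed (fact *)
qed

lemma harmonic_on_dilation:
  fixes f :: "'a::euclidean_space \<Rightarrow> real"
  assumes f: "harmonic_on f (ball 0 1)" and s: "0 < s" "s \<le> 1"
  shows "harmonic_on (\<lambda>x. f (s *\<^sub>R x)) (ball 0 1)"
proof (rule harmonic_onE[OF f])
  fix f' :: "'a \<Rightarrow> 'a \<Rightarrow>\<^sub>L real" and f'' :: "'a \<Rightarrow> 'a \<Rightarrow>\<^sub>L 'a \<Rightarrow>\<^sub>L real"
  assume *: "\<And>y. y \<in> ball 0 1 \<Longrightarrow> (f has_derivative blinfun_apply (f' y)) (at y)"
    "\<And>y. y \<in> ball 0 1 \<Longrightarrow> (f' has_derivative blinfun_apply (f'' y)) (at y)"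
    "continuous_on (ball 0 1) f''"
    "\<And>y. y \<in> ball 0 1 \<Longrightarrow> (\<Sum>b\<in>Basis. blinfun_apply (blinfun_apply (f'' y) b) b) = 0"
  have in_ball: "s *\<^sub>R y \<in> ball 0 1" if "y \<in> ball 0 1" for y :: 'a
    using that s by (auto intro: le_less_trans[OF mult_left_le_one_le])
  have scal: "((\<lambda>x. s *\<^sub>R x) has_derivative (\<lambda>h. s *\<^sub>R h)) (at y)" for y :: 'a
    by (auto intro!: derivative_eq_intros)
  show ?thesis
  proof (rule harmonic_onI[where f' = "\<lambda>y. s *\<^sub>R f' (s *\<^sub>R y)" and f'' = "\<lambda>y. (s * s) *\<^sub>R f'' (s *\<^sub>R y)"])
    fix y :: 'a assume y: "y \<in> ball 0 1"
    show "((\<lambda>x. f (s *\<^sub>R x)) has_derivative blinfun_apply (s *\<^sub>R f' (s *\<^sub>R y))) (at y)"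
      using has_derivative_compose[OF scal *(1)[OF in_ball[OF y]]]
      by (simp add: blinfun.scaleR_left[abs_def] blinfun.scaleR_right)
    have "((\<lambda>x. s *\<^sub>R f' (s *\<^sub>R x)) has_derivative (\<lambda>h. s *\<^sub>R f'' (s *\<^sub>R y) (s *\<^sub>R h))) (at y)"
      by (intro has_derivative_scaleR_right has_derivative_compose[OF scal *(2)[OF in_ball[OF y]]])
    then show "((\<lambda>x. s *\<^sub>R f' (s *\<^sub>R x)) has_derivative blinfun_apply ((s * s) *\<^sub>R f'' (s *\<^sub>R y))) (at y)"
      by (simp add: blinfun.scaleR_left[abs_def] blinfun.scaleR_right)
    show "(\<Sum>b\<in>Basis. blinfun_apply (blinfun_apply ((s * s) *\<^sub>R f'' (s *\<^sub>R y)) b) b) = 0"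
      using *(4)[OF in_ball[OF y]] by (simp add: blinfun.scaleR_left flip: sum_distrib_left)
  next
    show "continuous_on (ball 0 1) (\<lambda>y. (s * s) *\<^sub>R f'' (s *\<^sub>R y))"
      by (intro continuous_intros continuous_on_compose2[OF *(3)]) (use in_ball in auto)
  qed auto
qed


text \<open>
  If the second derivative were positive, the first derivative, which vanishes at the maximum, would
  be positive just to the right of it, and the function would increase beyond its maximum.
\<close>
lemma second_deriv_at_max_nonpos:
  fixes \<phi> \<phi>' :: "real \<Rightarrow> real"
  assumes d1: "\<forall>\<^sub>F t in nhds 0. (\<phi> has_real_derivative \<phi>' t) (at t)"
    and d2: "(\<phi>' has_real_derivative l) (at 0)"
    and mx: "\<forall>\<^sub>F t in nhds 0. \<phi> t \<le> \<phi> 0"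
  shows "l \<le> 0"
proof (rule ccontr)
  assume "\<not> l \<le> 0"
  obtain d where d: "d > 0" "\<And>t. \<bar>t\<bar> < d \<Longrightarrow> (\<phi> has_real_derivative \<phi>' t) (at t) \<and> \<phi> t \<le> \<phi> 0"
    using eventually_conj[OF d1 mx] unfolding eventually_nhds_metric by (auto simp: dist_real_def)
  have z: "\<phi>' 0 = 0"
    by (rule DERIV_local_max[of \<phi> _ 0 d]) (use d in auto)
  obtain e where e: "e > 0" "\<And>h. h > 0 \<Longrightarrow> h < e \<Longrightarrow> \<phi>' 0 < \<phi>' (0 + h)"
    using DERIV_pos_inc_right[OF d2] \<open>\<not> l \<le> 0\<close> by auto
  define h where "h = min d e / 2"
  have h: "0 < h" "h < d" "h < e" using d e by (auto simp: h_def)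
  obtain z where z2: "0 < z" "z < h" "\<phi> h - \<phi> 0 = (h - 0) * \<phi>' z"
    using MVT2[of 0 h \<phi> \<phi>'] h d by (metis abs_of_nonneg le_less_trans)
  have "\<phi>' z > 0" using e(2)[of z] z2 h z by simp
  then have "\<phi> h > \<phi> 0" using z2 h by (metis diff_zero diff_gt_0_iff_gt mult_pos_pos)
  then show False using d(2)[of h] h by auto
qed

text \<open>
  Adding \<open>\<epsilon> * (y \<bullet> y)\<close> makes the Laplacian strictly positive, so that an interior maximum, where every
  second derivative along an axis is nonpositive, is impossible. Then \<open>\<epsilon>\<close> tends to 0.
\<close>
lemma harmonic_max_principle:
  fixes f :: "'a::euclidean_space \<Rightarrow> real"
  assumes f: "harmonic_on f S" and S: "cball 0 \<rho> \<subseteq> S"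
    and bd: "\<And>y. norm y = \<rho> \<Longrightarrow> f y \<le> M" and x: "norm x \<le> \<rho>"
  shows "f x \<le> M"
proof (rule harmonic_onE[OF f])
  fix f' :: "'a \<Rightarrow> 'a \<Rightarrow>\<^sub>L real" and f'' :: "'a \<Rightarrow> 'a \<Rightarrow>\<^sub>L 'a \<Rightarrow>\<^sub>L real"
  assume *: "open S" "\<And>y. y \<in> S \<Longrightarrow> (f has_derivative blinfun_apply (f' y)) (at y)"
    "\<And>y. y \<in> S \<Longrightarrow> (f' has_derivative blinfun_apply (f'' y)) (at y)"
    "\<And>y. y \<in> S \<Longrightarrow> (\<Sum>b\<in>Basis. blinfun_apply (blinfun_apply (f'' y) b) b) = 0"
  have "f x \<le> M + \<epsilon> * \<rho>\<^sup>2" if \<epsilon>: "\<epsilon> > 0" for \<epsilon>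
  proof -
    define g where "g y = f y + \<epsilon> * (y \<bullet> y)" for y
    have "continuous_on (cball 0 \<rho>) g" unfolding g_def
      by (intro continuous_intros continuous_on_subset[OF harmonic_on_imp_continuous_on[OF f] S])
    moreover have "cball 0 \<rho> \<noteq> ({}::'a set)" using x norm_ge_zero[of x] by (metis empty_iff mem_cball_0)
    ultimately obtain p where p: "norm p \<le> \<rho>" "\<And>y. norm y \<le> \<rho> \<Longrightarrow> g y \<le> g p"
      using continuous_attains_sup[OF compact_cball] by (metis mem_cball_0)
    have "norm p = \<rho>"
    proof (rule ccontr)
      assume "norm p \<noteq> \<rho>"
      then have pb: "p \<in> ball 0 \<rho>" using p by auto
      have pS: "p \<in> S" using S p by auto
      have "f'' p b b + 2 * \<epsilon> * (b \<bullet> b) \<le> 0" if "b \<in> Basis" for b :: 'a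
      proof (rule second_deriv_at_max_nonpos[of "\<lambda>t. g (p + t *\<^sub>R b)"
            "\<lambda>t. f' (p + t *\<^sub>R b) b + 2 * \<epsilon> * ((p + t *\<^sub>R b) \<bullet> b)"])
        have g': "(g has_derivative (\<lambda>h. f' y h + 2 * \<epsilon> * (y \<bullet> h))) (at y)" if "y \<in> S" for y
          unfolding g_def using *(2)[OF that]
          by (auto intro!: derivative_eq_intros simp: inner_commute algebra_simps)
        show "\<forall>\<^sub>F t in nhds 0. ((\<lambda>t. g (p + t *\<^sub>R b)) has_real_derivative
            f' (p + t *\<^sub>R b) b + 2 * \<epsilon> * ((p + t *\<^sub>R b) \<bullet> b)) (at t)"
          using eventually_line_in_open[OF *(1) pS]
          by (rule eventually_mono) (erule DERIV_along_line[OF g'])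
        show "((\<lambda>t. f' (p + t *\<^sub>R b) b + 2 * \<epsilon> * ((p + t *\<^sub>R b) \<bullet> b)) has_real_derivative
            f'' p b b + 2 * \<epsilon> * (b \<bullet> b)) (at 0)"
        proof (rule DERIV_add)
          show "((\<lambda>t. f' (p + t *\<^sub>R b) b) has_real_derivative f'' p b b) (at 0)"
            by (rule DERIV_along_line_blinfun) (use *(3)[OF pS] in simp)
          show "((\<lambda>t. 2 * \<epsilon> * ((p + t *\<^sub>R b) \<bullet> b)) has_real_derivative 2 * \<epsilon> * (b \<bullet> b)) (at 0)"
            unfolding inner_add_left inner_scaleR_left by (rule derivative_eq_intros refl | simp)+
        qed
        show "\<forall>\<^sub>F t in nhds 0. g (p + t *\<^sub>R b) \<le> g (p + 0 *\<^sub>R b)"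
          using eventually_line_in_open[OF open_ball pb, of b]
          by (rule eventually_mono) (use p in auto)
      qed
      then have "(\<Sum>b\<in>Basis. f'' p b b + 2 * \<epsilon> * (b \<bullet> b)) \<le> 0" by (intro sum_nonpos)
      then have "2 * \<epsilon> * (\<Sum>b\<in>(Basis::'a set). b \<bullet> b) \<le> 0"
        using *(4)[OF pS] by (simp add: sum.distrib sum_distrib_left)
      moreover have "(\<Sum>b\<in>(Basis::'a set). b \<bullet> b) = DIM('a)" by (simp add: inner_Basis)
      ultimately show False using \<epsilon> by (simp add: mult_le_0_iff)
    qed
    have "f x \<le> g x" using \<epsilon> by (simp add: g_def)
    also have "\<dots> \<le> g p" using p x by auto
    also have "\<dots> \<le> M + \<epsilon> * \<rho>\<^sup>2" using bd[OF \<open>norm p = \<rho>\<close>] \<open>norm p = \<rho>\<close>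
      by (simp add: g_def power2_norm_eq_inner[symmetric])
    finally show ?thesis .
  qed
  then have "f x \<le> M + e" if "e > 0" for e
  proof -
    have "\<rho> \<ge> 0" using x norm_ge_zero order_trans by blast
    have p: "\<rho>\<^sup>2 + 1 > 0" by (simp add: add_nonneg_pos)
    then have "e / (\<rho>\<^sup>2 + 1) > 0" using that by simp
    from \<open>\<And>\<epsilon>. \<epsilon> > 0 \<Longrightarrow> f x \<le> M + \<epsilon> * \<rho>\<^sup>2\<close>[OF this]
    have "f x \<le> M + e / (\<rho>\<^sup>2 + 1) * \<rho>\<^sup>2" .
    also have "e / (\<rho>\<^sup>2 + 1) * \<rho>\<^sup>2 \<le> e" using that p by (simp add: field_simps)
    finally show ?thesis by simp
  qed
  then show ?thesis by (rule field_le_epsilon)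
qed

text \<open>
  A form of the maximum principle in which the function need not extend to the sphere: it suffices
  that its boundary values are nonpositive in the limit, uniformly.
\<close>
lemma harmonic_nonpos_of_boundary:
  fixes f :: "'a::euclidean_space \<Rightarrow> real"
  assumes f: "harmonic_on f (ball 0 1)"
    and bd: "\<And>\<epsilon>. \<epsilon> > 0 \<Longrightarrow> \<exists>\<delta>>0. \<forall>y. 1 - \<delta> < norm y \<and> norm y < 1 \<longrightarrow> f y \<le> \<epsilon>"
    and x: "norm x < 1"
  shows "f x \<le> 0"
proof (rule field_le_epsilon)
  fix e :: real assume "e > 0"
  then obtain \<delta> where \<delta>: "\<delta> > 0" "\<And>y. 1 - \<delta> < norm y \<Longrightarrow> norm y < 1 \<Longrightarrow> f y \<le> e"
    using bd by metis
  have "max (norm x) (1 - \<delta>) < 1" using x \<delta> by auto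
  then obtain \<rho> where \<rho>: "norm x < \<rho>" "1 - \<delta> < \<rho>" "\<rho> < 1"
    using dense by (metis max_less_iff_conj)
  show "f x \<le> 0 + e"
    by (rule order_trans[OF harmonic_max_principle[OF f, of \<rho> e x]]) (use \<delta> \<rho> in auto)
qed


text \<open>
  Differentiation under the integral sign, twice, on a compact box of parameters. This is how all
  the harmonic functions below are produced.
\<close>
lemma harmonic_integral:
  fixes q :: "'a::euclidean_space \<Rightarrow> 'b::euclidean_space \<Rightarrow> real"
    and q' :: "'a \<Rightarrow> 'b \<Rightarrow> 'a \<Rightarrow>\<^sub>L real" and q'' :: "'a \<Rightarrow> 'b \<Rightarrow> 'a \<Rightarrow>\<^sub>L 'a \<Rightarrow>\<^sub>L real"
  assumes U: "open U" "convex U"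
    and d1: "\<And>x t. x \<in> U \<Longrightarrow> t \<in> cbox a b \<Longrightarrow> ((\<lambda>x. q x t) has_derivative q' x t) (at x)"
    and d2: "\<And>x t. x \<in> U \<Longrightarrow> t \<in> cbox a b \<Longrightarrow> ((\<lambda>x. q' x t) has_derivative q'' x t) (at x)"
    and c0: "continuous_on (U \<times> cbox a b) (\<lambda>(x,t). q x t)"
    and c1: "continuous_on (U \<times> cbox a b) (\<lambda>(x,t). q' x t)"
    and c2: "continuous_on (U \<times> cbox a b) (\<lambda>(x,t). q'' x t)"
    and tr: "\<And>x t. x \<in> U \<Longrightarrow> t \<in> cbox a b \<Longrightarrow> (\<Sum>b\<in>Basis. q'' x t b b) = 0"
  shows "harmonic_on (\<lambda>x. integral (cbox a b) (q x)) U"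
proof -
  have slice: "f x integrable_on cbox a b" if c: "continuous_on (U \<times> cbox a b) (\<lambda>(x,t). f x t)" and x: "x \<in> U"
    for f :: "'a \<Rightarrow> 'b \<Rightarrow> 'c::banach" and x
  proof (rule integrable_continuous)
    have "continuous_on (cbox a b) (\<lambda>t. (\<lambda>(x,t). f x t) (x, t))"
      by (rule continuous_on_compose2[OF c]) (use x in \<open>auto intro!: continuous_intros\<close>)
    then show "continuous_on (cbox a b) (f x)" by simp
  qed
  show ?thesis
  proof (rule harmonic_onI[where f' = "\<lambda>x. integral (cbox a b) (q' x)"
          and f'' = "\<lambda>x. integral (cbox a b) (q'' x)"])
    fix x assume x: "x \<in> U"
    show "((\<lambda>x. integral (cbox a b) (q x)) has_derivative integral (cbox a b) (q' x)) (at x)"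
      using leibniz_rule[of U a b q q' x, OF has_derivative_at_withinI[OF d1] slice[OF c0] c1 x U(2)]
      unfolding at_within_open[OF x U(1)] .
    show "((\<lambda>x. integral (cbox a b) (q' x)) has_derivative integral (cbox a b) (q'' x)) (at x)"
      using leibniz_rule[of U a b q' q'' x, OF has_derivative_at_withinI[OF d2] slice[OF c1] c2 x U(2)]
      unfolding at_within_open[OF x U(1)] .
    have i1: "q'' x integrable_on cbox a b" by (rule slice[OF c2 x])
    have i2: "(\<lambda>t. q'' x t c) integrable_on cbox a b" for c
      using integrable_linear[OF i1 blinfun.bounded_linear_left[of c]] by (simp add: o_def)
    have i3: "(\<lambda>t. q'' x t c d) integrable_on cbox a b" for c d
      using integrable_linear[OF i2 blinfun.bounded_linear_left[of d]] by (simp add: o_def)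
    have "(\<Sum>c\<in>Basis. (integral (cbox a b) (q'' x)) c c) = (\<Sum>c\<in>Basis. integral (cbox a b) (\<lambda>t. q'' x t c c))"
      by (simp add: blinfun_apply_integral i1 i2)
    also have "\<dots> = integral (cbox a b) (\<lambda>t. \<Sum>c\<in>Basis. q'' x t c c)"
      by (rule integral_sum[symmetric]) (auto intro: i3)
    also have "\<dots> = integral (cbox a b) (\<lambda>t. 0)"
      by (rule Henstock_Kurzweil_Integration.integral_cong) (use tr x in auto)
    finally show "(\<Sum>c\<in>Basis. (integral (cbox a b) (q'' x)) c c) = 0" by simp
  next
    show "continuous_on U (\<lambda>x. integral (cbox a b) (q'' x))"
      by (rule integral_continuous_on_param[OF c2])
  qed (fact U)
qed

section \<open>Spherical means\<close>

text \<open>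
  The normalised surface measure of the unit sphere is realised inside Lebesgue measure: a radial weight
  on the shell \<open>1/2 < norm y < 1\<close> is pushed forward along \<open>y / norm y\<close>. Any integrable radial weight of
  positive mass gives the same spherical mean. This one is continuous and vanishes where the radial projection is singular, so that
  the integrands stay continuous on a box.
\<close>
definition shell_weight :: "'a::euclidean_space \<Rightarrow> real" where
  "shell_weight y = max 0 ((norm y - 1/2) * (1 - norm y))"

text \<open>
  The norm is bounded below by 1/2 in the denominator so that the map is continuous everywhere; it is the
  radial projection on the support of \<open>shell_weight\<close>, and it maps into the closed unit ball.
\<close>
definition to_sphere :: "'a::euclidean_space \<Rightarrow> 'a" where
  "to_sphere y = y /\<^sub>R max (norm y) (1/2)"

definition shell_mass :: "'a::euclidean_space itself \<Rightarrow> real" where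
  "shell_mass _ = (LINT y|lborel. shell_weight (y::'a))"

definition sphere_mean :: "('a::euclidean_space \<Rightarrow> real) \<Rightarrow> real" where
  "sphere_mean f = (LINT y|lborel. shell_weight y * f (to_sphere y)) / shell_mass TYPE('a)"

lemma continuous_shell_weight: "continuous_on S shell_weight"
  unfolding shell_weight_def[abs_def] by (intro continuous_intros)

lemma continuous_to_sphere: "continuous_on S to_sphere"
  unfolding to_sphere_def[abs_def] by (intro continuous_intros) auto

lemma borel_measurable_shell_weight [measurable]: "shell_weight \<in> borel_measurable borel"
  using continuous_shell_weight by (rule borel_measurable_continuous_onI)

lemma borel_measurable_to_sphere [measurable]: "to_sphere \<in> borel_measurable borel"
  using continuous_to_sphere by (rule borel_measurable_continuous_onI)

lemma shell_weight_nonneg: "shell_weight y \<ge> 0"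
  by (simp add: shell_weight_def)

lemma shell_weight_pos_iff: "shell_weight y > 0 \<longleftrightarrow> 1/2 < norm y \<and> norm y < 1"
  by (auto simp: shell_weight_def zero_less_mult_iff less_max_iff_disj)

lemma shell_weight_eq_0: "norm y \<ge> 1 \<Longrightarrow> shell_weight y = 0"
  using shell_weight_pos_iff[of y] shell_weight_nonneg[of y] by linarith

lemma norm_to_sphere: "shell_weight y \<noteq> 0 \<Longrightarrow> norm (to_sphere y) = 1"
  using shell_weight_pos_iff[of y] shell_weight_nonneg[of y] by (simp add: to_sphere_def max_def) (metis left_inverse norm_zero less_asym less_numeral_extra(3) mult_zero_left zero_less_one norm_ge_zero not_less)

lemma norm_to_sphere_le: "norm (to_sphere y) \<le> 1"
  by (auto simp: to_sphere_def field_simps max_def)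

lemma integrable_shell_weight: "integrable lborel (shell_weight :: 'a::euclidean_space \<Rightarrow> real)"
proof -
  have "set_integrable lborel (cball 0 1) (shell_weight :: 'a \<Rightarrow> real)"
    unfolding set_integrable_def by (rule borel_integrable_compact) (auto intro: continuous_shell_weight)
  then have "integrable lborel (\<lambda>y::'a. indicator (cball 0 1) y * shell_weight y)"
    by (simp add: set_integrable_def)
  also have "(\<lambda>y::'a. indicator (cball 0 1) y * shell_weight y) = shell_weight"
    by (auto simp: indicator_def shell_weight_eq_0 fun_eq_iff)
  finally show ?thesis .
qed

lemma shell_mass_pos: "shell_mass TYPE('a::euclidean_space) > 0"
proof -
  have "(LINT y|lborel. shell_weight (y::'a)) \<noteq> 0"
  proof
    assume "(LINT y|lborel. shell_weight (y::'a)) = 0"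
    then have "AE y in lborel. shell_weight (y::'a) = 0"
      using integral_nonneg_eq_0_iff_AE[OF integrable_shell_weight] shell_weight_nonneg by auto
    then have n: "{y::'a. shell_weight y \<noteq> 0} \<in> null_sets lborel"
      by (subst (asm) AE_iff_null) auto
    obtain b :: 'a where b: "b \<in> Basis" using nonempty_Basis by blast
    have "open {y::'a. shell_weight y \<noteq> 0}"
      using open_Collect_neq[OF continuous_shell_weight[of UNIV] continuous_on_const, of 0] by simp
    moreover have "(3/4) *\<^sub>R b \<in> {y::'a. shell_weight y \<noteq> 0}" using b
      by (simp add: shell_weight_def)
    ultimately have "\<not> negligible {y::'a. shell_weight y \<noteq> 0}"
      using open_not_negligible by blast
    then show False using n by (simp add: negligible_iff_null_sets null_sets_completionI)
  qed
  then show ?thesis unfolding shell_mass_def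
    using Bochner_Integration.integral_nonneg[of lborel "shell_weight::'a\<Rightarrow>real"] shell_weight_nonneg by fastforce
qed

text \<open>
  The class of integrands is described through \<open>to_sphere\<close> because functions that are merely defined and
  continuous on the closed ball have to belong to it.
\<close>
definition sphere_bounded :: "('a::euclidean_space \<Rightarrow> real) \<Rightarrow> bool" where
  "sphere_bounded f \<longleftrightarrow> (\<lambda>y. f (to_sphere y)) \<in> borel_measurable borel \<and> (\<exists>M. \<forall>z. norm z = 1 \<longrightarrow> \<bar>f z\<bar> \<le> M)"

lemma integrable_shell_weight_mult:
  assumes [measurable]: "(\<lambda>y::'a::euclidean_space. f (to_sphere y)) \<in> borel_measurable borel" and M: "\<And>z. norm z = 1 \<Longrightarrow> \<bar>f z\<bar> \<le> M"
  shows "integrable lborel (\<lambda>y. shell_weight y * f (to_sphere y))"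
proof (rule Bochner_Integration.integrable_bound)
  show "integrable lborel (\<lambda>y::'a. shell_weight y * M)"
    using integrable_shell_weight by (rule integrable_mult_left)
  show "(\<lambda>y. shell_weight y * f (to_sphere y)) \<in> borel_measurable lborel"
    by measurable
  show "AE y in lborel. norm (shell_weight y * f (to_sphere y)) \<le> norm (shell_weight y * M)"
  proof (intro AE_I2)
    fix y :: 'a
    show "norm (shell_weight y * f (to_sphere y)) \<le> norm (shell_weight y * M)"
      using M[OF norm_to_sphere[of y]] shell_weight_nonneg[of y]
      by (cases "shell_weight y = 0") (auto simp: abs_mult intro!: mult_left_mono)
  qed
qed

lemma integrable_sphere_bounded:
  "sphere_bounded f \<Longrightarrow> integrable lborel (\<lambda>y. shell_weight y * f (to_sphere y))"
  using integrable_shell_weight_mult unfolding sphere_bounded_def by blast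

lemma sphere_bounded_mult:
  assumes "sphere_bounded f" "sphere_bounded g" shows "sphere_bounded (\<lambda>z. f z * g z)"
proof -
  obtain M N where M: "\<And>z. norm z = 1 \<Longrightarrow> \<bar>f z\<bar> \<le> M" "\<And>z. norm z = 1 \<Longrightarrow> \<bar>g z\<bar> \<le> N"
    using assms unfolding sphere_bounded_def by metis
  have "\<bar>f z * g z\<bar> \<le> \<bar>M\<bar> * \<bar>N\<bar>" if "norm z = 1" for z
    unfolding abs_mult by (intro mult_mono) (use M[OF that] in auto)
  then show ?thesis using assms unfolding sphere_bounded_def by auto
qed

lemma sphere_bounded_add:
  assumes "sphere_bounded f" "sphere_bounded g" shows "sphere_bounded (\<lambda>z. f z + g z)"
proof -
  obtain M N where M: "\<And>z. norm z = 1 \<Longrightarrow> \<bar>f z\<bar> \<le> M" "\<And>z. norm z = 1 \<Longrightarrow> \<bar>g z\<bar> \<le> N"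
    using assms unfolding sphere_bounded_def by metis
  have "\<bar>f z + g z\<bar> \<le> M + N" if "norm z = 1" for z
    using M[OF that] by linarith
  then show ?thesis using assms unfolding sphere_bounded_def by auto
qed

lemma sphere_bounded_const: "sphere_bounded (\<lambda>z. c)"
  unfolding sphere_bounded_def by auto

lemma sphere_bounded_diff:
  assumes "sphere_bounded f" "sphere_bounded g" shows "sphere_bounded (\<lambda>z. f z - g z)"
  using sphere_bounded_add[OF assms(1) sphere_bounded_mult[OF sphere_bounded_const[of "-1"] assms(2)]] by simp

lemma sphere_bounded_indicator:
  assumes [measurable]: "A \<in> sets borel" shows "sphere_bounded (indicator A)"
  unfolding sphere_bounded_def by (auto intro!: exI[of _ 1] simp: indicator_def) 

lemma continuous_on_to_sphere:
  "continuous_on (cball 0 1) g \<Longrightarrow> continuous_on S (\<lambda>y. g (to_sphere y))"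
  by (rule continuous_on_compose2[OF _ continuous_to_sphere]) (auto simp: norm_to_sphere_le)

lemma sphere_bounded_continuous:
  fixes g :: "'a::euclidean_space \<Rightarrow> real"
  assumes g: "continuous_on (cball 0 1) g" shows "sphere_bounded g"
  unfolding sphere_bounded_def
proof
  show "(\<lambda>y. g (to_sphere y)) \<in> borel_measurable borel"
    by (rule borel_measurable_continuous_onI[OF continuous_on_to_sphere[OF g]])
  have "bounded (g ` cball 0 1)" by (rule compact_imp_bounded[OF compact_continuous_image[OF g compact_cball]])
  then show "\<exists>M. \<forall>z. norm z = 1 \<longrightarrow> \<bar>g z\<bar> \<le> M"
    unfolding bounded_iff by (metis imageI mem_cball_0 order_refl real_norm_def)
qed

lemma sphere_mean_add:
  assumes "sphere_bounded f" "sphere_bounded g"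
  shows "sphere_mean (\<lambda>z. f z + g z) = sphere_mean f + sphere_mean g"
  using integrable_sphere_bounded[OF assms(1)] integrable_sphere_bounded[OF assms(2)] unfolding sphere_mean_def
  by (simp add: distrib_left add_divide_distrib)

lemma sphere_mean_diff:
  assumes "sphere_bounded f" "sphere_bounded g"
  shows "sphere_mean (\<lambda>z. f z - g z) = sphere_mean f - sphere_mean g"
  using integrable_sphere_bounded[OF assms(1)] integrable_sphere_bounded[OF assms(2)] unfolding sphere_mean_def
  by (simp add: right_diff_distrib diff_divide_distrib)

lemma sphere_mean_cmult: "sphere_mean (\<lambda>z. c * f z) = c * sphere_mean f"
  unfolding sphere_mean_def by (simp add: mult.left_commute)

lemma sphere_mean_const: "sphere_mean (\<lambda>z::'a::euclidean_space. c) = c"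
  using shell_mass_pos[where 'a='a] by (simp add: sphere_mean_def shell_mass_def)

lemma sphere_mean_mono:
  assumes "sphere_bounded f" "sphere_bounded g" "\<And>z. norm z = 1 \<Longrightarrow> f z \<le> g z"
  shows "sphere_mean f \<le> sphere_mean (g :: 'a::euclidean_space \<Rightarrow> real)"
  unfolding sphere_mean_def
proof (intro divide_right_mono Bochner_Integration.integral_mono)
  show "integrable lborel (\<lambda>y. shell_weight y * f (to_sphere y))" "integrable lborel (\<lambda>y. shell_weight y * g (to_sphere y))"
    using assms integrable_shell_weight_mult unfolding sphere_bounded_def by blast+
  show "shell_weight y * f (to_sphere y) \<le> shell_weight y * g (to_sphere y)" for y
    using assms(3)[OF norm_to_sphere[of y]] shell_weight_nonneg[of y] 
    by (cases "shell_weight y = 0") (auto intro: mult_left_mono)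
qed (use shell_mass_pos[where 'a='a] in simp)

lemma sphere_mean_abs_le:
  assumes "sphere_bounded f" "sphere_bounded g" "\<And>z. norm z = 1 \<Longrightarrow> \<bar>f z\<bar> \<le> g z"
  shows "\<bar>sphere_mean f\<bar> \<le> sphere_mean (g :: 'a::euclidean_space \<Rightarrow> real)"
proof -
  have "sphere_bounded (\<lambda>z. -1 * f z)" using assms(1) unfolding sphere_bounded_def by auto
  from sphere_mean_mono[OF this assms(2)] sphere_mean_mono[OF assms(1,2)]
  have "sphere_mean (\<lambda>z. -1 * f z) \<le> sphere_mean g" "sphere_mean f \<le> sphere_mean g"
    using assms(3) by (auto simp: abs_le_iff)
  then show ?thesis unfolding sphere_mean_cmult by linarith
qed

lemma sphere_mean_tendsto:
  fixes g :: "nat \<Rightarrow> 'a::euclidean_space \<Rightarrow> real"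
  assumes g: "\<And>m. sphere_bounded (g m)" and h: "sphere_bounded h" and H: "sphere_bounded H"
    and bd: "\<And>m z. norm z = 1 \<Longrightarrow> \<bar>g m z\<bar> \<le> H z"
    and lim: "\<And>z. norm z = 1 \<Longrightarrow> (\<lambda>m. g m z) \<longlonglongrightarrow> h z"
  shows "(\<lambda>m. sphere_mean (g m)) \<longlonglongrightarrow> sphere_mean h"
  unfolding sphere_mean_def
proof (intro tendsto_divide tendsto_const)
  show "(\<lambda>m. LINT y|lborel. shell_weight y * g m (to_sphere y)) \<longlonglongrightarrow> (LINT y|lborel. shell_weight y * h (to_sphere y))"
  proof (rule integral_dominated_convergence)
    show "integrable lborel (\<lambda>y. shell_weight y * H (to_sphere y))" by (rule integrable_sphere_bounded[OF H])
    show "(\<lambda>y. shell_weight y * h (to_sphere y)) \<in> borel_measurable lborel"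
      using integrable_sphere_bounded[OF h] by blast
    show "(\<lambda>y. shell_weight y * g m (to_sphere y)) \<in> borel_measurable lborel" for m
      using integrable_sphere_bounded[OF g] by blast
    show "AE y in lborel. (\<lambda>m. shell_weight y * g m (to_sphere y)) \<longlonglongrightarrow> shell_weight y * h (to_sphere y)"
    proof (rule AE_I2)
      fix y :: 'a
      show "(\<lambda>m. shell_weight y * g m (to_sphere y)) \<longlonglongrightarrow> shell_weight y * h (to_sphere y)"
        using lim[OF norm_to_sphere[of y]] by (cases "shell_weight y = 0") (auto intro!: tendsto_intros)
    qed
    show "AE y in lborel. norm (shell_weight y * g m (to_sphere y)) \<le> shell_weight y * H (to_sphere y)" for m
    proof (rule AE_I2)
      fix y :: 'a
      show "norm (shell_weight y * g m (to_sphere y)) \<le> shell_weight y * H (to_sphere y)"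
        using bd[OF norm_to_sphere[of y]] shell_weight_nonneg[of y]
        by (cases "shell_weight y = 0") (auto simp: abs_mult intro!: mult_left_mono)
    qed
  qed
qed (use shell_mass_pos[where 'a='a] in simp)

text \<open>
  Rewriting the mean as a gauge integral over a box gives access to differentiation under the integral
  sign.
\<close>
lemma sphere_mean_eq_integral:
  fixes f :: "'a::euclidean_space \<Rightarrow> real"
  assumes f: "continuous_on (cball 0 1) f"
  shows "sphere_mean f = integral (cbox (-One) One) (\<lambda>y. f (to_sphere y) * (shell_weight y / shell_mass TYPE('a)))"
proof -
  let ?h = "\<lambda>y. shell_weight y * f (to_sphere y)"
  have c: "continuous_on (cbox (-One) One) ?h"
    by (intro continuous_intros continuous_shell_weight continuous_on_to_sphere f)
  have supp: "?h y = indicator (cbox (-One) One) y *\<^sub>R ?h y" for y :: 'a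
  proof (cases "y \<in> cbox (-One) One")
    case False
    then obtain i where i: "i \<in> Basis" "\<bar>y \<bullet> i\<bar> > 1" by (auto simp: mem_box abs_less_iff not_le)
    then have "norm y \<ge> 1" using Basis_le_norm[OF i(1), of y] by linarith
    then show ?thesis by (simp add: shell_weight_eq_0)
  qed simp
  have "(LINT y|lborel. ?h y) = (LINT y:cbox (-One) One|lborel. ?h y)"
    unfolding set_lebesgue_integral_def by (subst supp) simp
  also have "\<dots> = integral (cbox (-One) One) ?h"
    by (rule set_borel_integral_eq_integral(2))
       (unfold set_integrable_def, rule borel_integrable_compact[OF compact_cbox c])
  finally have "sphere_mean f = integral (cbox (-One) One) ?h / shell_mass TYPE('a)"
    by (simp only: sphere_mean_def)
  also have "\<dots> = integral (cbox (-One) One) (\<lambda>y. ?h y / shell_mass TYPE('a))"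
    by (rule integral_divide[symmetric])
  finally show ?thesis by (simp only: times_divide_eq_right mult.commute)
qed

section \<open>Rotation invariance\<close>

text \<open>
  The classical computation behind the uniqueness of Haar measure: translating first in \<open>y\<close> and then in
  \<open>x\<close> transforms \<open>f x * g y\<close> into \<open>f (x - y) * g x\<close>.
\<close>
lemma nn_integral_convolution_swap:
  fixes M :: "'a::euclidean_space measure"
  assumes [measurable_cong]: "sets M = sets borel" and "sigma_finite_measure M"
    and inv: "\<And>c. distr M borel ((+) c) = M"
    and [measurable]: "f \<in> borel_measurable borel" "g \<in> borel_measurable borel"
  shows "(\<integral>\<^sup>+x. f x \<partial>M) * (\<integral>\<^sup>+y. g y \<partial>lborel) = (\<integral>\<^sup>+x. g x \<partial>M) * (\<integral>\<^sup>+y. f (- y) \<partial>lborel)"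
proof -
  interpret M: sigma_finite_measure M by fact
  interpret pair_sigma_finite M lborel ..
  have trM: "(\<integral>\<^sup>+x. h (c + x) \<partial>M) = (\<integral>\<^sup>+x. h x \<partial>M)" if [measurable]: "h \<in> borel_measurable borel" for h c
    by (subst (2) inv[of c, symmetric]) (simp add: nn_integral_distr)
  have trL: "(\<integral>\<^sup>+x. h (c + x) \<partial>lborel) = (\<integral>\<^sup>+x. h x \<partial>lborel)" if [measurable]: "h \<in> borel_measurable borel" for h and c :: 'a
    by (subst (2) lborel_distr_plus[of c, symmetric]) (simp add: nn_integral_distr)
  have "(\<integral>\<^sup>+x. f x \<partial>M) * (\<integral>\<^sup>+y. g y \<partial>lborel) = (\<integral>\<^sup>+x. f x * (\<integral>\<^sup>+y. g (x + y) \<partial>lborel) \<partial>M)"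
    by (simp add: trL nn_integral_multc)
  also have "\<dots> = (\<integral>\<^sup>+x. (\<integral>\<^sup>+y. f x * g (x + y) \<partial>lborel) \<partial>M)"
    by (simp add: nn_integral_cmult)
  also have "\<dots> = (\<integral>\<^sup>+y. (\<integral>\<^sup>+x. f x * g (x + y) \<partial>M) \<partial>lborel)"
    by (rule Fubini'[symmetric]) measurable
  also have "\<dots> = (\<integral>\<^sup>+y. (\<integral>\<^sup>+x. f (- y + x) * g x \<partial>M) \<partial>lborel)"
  proof (rule nn_integral_cong)
    fix y :: 'a
    show "(\<integral>\<^sup>+x. f x * g (x + y) \<partial>M) = (\<integral>\<^sup>+x. f (- y + x) * g x \<partial>M)"
      using trM[of "\<lambda>x. f x * g (x + y)" "- y"] by simp
  qed
  also have "\<dots> = (\<integral>\<^sup>+x. (\<integral>\<^sup>+y. f (- y + x) * g x \<partial>lborel) \<partial>M)"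
    by (rule Fubini') measurable
  also have "\<dots> = (\<integral>\<^sup>+x. g x * (\<integral>\<^sup>+y. f (- y) \<partial>lborel) \<partial>M)"
  proof (rule nn_integral_cong)
    fix x :: 'a
    have "(\<integral>\<^sup>+y. f (- y + x) * g x \<partial>lborel) = g x * (\<integral>\<^sup>+y. f (- y + x) \<partial>lborel)"
      by (simp add: nn_integral_cmult mult.commute)
    also have "(\<integral>\<^sup>+y. f (- y + x) \<partial>lborel) = (\<integral>\<^sup>+y. f (- y) \<partial>lborel)"
      using trL[of "\<lambda>y. f (- y)" "- x"] by (simp add: add.commute)
    finally show "(\<integral>\<^sup>+y. f (- y + x) * g x \<partial>lborel) = g x * (\<integral>\<^sup>+y. f (- y) \<partial>lborel)" .
  qed
  also have "\<dots> = (\<integral>\<^sup>+x. g x \<partial>M) * (\<integral>\<^sup>+y. f (- y) \<partial>lborel)"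
    by (simp add: nn_integral_multc)
  finally show ?thesis .
qed

text \<open>
  Comparing the swap identity for the given measure with the same identity for Lebesgue measure, with
  \<open>g\<close> the indicator of the unit ball, leaves no freedom but a constant, which the ball fixes.
\<close>
lemma translation_invariant_eq_lborel:
  fixes M :: "'a::euclidean_space measure"
  assumes sM: "sets M = sets borel" and sf: "sigma_finite_measure M"
    and inv: "\<And>c. distr M borel ((+) c) = M"
    and ball: "emeasure M (ball 0 1) = emeasure lborel (ball (0::'a) 1)"
  shows "M = lborel"
proof (rule measure_eqI)
  fix A assume "A \<in> sets M"
  then have A[measurable]: "A \<in> sets borel" using sM by simp
  let ?B = "ball (0::'a) 1"
  let ?c = "emeasure lborel ?B" and ?N = "\<integral>\<^sup>+y. indicator A (- y :: 'a) \<partial>lborel"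
  have c: "?c \<noteq> 0" "?c \<noteq> \<infinity>"
    using open_not_negligible[of ?B] emeasure_bounded_finite[of ?B]
    by (auto simp: negligible_iff_null_sets null_sets_def null_sets_completionI)
  have "emeasure M A * ?c = emeasure M ?B * ?N"
    using nn_integral_convolution_swap[OF sM sf inv, of "indicator A" "indicator ?B"] sM by (simp add: borel_measurable_indicator)
  then have 1: "emeasure M A * ?c = ?c * ?N" using ball by simp
  have "emeasure lborel A * ?c = ?c * ?N"
    using nn_integral_convolution_swap[OF sets_lborel sigma_finite_lborel lborel_distr_plus, of "indicator A" "indicator ?B"] by (simp add: borel_measurable_indicator)
  with 1 c show "emeasure M A = emeasure lborel A"
    by (simp add: mult.commute[of _ ?c] ennreal_mult_cancel_left)
qed (simp add: sM)

text \<open>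
  The image of Lebesgue measure under a linear isometry is again translation invariant, and the unit ball
  is its own preimage.
\<close>
lemma lborel_distr_orthogonal:
  fixes T :: "'a::euclidean_space \<Rightarrow> 'a"
  assumes T: "orthogonal_transformation T"
  shows "distr lborel borel T = lborel"
proof (rule translation_invariant_eq_lborel)
  have lin: "linear T" using T orthogonal_transformation_linear by blast
  have m[measurable]: "T \<in> borel_measurable borel"
    using lin by (intro borel_measurable_continuous_onI linear_continuous_on linear_conv_bounded_linear[THEN iffD1])
  have nT: "norm (T y) = norm y" for y using T orthogonal_transformation_norm by blast
  have vb: "T -` ball 0 r = ball 0 r" for r by (auto simp: nT)
  then show "emeasure (distr lborel borel T) (ball 0 1) = emeasure lborel (ball (0::'a) 1)"
    by (simp add: emeasure_distr)
  show "sigma_finite_measure (distr lborel borel T)"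
  proof
    show "\<exists>A. countable A \<and> A \<subseteq> sets (distr lborel borel T) \<and> \<Union> A = space (distr lborel borel T) \<and>
      (\<forall>a\<in>A. emeasure (distr lborel borel T) a \<noteq> \<infinity>)"
    proof (intro exI[of _ "range (\<lambda>n::nat. ball 0 (real n))"] conjI)
      show "\<Union> (range (\<lambda>n::nat. ball 0 (real n))) = space (distr lborel borel T)"
        using reals_Archimedean2 by (auto simp: Bex_def)
      show "\<forall>a\<in>range (\<lambda>n::nat. ball 0 (real n)). emeasure (distr lborel borel T) a \<noteq> \<infinity>"
        using emeasure_bounded_finite[OF bounded_ball] by (auto simp: emeasure_distr vb less_top[symmetric])
    qed auto
  qed
  show "distr (distr lborel borel T) borel ((+) c) = distr lborel borel T" for c
  proof -
    obtain d where d: "T d = c"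
      using T orthogonal_transformation_surj by (metis surjD)
    have "distr (distr lborel borel T) borel ((+) c) = distr lborel borel (\<lambda>y. c + T y)"
      by (simp add: distr_distr o_def)
    also have "(\<lambda>y. c + T y) = T \<circ> (+) d" using d linear_add[OF lin] by (auto simp: o_def)
    also have "distr lborel borel (T \<circ> (+) d) = distr (distr lborel borel ((+) d)) borel T"
      by (subst distr_distr) auto
    also have "\<dots> = distr lborel borel T" by (simp add: lborel_distr_plus)
    finally show ?thesis .
  qed
qed simp

lemma sphere_mean_rotate:
  fixes T :: "'a::euclidean_space \<Rightarrow> 'a"
  assumes T: "orthogonal_transformation T"
    and f[measurable]: "(\<lambda>y. f (to_sphere y)) \<in> borel_measurable borel"
  shows "sphere_mean (\<lambda>z. f (T z)) = sphere_mean f"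
proof -
  have lin: "linear T" using T orthogonal_transformation_linear by blast
  have m[measurable]: "T \<in> borel_measurable borel"
    using lin by (intro borel_measurable_continuous_onI linear_continuous_on linear_conv_bounded_linear[THEN iffD1])
  have nT: "norm (T y) = norm y" for y using T orthogonal_transformation_norm by blast
  have "(LINT y|lborel. shell_weight y * f (to_sphere y)) = (LINT y|distr lborel borel T. shell_weight y * f (to_sphere y))"
    using lborel_distr_orthogonal[OF T] by simp
  also have "\<dots> = (LINT y|lborel. shell_weight (T y) * f (to_sphere (T y)))"
    by (subst integral_distr) auto
  also have "\<dots> = (LINT y|lborel. shell_weight y * f (T (to_sphere y)))"
    by (simp add: shell_weight_def to_sphere_def nT linear_scale[OF lin])
  finally show ?thesis by (simp add: sphere_mean_def)
qed

section \<open>Means of zonal functions\<close>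

lemma nn_integral_split_axis:
  fixes g :: "'a::euclidean_space \<Rightarrow> ennreal"
  assumes b: "b \<in> Basis" and [measurable]: "g \<in> borel_measurable borel"
  shows "(\<integral>\<^sup>+y. g y \<partial>lborel) =
    (\<integral>\<^sup>+f. (\<integral>\<^sup>+s. g (s *\<^sub>R b + (\<Sum>i\<in>Basis - {b}. f i *\<^sub>R i)) \<partial>lborel) \<partial>(\<Pi>\<^sub>M i\<in>Basis - {b}. lborel))"
proof -
  interpret product_sigma_finite "\<lambda>_::'a. lborel :: real measure"
    by (simp add: product_sigma_finite_def sigma_finite_lborel)
  have ins: "insert b (Basis - {b}) = (Basis :: 'a set)" using b by auto
  have "(\<integral>\<^sup>+y. g y \<partial>lborel) = (\<integral>\<^sup>+f. g (\<Sum>i\<in>Basis. f i *\<^sub>R i) \<partial>(\<Pi>\<^sub>M i\<in>Basis. lborel))"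
    by (subst lborel_eq) (simp add: nn_integral_distr)
  also have "\<dots> = (\<integral>\<^sup>+f. (\<integral>\<^sup>+s. g (\<Sum>i\<in>Basis. (f(b := s)) i *\<^sub>R i) \<partial>lborel) \<partial>(\<Pi>\<^sub>M i\<in>Basis - {b}. lborel))"
    using product_nn_integral_insert[of "Basis - {b}" b "\<lambda>f. g (\<Sum>i\<in>Basis. f i *\<^sub>R i)"] 
    unfolding ins by simp
  also have "\<dots> = (\<integral>\<^sup>+f. (\<integral>\<^sup>+s. g (s *\<^sub>R b + (\<Sum>i\<in>Basis - {b}. f i *\<^sub>R i)) \<partial>lborel) \<partial>(\<Pi>\<^sub>M i\<in>Basis - {b}. lborel))"
  proof -
    have "(\<Sum>i\<in>Basis. (f(b := s)) i *\<^sub>R i) = s *\<^sub>R b + (\<Sum>i\<in>Basis - {b}. f i *\<^sub>R i)" for f s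
      by (subst sum.remove[OF finite_Basis b]) (auto intro!: sum.cong)
    then show ?thesis by simp
  qed
  finally show ?thesis .
qed

text \<open>
  Zonal functions are integrated in the slope coordinate \<open>t = (y \<bullet> b) / norm y'\<close>, where \<open>y'\<close> is the
  component of \<open>y\<close> orthogonal to \<open>b\<close>. For fixed \<open>y'\<close> one substitutes \<open>y \<bullet> b = t * norm y'\<close>; the remaining
  integral over \<open>y'\<close> depends on \<open>t\<close> only through the factor \<open>sqrt (1 + t^2)\<close> that multiplies \<open>norm y'\<close> in
  the weight, and scaling turns this into the power \<open>(1 + t^2) powr (- n / 2)\<close>. The constant is kept in
  the form of an integral over the whole space, where Lebesgue measure scales in the obvious way.
\<close>
lemma nn_integral_zonal:
  fixes \<phi> :: "real \<Rightarrow> ennreal"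
  assumes b: "b \<in> (Basis :: 'a::euclidean_space set)" and dim: "DIM('a) \<ge> 2"
    and \<phi>[measurable]: "\<phi> \<in> borel_measurable borel"
  shows "(\<integral>\<^sup>+y. ennreal (shell_weight y) * \<phi> (to_sphere y \<bullet> b) \<partial>(lborel :: 'a measure)) =
    (\<integral>\<^sup>+y. indicator {y. 0 < y \<bullet> b \<and> y \<bullet> b < norm (y - (y \<bullet> b) *\<^sub>R b)} y *
        ennreal (shell_weight (y - (y \<bullet> b) *\<^sub>R b)) \<partial>(lborel :: 'a measure)) *
    (\<integral>\<^sup>+t. \<phi> (t / sqrt (1 + t\<^sup>2)) * ennreal ((1 + t\<^sup>2) powr (- real DIM('a) / 2)) \<partial>lborel)"
    (is "?L = ?A * ?I")
proof -
  define W where "W \<rho> = ennreal (max 0 ((\<rho> - 1/2) * (1 - \<rho>)))" for \<rho> :: real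
  have [measurable]: "W \<in> borel_measurable borel" unfolding W_def[abs_def] by measurable
  have W: "ennreal (shell_weight y) = W (norm y)" for y :: 'a by (simp add: W_def shell_weight_def)
  define M' where "M' = (\<Pi>\<^sub>M i\<in>Basis - {b}. (lborel :: real measure))"
  define p where "p f = (\<Sum>i\<in>Basis - {b}. f i *\<^sub>R i)" for f :: "'a \<Rightarrow> real"
  have [measurable]: "p \<in> M' \<rightarrow>\<^sub>M borel" unfolding p_def[abs_def] M'_def by measurable
  interpret product_sigma_finite "\<lambda>_::'a. lborel :: real measure"
    by (simp add: product_sigma_finite_def sigma_finite_lborel)
  have sfM: "sigma_finite_measure M'"
    unfolding M'_def by (rule sigma_finite) simp
  interpret M': sigma_finite_measure M' by fact
  interpret P: pair_sigma_finite M' "lborel :: real measure" ..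
  have pb: "p f \<bullet> b = 0" for f unfolding p_def inner_sum_left
    by (rule sum.neutral) (use b in \<open>auto simp: inner_Basis\<close>)
  have bb: "b \<bullet> b = 1" "norm b = 1" by (rule inner_same_Basis[OF b], rule norm_Basis[OF b])
  have nrm: "norm (s *\<^sub>R b + p f) = sqrt (s\<^sup>2 + (norm (p f))\<^sup>2)" for s f
  proof -
    have bp: "b \<bullet> p f = 0" by (subst inner_commute) (rule pb)
    have "(s *\<^sub>R b + p f) \<bullet> (s *\<^sub>R b + p f) = s\<^sup>2 + p f \<bullet> p f"
      unfolding inner_add_left inner_add_right inner_scaleR_left inner_scaleR_right pb bp bb(1)
      by (simp only: mult_zero_right mult_1_right add_0_left add_0_right power2_eq_square)
    then show ?thesis by (simp only: power2_norm_eq_inner norm_eq_sqrt_inner[of "s *\<^sub>R b + p f"])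
  qed
  have inn: "(s *\<^sub>R b + p f) \<bullet> b = s" for s f
    unfolding inner_add_left inner_scaleR_left pb bb(1) by (simp only: mult_1_right add_0_right)
  have split: "(\<integral>\<^sup>+y. g y \<partial>lborel) = (\<integral>\<^sup>+f. (\<integral>\<^sup>+s. g (s *\<^sub>R b + p f) \<partial>lborel) \<partial>M')"
    if "g \<in> borel_measurable borel" for g
    using nn_integral_split_axis[OF b that] by (simp add: p_def M'_def)
  obtain b' where b': "b' \<in> Basis" "b' \<noteq> b"
  proof -
    have "\<not> Basis \<subseteq> {b}"
    proof
      assume "Basis \<subseteq> {b}"
      then have "DIM('a) \<le> card {b}" by (intro card_mono) auto
      then show False using dim by simp
    qed
    then show thesis using that by auto
  qed
  \<comment> \<open>In dimension at least 2 the axis is contained in a hyperplane, hence is a null set.\<close>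
  have ae: "AE f in M'. p f \<noteq> 0"
  proof -
    have "(\<integral>\<^sup>+y. indicator {y::'a. y - (y \<bullet> b) *\<^sub>R b = 0} y \<partial>lborel) = 0"
    proof -
      have "negligible {y::'a. b' \<bullet> y = 0}" by (rule negligible_hyperplane) (use b' in auto)
      moreover have "{y::'a. y - (y \<bullet> b) *\<^sub>R b = 0} \<subseteq> {y. b' \<bullet> y = 0}"
      proof safe
        fix y :: 'a assume "y - (y \<bullet> b) *\<^sub>R b = 0"
        then have "b' \<bullet> y = b' \<bullet> ((y \<bullet> b) *\<^sub>R b)" by simp
        then show "b' \<bullet> y = 0" using b b' by (simp add: inner_Basis)
      qed
      ultimately have "negligible {y::'a. y - (y \<bullet> b) *\<^sub>R b = 0}" using negligible_subset by blast
      then have "{y::'a. y - (y \<bullet> b) *\<^sub>R b = 0} \<in> null_sets lebesgue" by (simp add: negligible_iff_null_sets)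
      moreover have "{y::'a. y - (y \<bullet> b) *\<^sub>R b = 0} \<in> sets borel" by measurable
      ultimately show ?thesis by (simp add: null_sets_def)
    qed
    then have "(\<integral>\<^sup>+f. (\<integral>\<^sup>+s. indicator {f. p f = 0} f \<partial>(lborel :: real measure)) \<partial>M') = 0"
      by (subst (asm) split) (auto simp: inn indicator_def cong: if_cong)
    then have "AE f in M'. (\<integral>\<^sup>+s. indicator {f. p f = 0} f \<partial>(lborel :: real measure)) = 0"
      by (subst (asm) nn_integral_0_iff_AE) (auto simp: indicator_def)
    then show ?thesis by (rule AE_mp) (auto intro!: AE_I2 simp: indicator_def)
  qed
  \<comment> \<open>The factor \<open>norm (p f)\<close> is the length of the interval \<open>0 < s < norm (p f)\<close>, so the left side is an
    integral over the whole space and the scaling law applies.\<close>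
  have scale: "(\<integral>\<^sup>+f. ennreal (norm (p f)) * W (\<mu> * norm (p f)) \<partial>M') = ennreal (\<mu> powr (- real DIM('a))) * ?A"
    if \<mu>: "\<mu> > 0" for \<mu>
  proof -
    define h :: "'a \<Rightarrow> ennreal" where "h y = indicator {y. 0 < y \<bullet> b \<and> y \<bullet> b < norm (y - (y \<bullet> b) *\<^sub>R b)} y *
        W (norm (y - (y \<bullet> b) *\<^sub>R b))" for y
    have [measurable]: "h \<in> borel_measurable borel" unfolding h_def[abs_def] by measurable
    have A: "?A = (\<integral>\<^sup>+y. h y \<partial>lborel)" by (simp add: h_def W)
    have hl: "h (\<mu> *\<^sub>R (s *\<^sub>R b + p f)) = indicator {0<..<norm (p f)} s * W (\<mu> * norm (p f))" for s f
      using \<mu> by (auto simp: h_def inn indicator_def algebra_simps inner_add pb bb zero_less_mult_iff split: if_splits)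
    have "(\<integral>\<^sup>+y. h y \<partial>lborel) = ennreal (\<mu> ^ DIM('a)) * (\<integral>\<^sup>+y. h (\<mu> *\<^sub>R y) \<partial>lborel)"
      by (subst lborel_affine[of \<mu> 0])
         (use \<mu> in \<open>simp_all add: nn_integral_density nn_integral_distr nn_integral_cmult\<close>)
    also have "(\<integral>\<^sup>+y. h (\<mu> *\<^sub>R y) \<partial>lborel) = (\<integral>\<^sup>+f. (\<integral>\<^sup>+s. indicator {0<..<norm (p f)} s * W (\<mu> * norm (p f)) \<partial>lborel) \<partial>M')"
      by (subst split) (simp_all add: hl)
    also have "\<dots> = (\<integral>\<^sup>+f. ennreal (norm (p f)) * W (\<mu> * norm (p f)) \<partial>M')"
      by (simp add: nn_integral_multc)
    finally have "ennreal (\<mu> powr (- real DIM('a))) * ?A =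
        (ennreal (\<mu> powr (- real DIM('a))) * ennreal (\<mu> ^ DIM('a))) * (\<integral>\<^sup>+f. ennreal (norm (p f)) * W (\<mu> * norm (p f)) \<partial>M')"
      unfolding A by (simp add: mult.assoc)
    also have "ennreal (\<mu> powr (- real DIM('a))) * ennreal (\<mu> ^ DIM('a)) = 1"
      using \<mu> by (simp add: ennreal_mult[symmetric] powr_minus powr_realpow)
    finally show ?thesis by simp
  qed
  have inner_int: "(\<integral>\<^sup>+s. W (norm (s *\<^sub>R b + p f)) * \<phi> (s / norm (s *\<^sub>R b + p f)) \<partial>lborel) =
      (\<integral>\<^sup>+t. ennreal (norm (p f)) * W (sqrt (1 + t\<^sup>2) * norm (p f)) * \<phi> (t / sqrt (1 + t\<^sup>2)) \<partial>lborel)"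
    if "p f \<noteq> 0" for f
  proof -
    define \<rho> where "\<rho> = norm (p f)"
    have \<rho>: "\<rho> > 0" using that by (simp add: \<rho>_def)
    have sq: "sqrt ((\<rho> * t)\<^sup>2 + \<rho>\<^sup>2) = sqrt (1 + t\<^sup>2) * \<rho>" for t
    proof -
      have "(\<rho> * t)\<^sup>2 + \<rho>\<^sup>2 = (1 + t\<^sup>2) * \<rho>\<^sup>2" by (simp add: power2_eq_square algebra_simps)
      then show ?thesis using \<rho> by (simp add: real_sqrt_mult)
    qed
    have "(\<integral>\<^sup>+s. W (norm (s *\<^sub>R b + p f)) * \<phi> (s / norm (s *\<^sub>R b + p f)) \<partial>lborel) =
       (\<integral>\<^sup>+s. W (sqrt (s\<^sup>2 + \<rho>\<^sup>2)) * \<phi> (s / sqrt (s\<^sup>2 + \<rho>\<^sup>2)) \<partial>lborel)"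
      by (simp add: nrm \<rho>_def)
    also have "\<dots> = ennreal \<bar>\<rho>\<bar> * (\<integral>\<^sup>+t. W (sqrt ((0 + \<rho> * t)\<^sup>2 + \<rho>\<^sup>2)) * \<phi> ((0 + \<rho> * t) / sqrt ((0 + \<rho> * t)\<^sup>2 + \<rho>\<^sup>2)) \<partial>lborel)"
      by (rule nn_integral_real_affine) (measurable, use \<rho> in simp)
    also have "\<dots> = (\<integral>\<^sup>+t. ennreal \<rho> * W (sqrt (1 + t\<^sup>2) * \<rho>) * \<phi> (t / sqrt (1 + t\<^sup>2)) \<partial>lborel)"
      using \<rho> by (simp add: sq nn_integral_cmult mult.assoc)
    finally show ?thesis by (simp add: \<rho>_def)
  qed
  have "?L = (\<integral>\<^sup>+y. W (norm y) * \<phi> ((y \<bullet> b) / norm y) \<partial>(lborel :: 'a measure))"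
  proof (rule nn_integral_cong)
    fix y :: 'a
    show "ennreal (shell_weight y) * \<phi> (to_sphere y \<bullet> b) = W (norm y) * \<phi> ((y \<bullet> b) / norm y)"
    proof (cases "shell_weight y = 0")
      case False
      then have "shell_weight y > 0" using shell_weight_nonneg[of y] by simp
      then have "1/2 < norm y" by (simp only: shell_weight_pos_iff)
      then have "to_sphere y \<bullet> b = inverse (norm y) * (y \<bullet> b)"
        by (simp only: to_sphere_def inner_scaleR_left max.absorb1[OF less_imp_le])
      then have "to_sphere y \<bullet> b = (y \<bullet> b) / norm y"
        by (simp only: divide_inverse mult.commute)
      then show ?thesis by (simp only: W)
    qed (simp add: W[symmetric])
  qed
  also have "\<dots> = (\<integral>\<^sup>+f. (\<integral>\<^sup>+s. W (norm (s *\<^sub>R b + p f)) * \<phi> (s / norm (s *\<^sub>R b + p f)) \<partial>lborel) \<partial>M')"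
    by (subst split) (simp_all add: inn)
  also have "\<dots> = (\<integral>\<^sup>+f. (\<integral>\<^sup>+t. ennreal (norm (p f)) * W (sqrt (1 + t\<^sup>2) * norm (p f)) * \<phi> (t / sqrt (1 + t\<^sup>2)) \<partial>lborel) \<partial>M')"
    by (rule nn_integral_cong_AE) (use ae inner_int in auto)
  also have "\<dots> = (\<integral>\<^sup>+t. (\<integral>\<^sup>+f. ennreal (norm (p f)) * W (sqrt (1 + t\<^sup>2) * norm (p f)) * \<phi> (t / sqrt (1 + t\<^sup>2)) \<partial>M') \<partial>lborel)"
    by (rule P.Fubini'[symmetric]) measurable
  also have "\<dots> = (\<integral>\<^sup>+t. ennreal (sqrt (1 + t\<^sup>2) powr (- real DIM('a))) * ?A * \<phi> (t / sqrt (1 + t\<^sup>2)) \<partial>lborel)"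
  proof (rule nn_integral_cong)
    fix t :: real
    have "sqrt (1 + t\<^sup>2) > 0" by (simp add: add_pos_nonneg)
    from scale[OF this]
    show "(\<integral>\<^sup>+f. ennreal (norm (p f)) * W (sqrt (1 + t\<^sup>2) * norm (p f)) * \<phi> (t / sqrt (1 + t\<^sup>2)) \<partial>M') =
      ennreal (sqrt (1 + t\<^sup>2) powr (- real DIM('a))) * ?A * \<phi> (t / sqrt (1 + t\<^sup>2))"
      by (simp add: nn_integral_multc)
  qed
  also have "\<dots> = (\<integral>\<^sup>+t. ?A * (\<phi> (t / sqrt (1 + t\<^sup>2)) * ennreal ((1 + t\<^sup>2) powr (- real DIM('a) / 2))) \<partial>lborel)"
    by (simp add: powr_half_sqrt[symmetric] powr_powr mult_ac add_nonneg_nonneg)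
  also have "\<dots> = ?A * ?I" by (rule nn_integral_cmult) measurable
  finally show ?thesis .
qed

text \<open>
  Taking the quotient with the case \<open>\<phi> = 1\<close> eliminates the constant of the previous lemma. Only the total
  mass \<open>B\<close> of the density \<open>(1 + t^2) powr (- n / 2)\<close> remains.
\<close>
lemma sphere_mean_zonal:
  fixes \<phi> :: "real \<Rightarrow> real"
  assumes b: "b \<in> (Basis :: 'a::euclidean_space set)" and dim: "DIM('a) \<ge> 2"
    and \<phi>[measurable]: "\<phi> \<in> borel_measurable borel"
    and \<phi>0: "\<And>s. \<phi> s \<ge> 0" and bd: "\<And>s. \<bar>s\<bar> \<le> 1 \<Longrightarrow> \<phi> s \<le> M"
    and B: "(\<integral>\<^sup>+t. ennreal ((1 + t\<^sup>2) powr (- real DIM('a) / 2)) \<partial>lborel) = ennreal B" "B > 0"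
  shows "(\<integral>\<^sup>+t. ennreal (\<phi> (t / sqrt (1 + t\<^sup>2)) * (1 + t\<^sup>2) powr (- real DIM('a) / 2)) \<partial>lborel)
       = ennreal (B * sphere_mean (\<lambda>z::'a. \<phi> (z \<bullet> b)))"
proof -
  let ?w = "shell_weight :: 'a \<Rightarrow> real"
  have nn: "(\<integral>\<^sup>+y. ennreal (?w y) * ennreal (\<psi> (to_sphere y \<bullet> b)) \<partial>lborel) = ennreal (shell_mass TYPE('a) * sphere_mean (\<lambda>z::'a. \<psi> (z \<bullet> b)))"
    if [measurable]: "\<psi> \<in> borel_measurable borel" and \<psi>0: "\<And>s. \<psi> s \<ge> 0" and bd: "\<And>s. \<bar>s\<bar> \<le> 1 \<Longrightarrow> \<psi> s \<le> M" for \<psi> :: "real \<Rightarrow> real" and M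
  proof -
    have "integrable lborel (\<lambda>y. shell_weight y * \<psi> (to_sphere y \<bullet> b))"
    proof (rule integrable_shell_weight_mult[of "\<lambda>z. \<psi> (z \<bullet> b)" M])
      fix z :: 'a assume "norm z = 1"
      then have "\<bar>z \<bullet> b\<bar> \<le> 1" using Cauchy_Schwarz_ineq2[of z b] b by simp
      then show "\<bar>\<psi> (z \<bullet> b)\<bar> \<le> M" using bd \<psi>0 by simp
    qed measurable
    then have "(\<integral>\<^sup>+y. ennreal (shell_weight y * \<psi> (to_sphere y \<bullet> b)) \<partial>lborel) = ennreal (LINT y|lborel. shell_weight y * \<psi> (to_sphere y \<bullet> b))"
      by (rule nn_integral_eq_integral) (simp add: \<psi>0 shell_weight_nonneg)
    then show ?thesis using shell_mass_pos[where 'a='a]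
      by (simp add: sphere_mean_def ennreal_mult \<psi>0 shell_weight_nonneg)
  qed
  define A where "A = (\<integral>\<^sup>+y. indicator {y. 0 < y \<bullet> b \<and> y \<bullet> b < norm (y - (y \<bullet> b) *\<^sub>R b)} y *
        ennreal (?w (y - (y \<bullet> b) *\<^sub>R b)) \<partial>lborel)"
  let ?m = "shell_mass TYPE('a)" and ?S = "sphere_mean (\<lambda>z::'a. \<phi> (z \<bullet> b))"
  let ?I = "\<integral>\<^sup>+t. ennreal (\<phi> (t / sqrt (1 + t\<^sup>2)) * (1 + t\<^sup>2) powr (- real DIM('a) / 2)) \<partial>lborel"
  have m: "?m > 0" by (rule shell_mass_pos)
  have 1: "ennreal ?m = A * ennreal B"
    using nn_integral_zonal[OF b dim, of "\<lambda>_. 1"] nn[of "\<lambda>_. 1" 1] B(1)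
    by (simp add: A_def sphere_mean_const)
  have 2: "ennreal (?m * ?S) = A * ?I"
    using nn_integral_zonal[OF b dim, of "\<lambda>s. ennreal (\<phi> s)"] nn[of \<phi> M] \<phi>0 bd
    by (simp add: A_def ennreal_mult)
  have A: "A \<noteq> 0" "A \<noteq> \<infinity>"
    using 1 m B(2) by (auto simp: ennreal_top_mult)
  have "?S \<ge> 0" unfolding sphere_mean_def
    by (intro divide_nonneg_pos Bochner_Integration.integral_nonneg mult_nonneg_nonneg shell_weight_nonneg \<phi>0 m)
  then have "A * ?I = A * ennreal (B * ?S)"
    using 1 2 m B(2) by (simp add: ennreal_mult mult.assoc)
  then show ?thesis using A by (simp add: ennreal_mult_cancel_left)
qed

section \<open>The Poisson kernel\<close>

text \<open>
  For \<open>norm z = 1\<close> this is the Poisson kernel \<open>(1 - norm x ^ 2) / norm (x - z) ^ n\<close>. Written in this form it is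
  smooth in \<open>x\<close> even for \<open>z\<close> in the interior of the ball, where \<open>norm (x - z)\<close> could vanish.
\<close>
definition poisson_kernel :: "'a::euclidean_space \<Rightarrow> 'a \<Rightarrow> real" where
  "poisson_kernel x z = (1 - x \<bullet> x) * (1 + x \<bullet> x - 2 * (x \<bullet> z)) powr (- real DIM('a) / 2)"

lemma poisson_denominator_bound:
  fixes x z :: "'a::euclidean_space"
  assumes "norm z \<le> 1"
  shows "(1 - norm x)\<^sup>2 \<le> 1 + x \<bullet> x - 2 * (x \<bullet> z)"
proof -
  have "x \<bullet> z \<le> norm x * norm z" using Cauchy_Schwarz_ineq2[of x z] by simp
  also have "\<dots> \<le> norm x" using assms by (simp add: mult_left_le)
  finally show ?thesis by (simp add: power2_eq_square algebra_simps flip: power2_norm_eq_inner)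
qed

lemma poisson_denominator_pos:
  fixes x z :: "'a::euclidean_space"
  assumes "norm x < 1" "norm z \<le> 1"
  shows "0 < 1 + x \<bullet> x - 2 * (x \<bullet> z)"
proof -
  have "0 < (1 - norm x)\<^sup>2" using assms by simp
  then show ?thesis using poisson_denominator_bound[OF assms(2), of x] by linarith
qed

lemma poisson_kernel_nonneg: "norm x < 1 \<Longrightarrow> poisson_kernel x z \<ge> 0"
  unfolding poisson_kernel_def
  by (intro mult_nonneg_nonneg) (simp_all add: dot_square_norm abs_square_le_1 power_le_one)

lemma poisson_kernel_0 [simp]: "poisson_kernel 0 z = 1"
  by (simp add: poisson_kernel_def)

lemma continuous_poisson_kernel:
  "continuous_on (ball 0 1 \<times> cball 0 1) (\<lambda>(x, z). poisson_kernel x (z::'a::euclidean_space))"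
  unfolding poisson_kernel_def case_prod_beta
  using poisson_denominator_pos
  by (intro continuous_intros) (fastforce simp: less_imp_neq[symmetric])

text \<open>
  With \<open>E = 1 - x \<bullet> x\<close>, \<open>D = 1 + x \<bullet> x - 2 * (x \<bullet> z)\<close> and \<open>a = - n / 2\<close> the kernel is \<open>E * D powr a\<close>, and its
  gradient is a combination \<open>\<alpha> x + \<beta> z\<close>. On the sphere \<open>norm z = 1\<close> the squared norm of the gradient of \<open>D\<close> is
  \<open>4 * D\<close>. Together with \<open>2 * (x \<bullet> x - x \<bullet> z) = D - E\<close> and the choice of the exponent this makes the trace of the
  second derivative vanish.
\<close>
lemma poisson_kernel_derivatives:
  obtains q' :: "'a \<Rightarrow> 'a \<Rightarrow> 'a::euclidean_space \<Rightarrow>\<^sub>L real" and q'' :: "'a \<Rightarrow> 'a \<Rightarrow> 'a \<Rightarrow>\<^sub>L 'a \<Rightarrow>\<^sub>L real"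
  where "\<And>x z. norm x < 1 \<Longrightarrow> norm z \<le> 1 \<Longrightarrow> ((\<lambda>x. poisson_kernel x z) has_derivative q' x z) (at x)"
    and "\<And>x z. norm x < 1 \<Longrightarrow> norm z \<le> 1 \<Longrightarrow> ((\<lambda>x. q' x z) has_derivative q'' x z) (at x)"
    and "continuous_on (ball 0 1 \<times> cball 0 1) (\<lambda>(x, z). q' x z)"
    and "continuous_on (ball 0 1 \<times> cball 0 1) (\<lambda>(x, z). q'' x z)"
    and "\<And>x z. norm x < 1 \<Longrightarrow> norm z = 1 \<Longrightarrow> (\<Sum>b\<in>Basis. q'' x z b b) = 0"
proof -
  define a where "a = - real DIM('a) / 2"
  define D where "D x z = 1 + x \<bullet> x - 2 * (x \<bullet> z)" for x z :: 'a
  define E where "E x = 1 - x \<bullet> x" for x :: 'a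
  define \<alpha> where "\<alpha> x z = - 2 * D x z powr a + 2 * a * E x * D x z powr (a - 1)" for x z
  define \<beta> where "\<beta> x z = - 2 * a * E x * D x z powr (a - 1)" for x z
  define dD where "dD x z k = 2 * (x \<bullet> k) - 2 * (z \<bullet> k)" for x z k :: 'a
  define d\<alpha> where "d\<alpha> x z k = - 2 * a * D x z powr (a - 1) * dD x z k - 4 * a * (x \<bullet> k) * D x z powr (a - 1)
     + 2 * a * E x * ((a - 1) * D x z powr (a - 2) * dD x z k)" for x z k
  define d\<beta> where "d\<beta> x z k = 4 * a * (x \<bullet> k) * D x z powr (a - 1) - 2 * a * E x * ((a - 1) * D x z powr (a - 2) * dD x z k)" for x z k
  define q' where "q' x z = \<alpha> x z *\<^sub>R blinfun_inner_right x + \<beta> x z *\<^sub>R blinfun_inner_right z" for x z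
  define q'' where "q'' x z = Blinfun (\<lambda>k. d\<alpha> x z k *\<^sub>R blinfun_inner_right x + \<alpha> x z *\<^sub>R blinfun_inner_right k
     + d\<beta> x z k *\<^sub>R blinfun_inner_right z)" for x z
  have Dpos: "D x z > 0" if "norm x < 1" "norm z \<le> 1" for x z
    using poisson_denominator_pos[OF that] by (simp add: D_def)
  have dDd: "((\<lambda>x. D x z) has_derivative (\<lambda>k. dD x z k)) (at x)" for x z
    unfolding D_def dD_def by (auto intro!: derivative_eq_intros simp: inner_commute algebra_simps)
  have dE: "(E has_derivative (\<lambda>k. - 2 * (x \<bullet> k))) (at x)" for x
    unfolding E_def[abs_def] by (auto intro!: derivative_eq_intros simp: inner_commute algebra_simps)
  have dP: "((\<lambda>x. D x z powr c) has_derivative (\<lambda>k. c * D x z powr (c - 1) * dD x z k)) (at x)"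
    if "norm x < 1" "norm z \<le> 1" for x z c
  proof -
    have "((\<lambda>t. t powr c) has_real_derivative c * D x z powr (c - 1)) (at (D x z))"
      by (rule has_real_derivative_powr) (rule Dpos[OF that])
    from has_derivative_compose[OF dDd this[unfolded has_field_derivative_def]]
    show ?thesis .
  qed
  have d\<alpha>: "((\<lambda>x. \<alpha> x z) has_derivative d\<alpha> x z) (at x)" if "norm x < 1" "norm z \<le> 1" for x z
    unfolding \<alpha>_def d\<alpha>_def[abs_def]
    apply (rule has_derivative_eq_rhs)
     apply (rule has_derivative_add has_derivative_mult has_derivative_const dE dP[OF that])+
    apply (simp add: fun_eq_iff algebra_simps)
    done
  have d\<beta>: "((\<lambda>x. \<beta> x z) has_derivative d\<beta> x z) (at x)" if "norm x < 1" "norm z \<le> 1" for x z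
    unfolding \<beta>_def d\<beta>_def[abs_def]
    apply (rule has_derivative_eq_rhs)
     apply (rule has_derivative_mult has_derivative_const dE dP[OF that])+
    apply (simp add: fun_eq_iff algebra_simps)
    done
  have lin: "bounded_linear (\<lambda>k. d\<alpha> x z k *\<^sub>R blinfun_inner_right x + \<alpha> x z *\<^sub>R blinfun_inner_right k
     + d\<beta> x z k *\<^sub>R blinfun_inner_right z)" for x z
    unfolding d\<alpha>_def d\<beta>_def dD_def
    by (intro bounded_linear_add bounded_linear_sub bounded_linear_scaleR_const bounded_linear_const_scaleR
        bounded_linear_blinfun_inner_right bounded_linear_mult_const bounded_linear_const_mult bounded_linear_inner_right bounded_linear_ident)
  have q''_apply: "blinfun_apply (q'' x z) k = d\<alpha> x z k *\<^sub>R blinfun_inner_right x + \<alpha> x z *\<^sub>R blinfun_inner_right k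
     + d\<beta> x z k *\<^sub>R blinfun_inner_right z" for x z k
    unfolding q''_def by (subst bounded_linear_Blinfun_apply[OF lin]) simp
  have cD: "continuous_on (ball 0 1 \<times> cball 0 1) (\<lambda>p. D (fst p) (snd p) powr c)" for c
    unfolding D_def using poisson_denominator_pos
    by (intro continuous_intros) (fastforce simp: less_imp_neq[symmetric])
  have cE: "continuous_on S (\<lambda>p. E (fst p))" for S :: "('a \<times> 'a) set"
    unfolding E_def by (intro continuous_intros)
  have ci: "continuous_on S (\<lambda>p. blinfun_inner_right (h p))" if "continuous_on S h" for S :: "('a \<times> 'a) set" and h :: "_ \<Rightarrow> 'a"
    using bounded_linear.continuous_on[OF bounded_linear_blinfun_inner_right that] .
  have ca: "continuous_on (ball 0 1 \<times> cball 0 1) (\<lambda>p. \<alpha> (fst p) (snd p))"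
    "continuous_on (ball 0 1 \<times> cball 0 1) (\<lambda>p. \<beta> (fst p) (snd p))"
    unfolding \<alpha>_def \<beta>_def by (intro continuous_intros cD cE)+
  show thesis
  proof (rule that[of q' q''])
    fix x z :: 'a assume xz: "norm x < 1" "norm z \<le> 1"
    have "((\<lambda>x. E x * D x z powr a) has_derivative
       (\<lambda>k. E x * (a * D x z powr (a - 1) * dD x z k) + (- 2 * (x \<bullet> k)) * D x z powr a)) (at x)"
      by (rule has_derivative_mult[OF dE dP[OF xz]])
    moreover have "(\<lambda>k. E x * (a * D x z powr (a - 1) * dD x z k) + (- 2 * (x \<bullet> k)) * D x z powr a) = blinfun_apply (q' x z)"
      by (rule ext) (simp only: q'_def \<alpha>_def \<beta>_def dD_def blinfun.add_left blinfun.scaleR_left blinfun_inner_right.rep_eq real_scaleR_def, simp add: algebra_simps)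
    moreover have "poisson_kernel x z = E x * D x z powr a" for x
      by (simp add: poisson_kernel_def E_def D_def a_def)
    ultimately show "((\<lambda>x. poisson_kernel x z) has_derivative q' x z) (at x)" by simp
    have dI: "(blinfun_inner_right has_derivative blinfun_inner_right) (at x)"
      by (rule bounded_linear_imp_has_derivative[OF bounded_linear_blinfun_inner_right])
    show "((\<lambda>x. q' x z) has_derivative q'' x z) (at x)"
      unfolding q'_def
      apply (rule has_derivative_eq_rhs)
       apply (rule has_derivative_add has_derivative_scaleR d\<alpha>[OF xz] d\<beta>[OF xz] has_derivative_const dI)+
      apply (simp add: fun_eq_iff q''_apply algebra_simps)
      done
  next
    show "continuous_on (ball 0 1 \<times> cball 0 1) (\<lambda>(x, z). q' x z)"
      unfolding q'_def case_prod_beta by (intro continuous_intros ca ci)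
    show "continuous_on (ball 0 1 \<times> cball 0 1) (\<lambda>(x, z). q'' x z)"
      unfolding case_prod_beta
    proof (rule continuous_on_blinfun_componentwise)
      fix i :: 'a
      show "continuous_on (ball 0 1 \<times> cball 0 1) (\<lambda>p. blinfun_apply (q'' (fst p) (snd p)) i)"
        unfolding q''_apply d\<alpha>_def d\<beta>_def dD_def
          by (intro continuous_on_add continuous_on_diff continuous_on_scaleR continuous_on_mult continuous_on_const
              continuous_on_inner continuous_on_fst continuous_on_snd continuous_on_id ca ci cD cE)
    qed
  next
    fix x z :: 'a assume x: "norm x < 1" and z: "norm z = 1"
    define n where "n = real DIM('a)"
    have an: "a = - n / 2" by (simp add: a_def n_def)
    define P where "P = D x z powr (a - 2)"
    have D0: "D x z > 0" using Dpos x z by simp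
    have P1: "D x z powr (a - 1) = D x z * P"
      using powr_add[of "D x z" "a - 2" 1] D0 by (simp add: P_def mult.commute)
    have P0: "D x z powr a = D x z * (D x z * P)"
      using powr_add[of "D x z" "a - 1" 1] D0 by (simp add: P1 mult.commute)
    have zz: "z \<bullet> z = 1" using z by (simp add: dot_square_norm)
    have s: "(\<Sum>b\<in>Basis. (u \<bullet> b) * (v \<bullet> b)) = u \<bullet> v" for u v :: 'a
      by (rule euclidean_inner[symmetric])
    have lin1: "d\<alpha> x z b = A1 * (x \<bullet> b) + A2 * (z \<bullet> b)" 
      if "A1 = - 8 * a * (D x z * P) + 4 * a * E x * (a - 1) * P" "A2 = 4 * a * (D x z * P) - 4 * a * E x * (a - 1) * P" for b A1 A2
      by (simp add: that d\<alpha>_def dD_def P1 P_def[symmetric] algebra_simps)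
    have lin2: "d\<beta> x z b = B1 * (x \<bullet> b) + B2 * (z \<bullet> b)" 
      if "B1 = 4 * a * (D x z * P) - 4 * a * E x * (a - 1) * P" "B2 = 4 * a * E x * (a - 1) * P" for b B1 B2
      by (simp add: that d\<beta>_def dD_def P1 P_def[symmetric] algebra_simps)
    define A1 where "A1 = - 8 * a * (D x z * P) + 4 * a * E x * (a - 1) * P"
    define A2 where "A2 = 4 * a * (D x z * P) - 4 * a * E x * (a - 1) * P"
    define B2 where "B2 = 4 * a * E x * (a - 1) * P"
    have "(\<Sum>b\<in>Basis. q'' x z b b) = (\<Sum>b\<in>Basis. A1 * ((x \<bullet> b) * (x \<bullet> b)) + A2 * ((z \<bullet> b) * (x \<bullet> b)) + \<alpha> x z * (b \<bullet> b)
        + (A2 * ((x \<bullet> b) * (z \<bullet> b)) + B2 * ((z \<bullet> b) * (z \<bullet> b))))"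
      by (intro sum.cong refl)
         (simp only: q''_apply blinfun.add_left blinfun.scaleR_left blinfun_inner_right.rep_eq real_scaleR_def lin1[OF A1_def A2_def] lin2[OF A2_def B2_def], simp add: algebra_simps)
    also have "\<dots> = A1 * (x \<bullet> x) + A2 * (z \<bullet> x) + \<alpha> x z * n + (A2 * (x \<bullet> z) + B2 * (z \<bullet> z))"
      by (simp add: sum.distrib s n_def inner_Basis inner_commute[of z x] flip: sum_distrib_left)
    also have "\<dots> = 0"
    proof -
      define r where "r = x \<bullet> x"
      define t where "t = x \<bullet> z"
      have DE: "D x z = 1 + r - 2 * t" "E x = 1 - r" "z \<bullet> x = t" by (simp_all add: D_def E_def r_def t_def inner_commute)
      have al: "\<alpha> x z = - 2 * (D x z * (D x z * P)) + 2 * a * E x * (D x z * P)"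
        unfolding \<alpha>_def P0 P1 ..
      have n: "n = - 2 * a" by (simp add: an)
      show ?thesis
        unfolding A1_def A2_def B2_def al zz r_def[symmetric] t_def[symmetric] DE n
        by (simp add: algebra_simps)
    qed
    finally show "(\<Sum>b\<in>Basis. q'' x z b b) = 0" .
  qed
qed

section \<open>The Poisson integral formula\<close>

lemma continuous_poisson_kernel_snd:
  "norm x < 1 \<Longrightarrow> continuous_on (cball 0 1) (poisson_kernel (x::'a::euclidean_space))"
proof -
  assume x: "norm x < 1"
  have "continuous_on (cball 0 1) (\<lambda>z. (\<lambda>(x, z). poisson_kernel x z) (x, z))"
    by (rule continuous_on_compose2[OF continuous_poisson_kernel]) (use x in \<open>auto intro!: continuous_intros\<close>)
  then show ?thesis by simp
qed

lemma sphere_bounded_poisson_kernel: "norm x < 1 \<Longrightarrow> sphere_bounded (poisson_kernel x)"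
  using continuous_poisson_kernel_snd sphere_bounded_continuous by blast

text \<open>
  The kernel is harmonic in \<open>x\<close> for each point \<open>z\<close> of the sphere, and the weight vanishes for all parameters
  that are not projected onto the sphere.
\<close>
theorem harmonic_poisson_integral:
  fixes g :: "'a::euclidean_space \<Rightarrow> real"
  assumes g: "continuous_on (cball 0 1) g"
  shows "harmonic_on (\<lambda>x. sphere_mean (\<lambda>z. poisson_kernel x z * g z)) (ball 0 1)"
proof -
  obtain q' :: "'a \<Rightarrow> 'a \<Rightarrow> 'a \<Rightarrow>\<^sub>L real" and q'' :: "'a \<Rightarrow> 'a \<Rightarrow> 'a \<Rightarrow>\<^sub>L 'a \<Rightarrow>\<^sub>L real"
    where q: "\<And>x z. norm x < 1 \<Longrightarrow> norm z \<le> 1 \<Longrightarrow> ((\<lambda>x. poisson_kernel x z) has_derivative q' x z) (at x)"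
    "\<And>x z. norm x < 1 \<Longrightarrow> norm z \<le> 1 \<Longrightarrow> ((\<lambda>x. q' x z) has_derivative q'' x z) (at x)"
    "continuous_on (ball 0 1 \<times> cball 0 1) (\<lambda>(x, z). q' x z)"
    "continuous_on (ball 0 1 \<times> cball 0 1) (\<lambda>(x, z). q'' x z)"
    "\<And>x z. norm x < 1 \<Longrightarrow> norm z = 1 \<Longrightarrow> (\<Sum>b\<in>Basis. q'' x z b b) = 0"
    by (rule poisson_kernel_derivatives, rule that) blast+
  define k where "k y = g (to_sphere y) * (shell_weight y / shell_mass TYPE('a))" for y :: 'a
  have ck: "continuous_on S (\<lambda>p. k (snd p))" for S :: "('a \<times> 'a) set"
    unfolding k_def
    by (rule continuous_on_compose2[where g = "\<lambda>y. g (to_sphere y) * (shell_weight y / shell_mass TYPE('a))" and t = UNIV])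
       (use shell_mass_pos[where 'a='a] in \<open>auto intro!: continuous_intros continuous_shell_weight continuous_on_to_sphere g\<close>)
  have cc: "continuous_on (ball 0 1 \<times> S) (\<lambda>p. F (fst p) (to_sphere (snd p)))"
    if F: "continuous_on (ball 0 1 \<times> cball 0 1) (\<lambda>(x, z). F x z)" for S and F :: "'a \<Rightarrow> 'a \<Rightarrow> 'c::topological_space"
  proof -
    have "continuous_on (ball 0 1 \<times> S) (\<lambda>p. (\<lambda>(x, z). F x z) (fst p, to_sphere (snd p)))"
      by (rule continuous_on_compose2[OF F])
         (auto intro!: continuous_intros continuous_on_compose2[OF continuous_to_sphere[of UNIV]] simp: norm_to_sphere_le)
    then show ?thesis by simp
  qed
  have "harmonic_on (\<lambda>x. integral (cbox (-One) One) (\<lambda>y. k y *\<^sub>R poisson_kernel x (to_sphere y))) (ball 0 1)"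
  proof (rule harmonic_integral[where q' = "\<lambda>x y. k y *\<^sub>R q' x (to_sphere y)" and q'' = "\<lambda>x y. k y *\<^sub>R q'' x (to_sphere y)"])
    fix x y :: 'a assume x: "x \<in> ball 0 1"
    then have n: "norm x < 1" "norm (to_sphere y) \<le> 1" by (auto simp: norm_to_sphere_le)
    show "((\<lambda>x. k y *\<^sub>R poisson_kernel x (to_sphere y)) has_derivative k y *\<^sub>R q' x (to_sphere y)) (at x)"
      using has_derivative_scaleR_right[OF q(1)[OF n]] by (simp add: blinfun.scaleR_left[abs_def])
    show "((\<lambda>x. k y *\<^sub>R q' x (to_sphere y)) has_derivative k y *\<^sub>R q'' x (to_sphere y)) (at x)"
      using has_derivative_scaleR_right[OF q(2)[OF n]] by (simp add: blinfun.scaleR_left[abs_def])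
    show "(\<Sum>b\<in>Basis. blinfun_apply (blinfun_apply (k y *\<^sub>R q'' x (to_sphere y)) b) b) = 0"
    proof (cases "shell_weight y = 0")
      case False
      then show ?thesis using q(5)[OF n(1) norm_to_sphere]
        by (simp add: blinfun.scaleR_left flip: sum_distrib_left)
    qed (simp add: k_def)
  next
    show "continuous_on (ball 0 1 \<times> cbox (-One) One) (\<lambda>(x, y). k y *\<^sub>R poisson_kernel x (to_sphere y))"
      "continuous_on (ball 0 1 \<times> cbox (-One) One) (\<lambda>(x, y). k y *\<^sub>R q' x (to_sphere y))"
      "continuous_on (ball 0 1 \<times> cbox (-One) One) (\<lambda>(x, y). k y *\<^sub>R q'' x (to_sphere y))"
      unfolding case_prod_beta
      by (intro continuous_on_scaleR ck cc q(3,4) continuous_poisson_kernel)+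
  qed auto
  moreover have "sphere_mean (\<lambda>z. poisson_kernel x z * g z) =
      integral (cbox (-One) One) (\<lambda>y. k y *\<^sub>R poisson_kernel x (to_sphere y))" if "x \<in> ball 0 1" for x
    using sphere_mean_eq_integral[OF continuous_on_mult[OF continuous_poisson_kernel_snd g]] that
    by (simp add: k_def mult_ac)
  ultimately show ?thesis
    by (subst harmonic_on_cong) auto
qed

lemma poisson_kernel_isometry:
  fixes T :: "'a::euclidean_space \<Rightarrow> 'a"
  assumes "orthogonal_transformation T"
  shows "poisson_kernel (T x) (T z) = poisson_kernel x z"
  using assms unfolding poisson_kernel_def orthogonal_transformation_def by simp

text \<open>
  The total mass \<open>H x\<close> of the Poisson kernel is harmonic in \<open>x\<close> and, by rotation invariance, radial. The
  maximum principle on the ball of radius \<open>norm x\<close>, applied to \<open>H\<close> and \<open>- H\<close>, gives \<open>H x = H 0 = 1\<close>.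
\<close>
lemma sphere_mean_poisson_kernel:
  fixes x :: "real^'n"
  assumes x: "norm x < 1"
  shows "sphere_mean (poisson_kernel x) = 1"
proof -
  define H where "H x = sphere_mean (poisson_kernel x)" for x :: "real^'n"
  have harm: "harmonic_on H (ball 0 1)"
    using harmonic_poisson_integral[of "\<lambda>_::real^'n. 1"] by (simp add: H_def[abs_def])
  have rad: "H y = H x" if y: "norm y = norm x" for y
  proof -
    obtain T where T: "orthogonal_transformation T" "T x = y"
      using orthogonal_transformation_exists[of x y] y by metis
    have "(\<lambda>w. poisson_kernel y (to_sphere w)) \<in> borel_measurable borel"
      using sphere_bounded_poisson_kernel[of y] x y by (simp add: sphere_bounded_def)
    from sphere_mean_rotate[OF T(1) this]
    have "H y = sphere_mean (\<lambda>z. poisson_kernel y (T z))" by (simp add: H_def)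
    also have "\<dots> = H x" using T by (simp add: H_def poisson_kernel_isometry flip: T(2))
    finally show ?thesis .
  qed
  have sub: "cball 0 (norm x) \<subseteq> (ball 0 1 :: (real^'n) set)" using x by auto
  have "H 0 \<le> H x"
    by (rule harmonic_max_principle[OF harm sub eq_refl[OF rad]]) simp_all
  moreover have "- H 0 \<le> - H x"
  proof -
    have "harmonic_on (\<lambda>y. (H y - H y) - H y) (ball 0 1)"
      by (intro harmonic_on_diff harm)
    then have "harmonic_on (\<lambda>y. - H y) (ball 0 1)" by simp
    then show ?thesis
      by (rule harmonic_max_principle[OF _ sub]) (metis rad order_refl, simp)
  qed
  ultimately have "H x = H 0" by simp
  also have "H 0 = 1" unfolding H_def poisson_kernel_0[abs_def] by (rule sphere_mean_const)
  finally show ?thesis by (simp add: H_def)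
qed

lemma poisson_denominator_eq_dist:
  "norm z = 1 \<Longrightarrow> 1 + x \<bullet> x - 2 * (x \<bullet> z) = (norm (x - z))\<^sup>2" for x z :: "'a::euclidean_space"
  unfolding power2_norm_eq_inner inner_diff_left inner_diff_right inner_commute[of z x]
  using dot_square_norm[of z] by simp

text \<open>
  The Poisson kernel is an approximate identity. Points \<open>z\<close> near \<open>y\<close> contribute little since \<open>g\<close> is uniformly
  continuous; for the others the denominator is bounded below while the factor \<open>1 - y \<bullet> y\<close> tends to 0.
\<close>
lemma poisson_integral_boundary:
  fixes g :: "real^'n \<Rightarrow> real"
  assumes g: "continuous_on (cball 0 1) g" and \<epsilon>: "\<epsilon> > 0"
  shows "\<exists>\<delta>>0. \<forall>y. 1 - \<delta> < norm y \<and> norm y < 1 \<longrightarrow>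
    \<bar>sphere_mean (\<lambda>z. poisson_kernel y z * g z) - g y\<bar> \<le> \<epsilon>"
proof -
  define a where "a = - real DIM(real^'n) / 2"
  have "bounded (g ` cball 0 1)" by (rule compact_imp_bounded[OF compact_continuous_image[OF g compact_cball]])
  then obtain M where M: "M > 0" "\<And>z. norm z \<le> 1 \<Longrightarrow> \<bar>g z\<bar> \<le> M"
    unfolding bounded_pos by (metis imageI mem_cball_0 real_norm_def)
  have "uniformly_continuous_on (cball 0 1) g" by (rule compact_uniformly_continuous[OF g compact_cball])
  moreover have "\<epsilon> / 2 > 0" using \<epsilon> by simp
  ultimately obtain \<eta> where "\<eta> > 0" "\<forall>y\<in>cball 0 1. \<forall>z\<in>cball 0 1. dist z y < \<eta> \<longrightarrow> dist (g z) (g y) < \<epsilon> / 2"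
    unfolding uniformly_continuous_on_def by blast
  then have \<eta>: "\<eta> > 0" "\<And>y z. norm y \<le> 1 \<Longrightarrow> norm z \<le> 1 \<Longrightarrow> dist z y < \<eta> \<Longrightarrow> \<bar>g z - g y\<bar> < \<epsilon> / 2"
    by (auto simp: dist_real_def)
  define K where "K = (\<eta>\<^sup>2) powr a"
  have K: "K > 0" using \<eta> by (simp add: K_def)
  \<comment> \<open>Away from \<open>y\<close> the kernel is at most \<open>2 * \<delta> * K\<close> and the oscillation of \<open>g\<close> at most \<open>2 * M\<close>; their
    product is \<open>\<epsilon> / 2\<close>.\<close>
  define \<delta> where "\<delta> = \<epsilon> / (8 * M * K)"
  have \<delta>: "\<delta> > 0" using \<epsilon> M K by (simp add: \<delta>_def)
  show ?thesis
  proof (intro exI[of _ \<delta>] conjI \<delta> allI impI)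
    fix y :: "real^'n" assume y: "1 - \<delta> < norm y \<and> norm y < 1"
    then have y1: "norm y < 1" by simp
    have bd: "sphere_bounded (\<lambda>z. poisson_kernel y z * (g z - g y))"
      by (intro sphere_bounded_mult sphere_bounded_poisson_kernel[OF y1] sphere_bounded_diff sphere_bounded_continuous[OF g] sphere_bounded_const)
    have "sphere_mean (\<lambda>z. poisson_kernel y z * (g z - g y))
      = sphere_mean (\<lambda>z. poisson_kernel y z * g z - g y * poisson_kernel y z)"
      by (simp add: algebra_simps)
    also have "\<dots> = sphere_mean (\<lambda>z. poisson_kernel y z * g z) - sphere_mean (\<lambda>z. g y * poisson_kernel y z)"
      by (intro sphere_mean_diff sphere_bounded_mult sphere_bounded_poisson_kernel[OF y1] sphere_bounded_continuous[OF g] sphere_bounded_const)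
    also have "\<dots> = sphere_mean (\<lambda>z. poisson_kernel y z * g z) - g y"
      by (simp add: sphere_mean_cmult sphere_mean_poisson_kernel[OF y1])
    finally have eq: "sphere_mean (\<lambda>z. poisson_kernel y z * g z) - g y = sphere_mean (\<lambda>z. poisson_kernel y z * (g z - g y))" ..
    have "\<bar>sphere_mean (\<lambda>z. poisson_kernel y z * (g z - g y))\<bar> \<le> sphere_mean (\<lambda>z. \<epsilon>/2 * poisson_kernel y z + \<epsilon>/2)"
    proof (rule sphere_mean_abs_le[OF bd])
      show "sphere_bounded (\<lambda>z. \<epsilon>/2 * poisson_kernel y z + \<epsilon>/2)"
        by (intro sphere_bounded_mult sphere_bounded_add sphere_bounded_poisson_kernel[OF y1] sphere_bounded_const)
      fix z :: "real^'n" assume z: "norm z = 1"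
      note Q0 = poisson_kernel_nonneg[OF y1, of z]
      show "\<bar>poisson_kernel y z * (g z - g y)\<bar> \<le> \<epsilon>/2 * poisson_kernel y z + \<epsilon>/2"
      proof (cases "dist z y < \<eta>")
        case True
        then have "\<bar>g z - g y\<bar> \<le> \<epsilon> / 2" using \<eta>(2)[of y z] y1 z by simp
        then have "poisson_kernel y z * \<bar>g z - g y\<bar> \<le> poisson_kernel y z * (\<epsilon> / 2)"
          by (rule mult_left_mono) (rule Q0)
        then have "\<bar>poisson_kernel y z * (g z - g y)\<bar> \<le> \<epsilon> / 2 * poisson_kernel y z"
          by (simp only: abs_mult abs_of_nonneg[OF Q0] mult.commute)
        then show ?thesis using \<epsilon> by linarith
      next
        case False
        have "\<eta>\<^sup>2 \<le> (norm (y - z))\<^sup>2" using False \<eta>(1) by (intro power_mono) (auto simp: dist_norm norm_minus_commute)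
        then have "(1 + y \<bullet> y - 2 * (y \<bullet> z)) powr a \<le> K"
          unfolding K_def poisson_denominator_eq_dist[OF z]
          by (intro powr_mono2') (use \<eta> in \<open>auto simp: a_def\<close>)
        moreover have "1 - y \<bullet> y \<le> 2 * \<delta>"
        proof -
          have "1 - y \<bullet> y = (1 - norm y) * (1 + norm y)"
            unfolding dot_square_norm by (simp add: algebra_simps power2_eq_square)
          also have "\<dots> \<le> \<delta> * 2" by (intro mult_mono) (use y \<delta> in auto)
          finally show ?thesis by simp
        qed
        moreover have "1 - y \<bullet> y \<ge> 0" unfolding dot_square_norm using power_le_one[of "norm y" 2] y1 by simp
        ultimately have "poisson_kernel y z \<le> 2 * \<delta> * K"
          unfolding poisson_kernel_def a_def using \<delta> by (intro mult_mono) simp_all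
        moreover have "\<bar>g z - g y\<bar> \<le> 2 * M" using M(2)[of z] M(2)[of y] y1 z by simp
        ultimately have "poisson_kernel y z * \<bar>g z - g y\<bar> \<le> (2 * \<delta> * K) * (2 * M)"
          using Q0 \<delta> K by (intro mult_mono) auto
        also have "\<dots> = \<epsilon> / 2" using M K by (simp add: \<delta>_def field_simps)
        finally have "\<bar>poisson_kernel y z * (g z - g y)\<bar> \<le> \<epsilon> / 2"
          by (simp only: abs_mult abs_of_nonneg[OF Q0])
        moreover have "0 \<le> \<epsilon> / 2 * poisson_kernel y z" using Q0 \<epsilon> by (intro mult_nonneg_nonneg) auto
        ultimately show ?thesis by linarith
      qed
    qed
    also have "\<dots> = sphere_mean (\<lambda>z. \<epsilon>/2 * poisson_kernel y z) + sphere_mean (\<lambda>z::real^'n. \<epsilon>/2)"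
      by (intro sphere_mean_add sphere_bounded_mult sphere_bounded_poisson_kernel[OF y1] sphere_bounded_const)
    also have "\<dots> = \<epsilon>"
      by (simp only: sphere_mean_cmult sphere_mean_poisson_kernel[OF y1] sphere_mean_const mult_1_right field_sum_of_halves)
    finally show "\<bar>sphere_mean (\<lambda>z. poisson_kernel y z * g z) - g y\<bar> \<le> \<epsilon>" unfolding eq .
  qed
qed

lemma continuous_on_dilation:
  fixes f :: "'a::euclidean_space \<Rightarrow> real"
  assumes f: "harmonic_on f (ball 0 1)" and s: "0 < s" "s < 1"
  shows "continuous_on (cball 0 1) (\<lambda>z. f (s *\<^sub>R z))"
proof (rule continuous_on_compose2[OF harmonic_on_imp_continuous_on[OF f]])
  show "(\<lambda>z. s *\<^sub>R z) ` cball 0 1 \<subseteq> (ball 0 1 :: 'a set)"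
  proof safe
    fix z :: 'a assume "z \<in> cball 0 1"
    then have "s * norm z \<le> s * 1" using s by (intro mult_left_mono) auto
    then have "s * norm z < 1" using s by linarith
    then show "s *\<^sub>R z \<in> ball 0 1" using s by simp
  qed
qed (intro continuous_intros)

text \<open>
  The Poisson integral of \<open>f (s *\<^sub>R z)\<close> and the dilation of \<open>f\<close> are harmonic with the same boundary values.
  The dilation by \<open>s < 1\<close> is needed as \<open>f\<close> need not have boundary values on the unit sphere.
\<close>
theorem poisson_formula:
  fixes f :: "real^'n \<Rightarrow> real"
  assumes f: "harmonic_on f (ball 0 1)" and s: "0 < s" "s < 1" and x: "norm x < 1"
  shows "f (s *\<^sub>R x) = sphere_mean (\<lambda>z. poisson_kernel x z * f (s *\<^sub>R z))"
proof -
  define g where "g z = f (s *\<^sub>R z)" for z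
  define h where "h x = sphere_mean (\<lambda>z. poisson_kernel x z * g z)" for x
  have cg: "continuous_on (cball 0 1) g" unfolding g_def
    by (rule continuous_on_dilation[OF f s])
  have hg: "harmonic_on g (ball 0 1)" unfolding g_def using harmonic_on_dilation[OF f] s by simp
  have hh: "harmonic_on h (ball 0 1)" unfolding h_def by (rule harmonic_poisson_integral[OF cg])
  have bnd: "\<exists>\<delta>>0. \<forall>y. 1 - \<delta> < norm y \<and> norm y < 1 \<longrightarrow> \<bar>h y - g y\<bar> \<le> \<epsilon>" if "\<epsilon> > 0" for \<epsilon>
    unfolding h_def by (rule poisson_integral_boundary[OF cg that])
  have "h x - g x \<le> 0"
    by (rule harmonic_nonpos_of_boundary[OF harmonic_on_diff[OF hh hg] _ x]) (use bnd abs_le_D1 in meson)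
  moreover have "g x - h x \<le> 0"
    by (rule harmonic_nonpos_of_boundary[OF harmonic_on_diff[OF hg hh] _ x]) (use bnd abs_le_D1 abs_minus_commute in metis)
  ultimately show ?thesis by (simp add: h_def g_def)
qed

section \<open>The Schwarz lemma for bounded harmonic functions\<close>

lemma sphere_mean_halves:
  fixes x :: "'a::euclidean_space"
  shows "sphere_mean (indicator {z. z \<bullet> x < 0}) \<le> sphere_mean (indicator {z. z \<bullet> x \<ge> 0})"
proof -
  have o: "orthogonal_transformation (uminus :: 'a \<Rightarrow> 'a)"
    by (auto simp: orthogonal_transformation_def intro!: linearI)
  have "sphere_mean (indicator {z. z \<bullet> x \<ge> 0}) = sphere_mean (\<lambda>z. indicator {z. z \<bullet> x \<ge> 0} (- z))"
    by (rule sphere_mean_rotate[OF o, symmetric]) measurable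
  moreover have "sphere_mean (indicator {z. z \<bullet> x < 0}) \<le> sphere_mean (\<lambda>z. indicator {z. z \<bullet> x \<ge> 0} (- z))"
    by (rule sphere_mean_mono) (auto intro!: exI[of _ 1] simp: sphere_bounded_def indicator_def)
  ultimately show ?thesis by simp
qed

text \<open>
  Let \<open>c\<close> be the value of the Poisson kernel on the equator orthogonal to \<open>x\<close>. The kernel is at least \<open>c\<close> on the
  hemisphere that faces \<open>x\<close> and at most \<open>c\<close> on the opposite one. As \<open>f\<close> has mean 0, a multiple of the mean may
  be subtracted, and \<open>f (s *\<^sub>R x)\<close> is the mean of \<open>kernel - c\<close> times the boundary values \<open>f (s *\<^sub>R z)\<close>. For
  values in \<open>{-1..1}\<close> this is at most the mean obtained from 1 on the near hemisphere and -1 on the far one.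
\<close>
theorem harmonic_schwarz_bound_dilated:
  fixes f :: "real^'n \<Rightarrow> real"
  assumes f: "harmonic_on f (ball 0 1)" and bd: "\<And>y. norm y < 1 \<Longrightarrow> \<bar>f y\<bar> \<le> 1" and f0: "f 0 = 0"
    and s: "0 < s" "s < 1" and x: "norm x < 1"
  shows "2 * sphere_mean (\<lambda>z. poisson_kernel x z * indicator {z. z \<bullet> x < 0} z) \<le> 1 - f (s *\<^sub>R x)"
proof -
  define a where "a = - real DIM(real^'n) / 2"
  define g where "g z = f (s *\<^sub>R z)" for z
  define N where "N = {z. z \<bullet> x < 0}"
  define P where "P = {z. z \<bullet> x \<ge> 0}"
  define c where "c = (1 - x \<bullet> x) * (1 + x \<bullet> x) powr a"
  have NP: "N \<in> sets borel" "P \<in> sets borel" unfolding N_def P_def by measurable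
  have cg: "continuous_on (cball 0 1) g" unfolding g_def
    by (rule continuous_on_dilation[OF f s])
  have g1: "\<bar>g z\<bar> \<le> 1" if "norm z = 1" for z
    unfolding g_def using bd[of "s *\<^sub>R z"] s that by simp
  have x2: "0 \<le> x \<bullet> x" "x \<bullet> x \<le> 1" using x by (auto simp: dot_square_norm abs_square_le_1)
  then have x3: "0 < 1 + x \<bullet> x" by linarith
  have c0: "c \<ge> 0" using x2 by (simp add: c_def)
  note B = sphere_bounded_mult sphere_bounded_diff sphere_bounded_add sphere_bounded_const sphere_bounded_poisson_kernel[OF x]
    sphere_bounded_indicator[OF NP(1)] sphere_bounded_indicator[OF NP(2)] sphere_bounded_continuous[OF cg]
  have pw: "c * (indicator P z - indicator N z - g z) \<le> poisson_kernel x z - poisson_kernel x z * g z - 2 * (poisson_kernel x z * indicator N z)"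
    if z: "norm z = 1" for z
  proof -
    have Dp: "0 < 1 + x \<bullet> x - 2 * (x \<bullet> z)" using poisson_denominator_pos[OF x] z by simp
    show ?thesis
    proof (cases "z \<in> N")
      case True
      then have "z \<bullet> x < 0" by (simp add: N_def)
      then have "poisson_kernel x z \<le> c"
        unfolding poisson_kernel_def c_def a_def using x2 x3
        by (intro mult_left_mono powr_mono2') (auto simp: inner_commute)
      then have "poisson_kernel x z * (1 + g z) \<le> c * (1 + g z)"
        using g1[OF z] by (intro mult_right_mono) auto
      then show ?thesis using True by (auto simp: N_def P_def algebra_simps)
    next
      case False
      then have "z \<bullet> x \<ge> 0" by (simp add: N_def)
      then have "c \<le> poisson_kernel x z"
        unfolding poisson_kernel_def c_def a_def using x2 Dp
        by (intro mult_left_mono powr_mono2') (auto simp: inner_commute)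
      then have "c * (1 - g z) \<le> poisson_kernel x z * (1 - g z)"
        using g1[OF z] by (intro mult_right_mono) auto
      then show ?thesis using False by (auto simp: N_def P_def algebra_simps)
    qed
  qed
  have "sphere_mean g = f (s *\<^sub>R 0)"
    using poisson_formula[OF f s, of 0] by (simp add: g_def[abs_def])
  then have g0: "sphere_mean g = 0" using f0 by simp
  have "0 \<le> c * (sphere_mean (indicator P) - sphere_mean (indicator N) - sphere_mean g)"
    using sphere_mean_halves[of x] c0 g0 by (simp add: N_def P_def)
  also have "\<dots> = sphere_mean (\<lambda>z. c * (indicator P z - indicator N z - g z))"
    by (simp add: sphere_mean_cmult sphere_mean_diff B)
  also have "\<dots> \<le> sphere_mean (\<lambda>z. poisson_kernel x z - poisson_kernel x z * g z - 2 * (poisson_kernel x z * indicator N z))"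
    by (rule sphere_mean_mono) (intro B pw | assumption)+
  also have "\<dots> = sphere_mean (\<lambda>z. poisson_kernel x z - poisson_kernel x z * g z) - sphere_mean (\<lambda>z. 2 * (poisson_kernel x z * indicator N z))"
    by (intro sphere_mean_diff B)
  also have "sphere_mean (\<lambda>z. poisson_kernel x z - poisson_kernel x z * g z) = sphere_mean (poisson_kernel x) - sphere_mean (\<lambda>z. poisson_kernel x z * g z)"
    by (intro sphere_mean_diff B)
  also have "\<dots> = 1 - f (s *\<^sub>R x)"
    unfolding poisson_formula[OF f s x] g_def by (simp only: sphere_mean_poisson_kernel[OF x])
  finally show ?thesis by (simp add: N_def sphere_mean_cmult)
qed

theorem harmonic_schwarz_bound:
  fixes f :: "real^'n \<Rightarrow> real"
  assumes f: "harmonic_on f (ball 0 1)" and bd: "\<And>y. norm y < 1 \<Longrightarrow> \<bar>f y\<bar> \<le> 1" and f0: "f 0 = 0"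
    and x: "norm x < 1"
  shows "2 * sphere_mean (\<lambda>z. poisson_kernel x z * indicator {z. z \<bullet> x < 0} z) \<le> 1 - f x"
proof -
  define s where "s n = 1 - inverse (real (Suc (Suc n)))" for n :: nat
  have s: "0 < s n" "s n < 1" for n by (auto simp: s_def field_simps)
  have "s \<longlonglongrightarrow> 1 - 0" unfolding s_def
    by (intro tendsto_diff tendsto_const LIMSEQ_Suc[OF LIMSEQ_inverse_real_of_nat])
  then have "(\<lambda>n. s n *\<^sub>R x) \<longlonglongrightarrow> 1 *\<^sub>R x" by (intro tendsto_intros) auto
  moreover have "isCont f x"
    using harmonic_on_imp_continuous_on[OF f] x by (simp add: continuous_on_eq_continuous_at)
  ultimately have "(\<lambda>n. 1 - f (s n *\<^sub>R x)) \<longlonglongrightarrow> 1 - f x"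
    by (intro tendsto_diff tendsto_const isCont_tendsto_compose[of x f]) auto
  then show ?thesis
    by (rule LIMSEQ_le_const) (use harmonic_schwarz_bound_dilated[OF f bd f0 s x] in auto)
qed

section \<open>The normalising constant\<close>

lemma Gamma_plus1_pos: "x > 0 \<Longrightarrow> Gamma (x + 1) = x * Gamma x" for x :: real
  by (rule Gamma_plus1) (auto elim!: nonpos_Ints_cases)

text \<open>
  The total mass of the density \<open>(1 + t^2) powr (- n / 2)\<close> on the line (a Student distribution up to
  scaling), as is proved below.
\<close>
definition student_mass :: "real \<Rightarrow> real" where
  "student_mass n = sqrt pi * Gamma ((n - 1) / 2) / Gamma (n / 2)"

lemma student_mass_pos: "n > 1 \<Longrightarrow> student_mass n > 0"
  unfolding student_mass_def by (intro divide_pos_pos mult_pos_pos Gamma_real_pos) auto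

lemma DERIV_one_plus_square_powr:
  "((\<lambda>t. (1 + t\<^sup>2) powr a) has_real_derivative a * (1 + t\<^sup>2) powr (a - 1) * (2 * t)) (at (t::real))"
proof -
  have p: "1 + t\<^sup>2 > 0" by (simp add: add_pos_nonneg)
  have "((\<lambda>t. 1 + t\<^sup>2) has_real_derivative 2 * t) (at t)" by (auto intro!: derivative_eq_intros)
  from DERIV_fun_powr[OF this p, of a] show ?thesis by simp
qed

lemma one_plus_square_powr_Suc:
  "(1 + t\<^sup>2) powr a = (1 + t\<^sup>2) * (1 + t\<^sup>2) powr (a - 1)" for t :: real
proof -
  have p: "1 + t\<^sup>2 > 0" by (simp add: add_pos_nonneg)
  show ?thesis using powr_add[of "1 + t\<^sup>2" 1 "a - 1"] p by simp
qed

text \<open>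
  Differentiating \<open>x * (1 + x^2) powr (- n / 2)\<close> relates the densities with parameters \<open>n\<close> and \<open>n + 2\<close>. Working
  with antiderivatives instead of integrals keeps the induction free of integrability questions.
\<close>
lemma student_antiderivative_step:
  fixes F :: "real \<Rightarrow> real"
  assumes n: "n > 1"
    and F: "\<And>x. (F has_real_derivative (1 + x\<^sup>2) powr (- n / 2)) (at x)" "F 0 = 0"
    and lim: "(F \<longlongrightarrow> l) at_top"
  defines "G \<equiv> \<lambda>x. ((n - 1) * F x + x * (1 + x\<^sup>2) powr (- n / 2)) / n"
  shows "(G has_real_derivative (1 + x\<^sup>2) powr (- (n + 2) / 2)) (at x)" "G 0 = 0"
    "(G \<longlongrightarrow> (n - 1) / n * l) at_top"
proof -
  define Q where "Q = (1 + x\<^sup>2) powr (- n / 2 - 1)"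
  have P: "(1 + x\<^sup>2) powr (- n / 2) = (1 + x\<^sup>2) * Q" unfolding Q_def by (rule one_plus_square_powr_Suc)
  have e: "- (n + 2) / 2 = - n / 2 - 1" by simp
  have "(G has_real_derivative ((n - 1) * (1 + x\<^sup>2) powr (- n / 2) +
     (1 * (1 + x\<^sup>2) powr (- n / 2) + (- n / 2 * (1 + x\<^sup>2) powr (- n / 2 - 1) * (2 * x)) * x)) / n) (at x)"
    unfolding G_def by (intro DERIV_cdivide DERIV_add DERIV_cmult F DERIV_mult DERIV_ident DERIV_one_plus_square_powr)
  moreover have "((n - 1) * (1 + x\<^sup>2) powr (- n / 2) +
     (1 * (1 + x\<^sup>2) powr (- n / 2) + (- n / 2 * (1 + x\<^sup>2) powr (- n / 2 - 1) * (2 * x)) * x)) / n = Q"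
    unfolding P Q_def[symmetric] using n by (simp add: field_simps power2_eq_square)
  ultimately show "(G has_real_derivative (1 + x\<^sup>2) powr (- (n + 2) / 2)) (at x)" by (simp only: Q_def e)
  show "G 0 = 0" using F(2) by (simp add: G_def)
  have "((\<lambda>x. x * (1 + x\<^sup>2) powr (- n / 2)) \<longlongrightarrow> 0) at_top"
  proof (rule tendsto_sandwich[OF _ _ tendsto_const])
    show "\<forall>\<^sub>F x in at_top. 0 \<le> x * (1 + x\<^sup>2) powr (- n / 2)"
      using eventually_ge_at_top[of 0] by eventually_elim simp
    show "\<forall>\<^sub>F x in at_top. x * (1 + x\<^sup>2) powr (- n / 2) \<le> x powr (1 - n)"
      using eventually_gt_at_top[of 0]
    proof eventually_elim
      case (elim x)
      have "(1 + x\<^sup>2) powr (- n / 2) \<le> (x\<^sup>2) powr (- n / 2)"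
        by (rule powr_mono2') (use elim n in auto)
      also have "\<dots> = x powr (- n)" using elim by (simp add: powr_powr flip: powr_numeral)
      finally have "x * (1 + x\<^sup>2) powr (- n / 2) \<le> x * x powr (- n)" using elim by simp
      also have "\<dots> = x powr (1 - n)" using elim powr_add[of x 1 "- n"] by simp
      finally show ?case .
    qed
    show "((\<lambda>x::real. x powr (1 - n)) \<longlongrightarrow> 0) at_top"
      by (rule tendsto_neg_powr) (use n in \<open>simp_all add: filterlim_ident\<close>)
  qed
  then have "(G \<longlongrightarrow> ((n - 1) * l + 0) / n) at_top"
    unfolding G_def using n by (intro tendsto_intros lim) auto
  then show "(G \<longlongrightarrow> (n - 1) / n * l) at_top" by simp
qed

lemma student_mass_step: "n > 1 \<Longrightarrow> student_mass (n + 2) = (n - 1) / n * student_mass n"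
proof -
  assume n: "n > 1"
  have "Gamma ((n - 1) / 2 + 1) = (n - 1) / 2 * Gamma ((n - 1) / 2)" "Gamma (n / 2 + 1) = n / 2 * Gamma (n / 2)"
    by (rule Gamma_plus1_pos, use n in simp)+
  moreover have "(n + 2 - 1) / 2 = (n - 1) / 2 + 1" "(n + 2) / 2 = n / 2 + 1" by (simp_all add: field_simps)
  ultimately have "student_mass (n + 2) = sqrt pi * ((n - 1) / 2 * Gamma ((n - 1) / 2)) / (n / 2 * Gamma (n / 2))"
    unfolding student_mass_def by (simp only:)
  also have "\<dots> = (n - 1) / n * student_mass n"
    unfolding student_mass_def by simp
  finally show ?thesis .
qed

text \<open>
  Induction in steps of 2 from the antiderivatives \<open>arctan x\<close> of \<open>(1 + x^2) powr (- 2 / 2)\<close> and \<open>x / sqrt (1 + x^2)\<close> of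
  \<open>(1 + x^2) powr (- 3 / 2)\<close>.
\<close>
lemma student_antiderivative:
  "\<exists>F. (\<forall>x. (F has_real_derivative (1 + x\<^sup>2) powr (- real (n + 2) / 2)) (at x)) \<and> F 0 = 0 \<and>
     (F \<longlongrightarrow> student_mass (real (n + 2)) / 2) at_top"
proof (induction n rule: nat_induct2)
  case 0
  have "(arctan has_real_derivative (1 + x\<^sup>2) powr (- real (0 + 2) / 2)) (at x)" for x
    by (rule derivative_eq_intros refl | simp add: powr_minus add_pos_nonneg)+
  moreover have "(arctan \<longlongrightarrow> student_mass (real (0 + 2)) / 2) at_top"
    using tendsto_arctan_at_top by (simp add: student_mass_def Gamma_one_half_real)
  ultimately show ?case by (intro exI[of _ arctan]) auto
next
  case 1
  let ?F = "\<lambda>x::real. x * (1 + x\<^sup>2) powr (- 1 / 2)"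
  have "(?F has_real_derivative (1 + x\<^sup>2) powr (- real (1 + 2) / 2)) (at x)" for x
  proof -
    have "(?F has_real_derivative 1 * (1 + x\<^sup>2) powr (- 1 / 2) + (- 1 / 2 * (1 + x\<^sup>2) powr (- 1 / 2 - 1) * (2 * x)) * x) (at x)"
      by (intro DERIV_mult DERIV_ident DERIV_one_plus_square_powr)
    moreover have "1 * (1 + x\<^sup>2) powr (- 1 / 2) + (- 1 / 2 * (1 + x\<^sup>2) powr (- 1 / 2 - 1) * (2 * x)) * x = (1 + x\<^sup>2) powr (- 1 / 2 - 1)"
      unfolding one_plus_square_powr_Suc[of x "- 1 / 2"] by (simp add: algebra_simps power2_eq_square)
    ultimately show ?thesis by simp
  qed
  moreover have "(?F \<longlongrightarrow> student_mass (real (1 + 2)) / 2) at_top"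
  proof -
    have "((\<lambda>x::real. (1 + (1 / x)\<^sup>2) powr (- 1 / 2)) \<longlongrightarrow> (1 + 0\<^sup>2) powr (- 1 / 2)) at_top"
      by (intro tendsto_intros tendsto_divide_0[OF tendsto_const] filterlim_at_top_imp_at_infinity filterlim_ident) auto
    moreover have "\<forall>\<^sub>F x::real in at_top. (1 + (1 / x)\<^sup>2) powr (- 1 / 2) = ?F x"
      using eventually_gt_at_top[of 0]
    proof eventually_elim
      case (elim x)
      have "(1 + x\<^sup>2) powr (- 1 / 2) = (x\<^sup>2 * (1 + (1 / x)\<^sup>2)) powr (- 1 / 2)"
      proof -
        have "1 + x\<^sup>2 = x\<^sup>2 * (1 + (1 / x)\<^sup>2)" using elim by (simp add: field_simps)
        then show ?thesis by simp
      qed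
      also have "\<dots> = (x\<^sup>2) powr (- 1 / 2) * (1 + (1 / x)\<^sup>2) powr (- 1 / 2)"
        by (rule powr_mult)
      also have "(x\<^sup>2) powr (- 1 / 2) = 1 / x" using elim by (simp add: powr_minus powr_half_sqrt field_simps)
      finally show ?case using elim by simp
    qed
    moreover have "student_mass (real (1 + 2)) / 2 = 1"
      using Gamma_plus1_pos[of "1/2"] by (simp add: student_mass_def Gamma_one_half_real)
    ultimately show ?thesis by (simp add: tendsto_cong)
  qed
  ultimately show ?case by (intro exI[of _ ?F]) auto
next
  case (step n)
  then obtain F where F: "\<And>x. (F has_real_derivative (1 + x\<^sup>2) powr (- real (n + 2) / 2)) (at x)" "F 0 = 0"
     "(F \<longlongrightarrow> student_mass (real (n + 2)) / 2) at_top" by blast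
  have n: "real (n + 2) > 1" by simp
  note st = student_antiderivative_step[OF n F]
  have e: "real (n + 2 + 2) = real (n + 2) + 2" by simp
  show ?case unfolding e student_mass_step[OF n]
    using st by (intro exI[of _ "\<lambda>x. ((real (n + 2) - 1) * F x + x * (1 + x\<^sup>2) powr (- real (n + 2) / 2)) / real (n + 2)"] conjI allI) simp_all
qed

lemma nn_integral_even:
  fixes f :: "real \<Rightarrow> ennreal"
  assumes [measurable]: "f \<in> borel_measurable borel" and ev: "\<And>x. f (- x) = f x"
  shows "(\<integral>\<^sup>+x. f x \<partial>lborel) = 2 * (\<integral>\<^sup>+x. f x * indicator {0..} x \<partial>lborel)"
proof -
  have "(\<integral>\<^sup>+x. f x \<partial>lborel) = (\<integral>\<^sup>+x. f x * indicator {0..} x + f x * indicator {..<0} x \<partial>lborel)"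
    by (intro nn_integral_cong) (auto simp: indicator_def)
  also have "\<dots> = (\<integral>\<^sup>+x. f x * indicator {0..} x \<partial>lborel) + (\<integral>\<^sup>+x. f x * indicator {..<0} x \<partial>lborel)"
    by (rule nn_integral_add) measurable
  also have "(\<integral>\<^sup>+x. f x * indicator {..<0} x \<partial>lborel) = (\<integral>\<^sup>+x. f x * indicator {0<..} x \<partial>lborel)"
    by (subst nn_integral_real_affine[where c = "-1" and t = 0]) (auto simp: ev indicator_def intro!: nn_integral_cong)
  also have "\<dots> = (\<integral>\<^sup>+x. f x * indicator {0..} x \<partial>lborel)"
    by (rule nn_integral_cong_AE) (use AE_lborel_singleton[of "0::real"] in \<open>auto simp: indicator_def elim!: AE_mp\<close>)
  finally show ?thesis by (simp add: mult_2)
qed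

lemma nn_integral_student:
  assumes n: "n \<ge> 2"
  shows "(\<integral>\<^sup>+t. ennreal ((1 + t\<^sup>2) powr (- real n / 2)) \<partial>lborel) = ennreal (student_mass (real n))"
proof -
  obtain F where F: "\<And>x. (F has_real_derivative (1 + x\<^sup>2) powr (- real n / 2)) (at x)" "F 0 = 0"
     "(F \<longlongrightarrow> student_mass (real n) / 2) at_top"
    using student_antiderivative[of "n - 2"] n by auto
  have m: "student_mass (real n) > 0" using n by (intro student_mass_pos) simp
  have "(\<integral>\<^sup>+t. ennreal ((1 + t\<^sup>2) powr (- real n / 2)) \<partial>lborel) =
      2 * (\<integral>\<^sup>+t. ennreal ((1 + t\<^sup>2) powr (- real n / 2)) * indicator {0..} t \<partial>lborel)"
    by (rule nn_integral_even) auto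
  also have "(\<integral>\<^sup>+t. ennreal ((1 + t\<^sup>2) powr (- real n / 2)) * indicator {0..} t \<partial>lborel) = ennreal (student_mass (real n) / 2 - F 0)"
    by (rule nn_integral_FTC_atLeast[OF _ F(1) _ F(3)]) auto
  also have "2 * \<dots> = ennreal (student_mass (real n))"
    using m F(2) ennreal_mult[of 2 "student_mass (real n) / 2"] by simp
  finally show ?thesis .
qed

text \<open>
  Legendre duplication in the form that matches the Gamma factors of \<open>schwarz_const\<close>. For integers it follows
  from the recursion in steps of 2.
\<close>
lemma student_mass_closed_form:
  "student_mass (real (n + 2)) * (real (n + 1) * fact (n + 1)) = 2 ^ (n + 2) * (Gamma (real (n + 3) / 2))\<^sup>2"
proof (induction n rule: nat_induct2)
  case 0
  have "Gamma (3/2 :: real) = sqrt pi / 2" using Gamma_plus1_pos[of "1/2"] by (simp add: Gamma_one_half_real)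
  then have "(Gamma (3/2 :: real))\<^sup>2 = pi / 4" by (simp only: power_divide) simp
  then show ?case by (simp add: student_mass_def Gamma_one_half_real)
next
  case 1
  have g: "Gamma (3/2 :: real) = sqrt pi / 2" using Gamma_plus1_pos[of "1/2"] by (simp add: Gamma_one_half_real)
  have "Gamma (2 :: real) = 1" using Gamma_plus1_pos[of 1] by simp
  then show ?case by (simp add: student_mass_def g)
next
  case (step n)
  have g: "Gamma (real (n + 2 + 3) / 2) = real (n + 3) / 2 * Gamma (real (n + 3) / 2)"
    using Gamma_plus1_pos[of "real (n + 3) / 2"] by (simp add: field_simps)
  have m: "student_mass (real (n + 2 + 2)) = real (n + 1) / real (n + 2) * student_mass (real (n + 2))"
    using student_mass_step[of "real (n + 2)"] by (simp add: add.commute)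
  have f: "fact (n + 2 + 1) = real (n + 3) * (real (n + 2) * fact (n + 1))"
    by (simp add: numeral_eq_Suc algebra_simps)
  have "student_mass (real (n + 2 + 2)) * (real (n + 2 + 1) * fact (n + 2 + 1)) =
     (real (n + 3))\<^sup>2 * (student_mass (real (n + 2)) * (real (n + 1) * fact (n + 1)))"
    unfolding m f by (simp add: field_simps power2_eq_square)
  also have "\<dots> = 2 ^ (n + 2 + 2) * (Gamma (real (n + 2 + 3) / 2))\<^sup>2"
    unfolding step.IH g by (simp add: power_mult_distrib power_divide)
  finally show ?case .
qed

section \<open>The hemisphere integral along the axis\<close>

text \<open>
  Up to normalisation, the mean over the far hemisphere of \<open>norm (r b - z) powr (- n)\<close>, in the slope
  coordinate \<open>t\<close> of \<open>- z\<close>. Here \<open>t + r * sqrt (1 + t^2)\<close> is the slope of the same point seen from \<open>r b\<close> instead of from the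
  centre.
\<close>
definition slope_integral :: "nat \<Rightarrow> real \<Rightarrow> ennreal" where
  "slope_integral n r = (\<integral>\<^sup>+t. ennreal ((1 + (t + r * sqrt (1 + t\<^sup>2))\<^sup>2) powr (- real n / 2)) * indicator {0..} t \<partial>lborel)"

text \<open>
  Twice the value of \<open>slope_integral\<close> at \<open>r = 1\<close>, as an integral over a compact interval.
\<close>
definition schwarz_integral :: "nat \<Rightarrow> real" where
  "schwarz_integral n = integral {0..1} (\<lambda>s. s ^ (n - 2) * (1 + s\<^sup>2) powr (1 - real n / 2))"

text \<open>
  The pointwise inequality behind the monotonicity argument: \<open>2 / (1 + r)\<close> is the factor by which the slopes
  for \<open>r < 1\<close> have to be dilated. After multiplication by \<open>1 + r\<close> and squaring it reduces to
  \<open>2 * u * sqrt (1 + u^2) \<le> 1 + 2 * u^2\<close>.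
\<close>
lemma chord_slope_dilation:
  fixes u r :: real
  assumes u: "u \<ge> 0" and r: "0 \<le> r" "r \<le> 1"
  shows "2 / (1 + r) * u + r * sqrt (1 + (2 / (1 + r) * u)\<^sup>2) \<le> u + sqrt (1 + u\<^sup>2)"
proof -
  define q where "q = sqrt (1 + u\<^sup>2)"
  have q: "q\<^sup>2 = 1 + u\<^sup>2" "q \<ge> u" "q \<ge> 0" using u by (auto simp: q_def intro!: real_le_rsqrt)
  have uq: "2 * u * q \<le> 1 + 2 * u\<^sup>2"
    using zero_le_power2[of "u - q"] q(1) by (simp add: power2_eq_square algebra_simps)
  have p: "1 + r > 0" using r by simp
  have nn: "0 \<le> (1 + r) * q - (1 - r) * u"
  proof -
    have "(1 - r) * u \<le> (1 + r) * q" using r u q by (intro mult_mono) auto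
    then show ?thesis by simp
  qed
  have "r * sqrt ((1 + r)\<^sup>2 + 4 * u\<^sup>2) \<le> (1 + r) * q - (1 - r) * u"
  proof (rule power2_le_imp_le[OF _ nn])
    have "((1 + r) * q - (1 - r) * u)\<^sup>2 - (r * sqrt ((1 + r)\<^sup>2 + 4 * u\<^sup>2))\<^sup>2 =
       (1 + r)\<^sup>2 * q\<^sup>2 - 2 * (1 - r) * (1 + r) * u * q + (1 - r)\<^sup>2 * u\<^sup>2 - r\<^sup>2 * ((1 + r)\<^sup>2 + 4 * u\<^sup>2)"
    proof -
      have "(r * sqrt ((1 + r)\<^sup>2 + 4 * u\<^sup>2))\<^sup>2 = r\<^sup>2 * ((1 + r)\<^sup>2 + 4 * u\<^sup>2)"
        unfolding power_mult_distrib by (subst real_sqrt_pow2) (auto intro: add_nonneg_nonneg)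
      then show ?thesis by (simp add: power_mult_distrib power2_eq_square algebra_simps)
    qed
    also have "\<dots> = (1 - r) * (1 + r) * ((1 + r)\<^sup>2 + 2 * u\<^sup>2 - 2 * u * q)"
      unfolding q(1) by (simp add: power2_eq_square algebra_simps)
    also have "\<dots> \<ge> 0"
    proof (intro mult_nonneg_nonneg)
      have "1 \<le> (1 + r)\<^sup>2" using r by (simp add: power2_eq_square algebra_simps)
      then show "0 \<le> (1 + r)\<^sup>2 + 2 * u\<^sup>2 - 2 * u * q" using uq by linarith
    qed (use r in auto)
    finally show "(r * sqrt ((1 + r)\<^sup>2 + 4 * u\<^sup>2))\<^sup>2 \<le> ((1 + r) * q - (1 - r) * u)\<^sup>2" by simp
  qed
  moreover have "sqrt ((1 + r)\<^sup>2 + 4 * u\<^sup>2) = (1 + r) * sqrt (1 + (2 / (1 + r) * u)\<^sup>2)"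
  proof -
    have "(1 + r)\<^sup>2 + 4 * u\<^sup>2 = (1 + r)\<^sup>2 * (1 + (2 / (1 + r) * u)\<^sup>2)"
      using p by (simp add: power_mult_distrib power_divide distrib_left)
    then show ?thesis using p by (simp only: real_sqrt_mult real_sqrt_abs abs_of_pos)
  qed
  ultimately have "(1 + r) * (r * sqrt (1 + (2 / (1 + r) * u)\<^sup>2)) \<le> (1 + r) * (u + q) - 2 * u"
    by (simp add: algebra_simps)
  also have "\<dots> = (1 + r) * (u + q - 2 / (1 + r) * u)" using p by (simp add: field_simps)
  finally have "r * sqrt (1 + (2 / (1 + r) * u)\<^sup>2) \<le> u + q - 2 / (1 + r) * u"
    using p by (simp only: mult_le_cancel_left_pos)
  then show ?thesis by (simp add: q_def)
qed

text \<open>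
  Substituting \<open>t = 2 / (1 + r) * u\<close> makes the integrand for \<open>r\<close> dominate the one for 1 pointwise. Hence
  \<open>(1 + r) * slope_integral n r\<close> is smallest at \<open>r = 1\<close>, which is the decisive step for the inequality.
\<close>
lemma slope_integral_lower:
  assumes r: "0 \<le> r" "r \<le> 1"
  shows "ennreal (2 / (1 + r)) * slope_integral n 1 \<le> slope_integral n r"
proof -
  define c where "c = 2 / (1 + r)"
  have c: "c > 0" using r by (simp add: c_def)
  let ?h = "\<lambda>r t. ennreal ((1 + (t + r * sqrt (1 + t\<^sup>2))\<^sup>2) powr (- real n / 2)) * indicator {0..} t"
  have "slope_integral n r = ennreal \<bar>c\<bar> * (\<integral>\<^sup>+u. ?h r (0 + c * u) \<partial>lborel)"
    unfolding slope_integral_def by (rule nn_integral_real_affine) (use c in auto)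
  also have "\<dots> \<ge> ennreal c * (\<integral>\<^sup>+u. ?h 1 u \<partial>lborel)"
    unfolding abs_of_pos[OF c]
  proof (intro mult_left_mono nn_integral_mono)
    fix u :: real
    show "?h 1 u \<le> ?h r (0 + c * u)"
    proof (cases "u \<ge> 0")
      case True
      have "(1 + (u + 1 * sqrt (1 + u\<^sup>2))\<^sup>2) powr (- real n / 2) \<le> (1 + (c * u + r * sqrt (1 + (c * u)\<^sup>2))\<^sup>2) powr (- real n / 2)"
      proof (rule powr_mono2')
        have "0 \<le> c * u + r * sqrt (1 + (c * u)\<^sup>2)" using True c r by (intro add_nonneg_nonneg mult_nonneg_nonneg) auto
        then show "1 + (c * u + r * sqrt (1 + (c * u)\<^sup>2))\<^sup>2 \<le> 1 + (u + 1 * sqrt (1 + u\<^sup>2))\<^sup>2"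
          using chord_slope_dilation[OF True r] by (intro add_left_mono power_mono) (auto simp: c_def)
      qed (auto simp: add_pos_nonneg)
      then show ?thesis using True c by (simp add: indicator_def ennreal_leI)
    qed (simp add: indicator_def)
  qed simp
  finally show ?thesis by (simp add: slope_integral_def c_def)
qed

text \<open>
  Crude, but sharp as \<open>r\<close> tends to 1, which is all that the optimality of the constant requires.
\<close>
lemma slope_integral_upper:
  assumes r: "0 < r" "r \<le> 1"
  shows "slope_integral n r \<le> ennreal (r powr (- real n)) * slope_integral n 1"
proof -
  have "slope_integral n r \<le> (\<integral>\<^sup>+t. ennreal (r powr (- real n)) * (ennreal ((1 + (t + 1 * sqrt (1 + t\<^sup>2))\<^sup>2) powr (- real n / 2)) * indicator {0..} t) \<partial>lborel)"
    unfolding slope_integral_def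
  proof (rule nn_integral_mono)
    fix t :: real
    show "ennreal ((1 + (t + r * sqrt (1 + t\<^sup>2))\<^sup>2) powr (- real n / 2)) * indicator {0..} t \<le>
      ennreal (r powr (- real n)) * (ennreal ((1 + (t + 1 * sqrt (1 + t\<^sup>2))\<^sup>2) powr (- real n / 2)) * indicator {0..} t)"
    proof (cases "t \<ge> 0")
      case True
      define p where "p = t + 1 * sqrt (1 + t\<^sup>2)"
      have p0: "0 \<le> p" using True by (simp add: p_def add_nonneg_nonneg)
      have "r * p \<le> t + r * sqrt (1 + t\<^sup>2)"
        using True r mult_right_mono[of r 1 t] by (simp add: p_def algebra_simps)
      then have "(r * p)\<^sup>2 \<le> (t + r * sqrt (1 + t\<^sup>2))\<^sup>2" using p0 r by (intro power_mono) auto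
      moreover have "r\<^sup>2 \<le> 1" using r by (simp add: power_le_one)
      ultimately have "r\<^sup>2 * (1 + p\<^sup>2) \<le> 1 + (t + r * sqrt (1 + t\<^sup>2))\<^sup>2"
        by (simp add: power_mult_distrib algebra_simps)
      then have "(1 + (t + r * sqrt (1 + t\<^sup>2))\<^sup>2) powr (- real n / 2) \<le> (r\<^sup>2 * (1 + p\<^sup>2)) powr (- real n / 2)"
        using r by (intro powr_mono2') (auto simp: add_pos_nonneg)
      also have "\<dots> = (r\<^sup>2) powr (- real n / 2) * (1 + p\<^sup>2) powr (- real n / 2)"
        by (rule powr_mult)
      also have "(r\<^sup>2) powr (- real n / 2) = r powr (- real n)"
        using r by (simp add: powr_powr flip: powr_numeral)
      finally show ?thesis using True by (simp add: p_def ennreal_leI flip: ennreal_mult)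
    qed (simp add: indicator_def)
  qed
  also have "\<dots> = ennreal (r powr (- real n)) * slope_integral n 1"
    unfolding slope_integral_def by (rule nn_integral_cmult) measurable
  finally show ?thesis .
qed

text \<open>
  The substitution \<open>\<tau> = sqrt (1 + t^2) - t\<close>, whose inverse \<open>1 / \<tau> = t + sqrt (1 + t^2)\<close> is the slope in the
  integrand, maps the half-line onto \<open>{0<..1}\<close>.
\<close>
lemma slope_integral_1:
  assumes n: "n \<ge> 2"
  shows "slope_integral n 1 = ennreal (schwarz_integral n / 2)"
proof -
  define \<phi> where "\<phi> s = s ^ (n - 2) * (1 + s\<^sup>2) powr (1 - real n / 2)" for s :: real
  define \<Phi> where "\<Phi> x = integral {0..x} \<phi>" for x
  define \<tau> where "\<tau> t = sqrt (1 + t\<^sup>2) - t" for t :: real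
  have c\<phi>: "continuous_on S \<phi>" for S unfolding \<phi>_def
    by (intro continuous_intros) (auto simp: add_nonneg_eq_0_iff)
  have d\<Phi>: "(\<Phi> has_real_derivative \<phi> x) (at x)" if "0 < x" "x \<le> 1" for x
  proof -
    have "(\<Phi> has_real_derivative \<phi> x) (at x within {0..2})"
      unfolding \<Phi>_def using that by (intro integral_has_real_derivative c\<phi>) auto
    then have "(\<Phi> has_real_derivative \<phi> x) (at x within {0<..<2})" by (rule DERIV_subset) auto
    then show ?thesis using that by (simp add: at_within_open[of x "{0<..<2}"])
  qed
  have s0: "sqrt (1 + t\<^sup>2) > 0" "(sqrt (1 + t\<^sup>2))\<^sup>2 = 1 + t\<^sup>2" for t :: real
    by (simp_all add: add_pos_nonneg add_nonneg_nonneg)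
  have \<tau>0: "0 < \<tau> t" if "t \<ge> 0" for t unfolding \<tau>_def using that by (simp add: real_less_rsqrt)
  have \<tau>1: "\<tau> t \<le> 1" if "t \<ge> 0" for t
    unfolding \<tau>_def using that by (simp add: real_le_lsqrt power2_eq_square algebra_simps)
  have \<tau>p: "\<tau> t * (t + sqrt (1 + t\<^sup>2)) = 1" for t
    unfolding \<tau>_def using s0(2)[of t] by (simp add: power2_eq_square algebra_simps)
  have d\<tau>: "(\<tau> has_real_derivative - \<tau> t / sqrt (1 + t\<^sup>2)) (at t)" for t
  proof -
    have "(\<tau> has_real_derivative (inverse (sqrt (1 + t\<^sup>2)) / 2) * (2 * t) - 1) (at t)"
      unfolding \<tau>_def[abs_def]
      by (intro DERIV_diff DERIV_ident DERIV_chain2[OF DERIV_real_sqrt])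
         (auto intro!: derivative_eq_intros simp: add_pos_nonneg)
    moreover have "(inverse (sqrt (1 + t\<^sup>2)) / 2) * (2 * t) - 1 = - \<tau> t / sqrt (1 + t\<^sup>2)"
      using s0(1)[of t] by (simp add: \<tau>_def field_simps)
    ultimately show ?thesis by simp
  qed
  have key: "(1 + (t + 1 * sqrt (1 + t\<^sup>2))\<^sup>2) powr (- real n / 2) = \<phi> (\<tau> t) * (\<tau> t / sqrt (1 + t\<^sup>2)) / 2" if t: "t \<ge> 0" for t
  proof -
    define T where "T = \<tau> t"
    define q where "q = sqrt (1 + t\<^sup>2)"
    have T: "T > 0" "T \<le> 1" using \<tau>0[OF t] \<tau>1[OF t] by (auto simp: T_def)
    have p: "t + q = 1 / T" using \<tau>p[of t] T by (simp add: T_def q_def field_simps)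
    have q: "q = (1 + T\<^sup>2) / (2 * T)"
    proof -
      have "2 * q = T + 1 / T" using p by (simp add: T_def \<tau>_def q_def)
      then show ?thesis using T by (simp add: field_simps power2_eq_square)
    qed
    define R where "R = (1 + T\<^sup>2) powr (- real n / 2)"
    have R: "(1 + T\<^sup>2) powr (1 - real n / 2) = (1 + T\<^sup>2) * R"
      unfolding R_def using one_plus_square_powr_Suc[of T "1 - real n / 2"] by simp
    have "(1 + (t + q)\<^sup>2) = (1 + T\<^sup>2) * T powr (- 2)" 
      unfolding p using T by (simp add: field_simps powr_minus power2_eq_square)
    then have "(1 + (t + q)\<^sup>2) powr (- real n / 2) = ((1 + T\<^sup>2) * T powr (- 2)) powr (- real n / 2)" by simp
    also have "\<dots> = R * (T powr (- 2)) powr (- real n / 2)"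
      unfolding R_def by (rule powr_mult)
    also have "(T powr (- 2)) powr (- real n / 2) = T ^ n"
      using T by (simp add: powr_powr powr_realpow)
    finally have 1: "(1 + (t + q)\<^sup>2) powr (- real n / 2) = R * T ^ n" .
    have "T ^ ((n - 2) + 2) = T ^ (n - 2) * T\<^sup>2" by (rule power_add)
    then have "T ^ n = T ^ (n - 2) * T\<^sup>2" by (simp only: le_add_diff_inverse2[OF n])
    moreover have "1 + T\<^sup>2 \<noteq> 0" by (simp add: add_nonneg_eq_0_iff)
    ultimately have "R * T ^ n = \<phi> T * (T / q) / 2"
      unfolding \<phi>_def R q using T by (simp add: field_simps power2_eq_square)
    with 1 show ?thesis by (simp add: q_def T_def)
  qed
  have "slope_integral n 1 = (\<integral>\<^sup>+t. ennreal ((1 + (t + 1 * sqrt (1 + t\<^sup>2))\<^sup>2) powr (- real n / 2)) * indicator {0..} t \<partial>lborel)"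
    by (simp add: slope_integral_def)
  also have "\<dots> = ennreal (0 - (- \<Phi> (\<tau> 0) / 2))"
  proof (rule nn_integral_FTC_atLeast)
    fix t :: real assume t: "0 \<le> t"
    have "((\<lambda>t. \<Phi> (\<tau> t)) has_real_derivative \<phi> (\<tau> t) * (- \<tau> t / sqrt (1 + t\<^sup>2))) (at t)"
      by (rule DERIV_chain2[OF d\<Phi> d\<tau>]) (use \<tau>0[OF t] \<tau>1[OF t] in auto)
    from DERIV_cdivide[OF DERIV_minus[OF this], of 2]
    show "((\<lambda>t. - \<Phi> (\<tau> t) / 2) has_real_derivative (1 + (t + 1 * sqrt (1 + t\<^sup>2))\<^sup>2) powr (- real n / 2)) (at t)"
      unfolding key[OF t] by simp
  next
    have "continuous_on {0..1} \<Phi>"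
      unfolding \<Phi>_def by (intro indefinite_integral_continuous_1 integrable_continuous_interval c\<phi>)
    then have "(\<Phi> \<longlongrightarrow> \<Phi> 0) (at 0 within {0..1})" by (simp add: continuous_on_def)
    moreover have "filterlim \<tau> (at 0 within {0..1}) at_top"
      unfolding filterlim_at
    proof
      show "\<forall>\<^sub>F t in at_top. \<tau> t \<in> {0..1} \<and> \<tau> t \<noteq> 0"
        using eventually_ge_at_top[of 0] by eventually_elim (use \<tau>0 \<tau>1 in force)
      show "(\<tau> \<longlongrightarrow> 0) at_top"
      proof (rule tendsto_sandwich[OF _ _ tendsto_const])
        show "\<forall>\<^sub>F t in at_top. 0 \<le> \<tau> t"
          using eventually_ge_at_top[of 0] by eventually_elim (use \<tau>0 in force)
        show "\<forall>\<^sub>F t in at_top. \<tau> t \<le> 1 / t"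
          using eventually_gt_at_top[of 0]
        proof eventually_elim
          case (elim t)
          have "\<tau> t * t \<le> \<tau> t * (t + sqrt (1 + t\<^sup>2))" using \<tau>0[of t] elim s0(1)[of t] by (intro mult_left_mono) auto
          then show ?case using elim \<tau>p[of t] by (simp add: field_simps)
        qed
        show "((\<lambda>t::real. 1 / t) \<longlongrightarrow> 0) at_top"
          by (intro tendsto_divide_0[OF tendsto_const] filterlim_at_top_imp_at_infinity filterlim_ident)
      qed
    qed
    ultimately have "((\<lambda>t. \<Phi> (\<tau> t)) \<longlongrightarrow> \<Phi> 0) at_top" by (rule filterlim_compose)
    then have "((\<lambda>t. - \<Phi> (\<tau> t) / 2) \<longlongrightarrow> - \<Phi> 0 / 2) at_top" by (intro tendsto_intros) auto
    moreover have "\<Phi> 0 = 0" by (simp add: \<Phi>_def)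
    ultimately show "((\<lambda>t. - \<Phi> (\<tau> t) / 2) \<longlongrightarrow> 0) at_top" by simp
  qed auto
  also have "\<Phi> (\<tau> 0) = schwarz_integral n" by (simp add: \<Phi>_def \<tau>_def schwarz_integral_def \<phi>_def[abs_def])
  finally show ?thesis by simp
qed

lemma schwarz_integral_nonneg: "schwarz_integral n \<ge> 0"
  unfolding schwarz_integral_def by (rule integral_nonneg) (auto intro!: integrable_continuous_interval continuous_intros simp: add_nonneg_eq_0_iff)

section \<open>The hypergeometric form of the constant\<close>

lemma Beta_pochhammer:
  fixes c :: real
  assumes c: "c > 1"
  shows "(c - 1) * Beta (real k + 1) (c - 1) = fact k / pochhammer c k"
proof -
  have ni: "c \<notin> \<int>\<^sub>\<le>\<^sub>0" using c by (auto dest: nonpos_Ints_nonpos)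
  have 1: "Gamma c = (c - 1) * Gamma (c - 1)" using Gamma_plus1_pos[of "c - 1"] c by simp
  have "Gamma c > 0" using c by (intro Gamma_real_pos) simp
  then have 2: "Gamma (c + real k) = pochhammer c k * Gamma c"
    using pochhammer_Gamma[OF ni, of k] by (simp add: field_simps)
  have 3: "Gamma (real k + 1) = fact k" using Gamma_fact[of k, where 'a = real] by (simp add: add.commute)
  have "(c - 1) * Beta (real k + 1) (c - 1) = fact k * Gamma c / Gamma (c + real k)"
    unfolding Beta_def 3 1 by (simp add: algebra_simps)
  also have "\<dots> = fact k / pochhammer c k" unfolding 2 using \<open>Gamma c > 0\<close> by simp
  finally show ?thesis .
qed

text \<open>
  Expand the second factor of the integrand into its binomial series and integrate term by term against
  the Beta density; on \<open>{0..1}\<close> the series converges uniformly since \<open>\<bar>x\<bar> < 1\<close>.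
\<close>
lemma hypergeometric_Euler_integral:
  fixes c x :: real
  assumes c: "c > 2" and x: "\<bar>x\<bar> < 1"
  shows "eval_fps (fps_hypergeo [1/2, 1] [c] 1) x =
    (c - 1) * integral {0..1} (\<lambda>u. (1 - u) powr (c - 2) * (1 - x * u) powr (- 1 / 2))"
proof -
  define p where "p k = pochhammer (1/2 :: real) k / fact k" for k :: nat
  have p0: "p k \<ge> 0" for k unfolding p_def by (intro divide_nonneg_pos pochhammer_nonneg) auto
  have ps: "(\<lambda>k. p k * z ^ k) sums (1 - z) powr (- 1 / 2)" if "\<bar>z\<bar> < 1" for z :: real
  proof -
    have "(\<lambda>k. ((- 1 / 2) gchoose k) * (- z) ^ k) sums (1 + - z) powr (- 1 / 2)"
      by (rule gen_binomial_real) (use that in simp)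
    moreover have "((- 1 / 2) gchoose k) * (- z) ^ k = p k * z ^ k" for k
    proof -
      have "(- 1 / 2 :: real) gchoose k = (- 1) ^ k * p k"
        by (simp add: gbinomial_pochhammer p_def)
      moreover have "(- z) ^ k = (- 1) ^ k * z ^ k" by (rule power_minus)
      moreover have "(- 1 :: real) ^ k * (- 1) ^ k = 1" by (simp flip: power_mult_distrib)
      ultimately show ?thesis by (simp add: algebra_simps)
    qed
    ultimately show ?thesis by simp
  qed
  define f where "f k u = (1 - u) powr (c - 2) * (p k * (x * u) ^ k)" for k and u :: real
  have ul: "uniform_limit {0..1} (\<lambda>N u. \<Sum>k<N. f k u) (\<lambda>u. suminf (\<lambda>k. f k u)) sequentially"
  proof (rule Weierstrass_m_test)
    show "summable (\<lambda>k. p k * \<bar>x\<bar> ^ k)" using ps[of "\<bar>x\<bar>"] x by (simp add: sums_iff)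
    fix k and u :: real assume u: "u \<in> {0..1}"
    have "(1 - u) powr (c - 2) \<le> 1" using u c by (intro powr_le1) auto
    moreover have "\<bar>x * u\<bar> ^ k \<le> \<bar>x\<bar> ^ k" using u by (intro power_mono) (auto simp: abs_mult mult_left_le)
    ultimately have "(1 - u) powr (c - 2) * (p k * \<bar>x * u\<bar> ^ k) \<le> 1 * (p k * \<bar>x\<bar> ^ k)"
      using p0 by (intro mult_mono) auto
    then show "norm (f k u) \<le> p k * \<bar>x\<bar> ^ k"
      using p0[of k] by (simp add: f_def abs_mult power_abs)
  qed
  have cf: "continuous_on {0..1} (\<lambda>u. \<Sum>k<N. f k u)" for N
    unfolding f_def using c
    by (intro continuous_on_sum continuous_on_mult continuous_on_powr' continuous_on_power continuous_on_diff continuous_on_const continuous_on_id) auto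
  obtain I J where IJ: "\<And>N. ((\<lambda>u. \<Sum>k<N. f k u) has_integral I N) {0..1}"
    "((\<lambda>u. suminf (\<lambda>k. f k u)) has_integral J) {0..1}" "I \<longlonglongrightarrow> J"
    by (rule uniform_limit_integral[OF ul cf sequentially_bot]) blast
  have fk: "(f k has_integral p k * x ^ k * Beta (real k + 1) (c - 1)) {0..1}" for k
  proof -
    have "((\<lambda>t. t powr (real k + 1 - 1) * (1 - t) powr (c - 1 - 1)) has_integral Beta (real k + 1) (c - 1)) {0..1}"
      by (rule has_integral_Beta_real) (use c in auto)
    from has_integral_mult_right[OF this, of "p k * x ^ k"]
    have "((\<lambda>t. p k * x ^ k * (t powr (real k + 1 - 1) * (1 - t) powr (c - 1 - 1))) has_integral p k * x ^ k * Beta (real k + 1) (c - 1)) {0..1}" .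
    \<comment> \<open>The point 0 is exceptional because \<open>0 powr 0 = 0\<close> but \<open>0 ^ 0 = 1\<close>.\<close>
    then show ?thesis
      by (rule has_integral_spike_finite[of "{0}", rotated 2])
         (auto simp: f_def powr_realpow power_mult_distrib algebra_simps)
  qed
  have "I N = (\<Sum>k<N. p k * x ^ k * Beta (real k + 1) (c - 1))" for N
    by (rule has_integral_unique[OF IJ(1)], rule has_integral_sum[OF finite_lessThan fk])
  then have "(c - 1) * I N = (\<Sum>k<N. p k * x ^ k * ((c - 1) * Beta (real k + 1) (c - 1)))" for N
    by (simp add: sum_distrib_left algebra_simps)
  moreover have "p k * x ^ k * ((c - 1) * Beta (real k + 1) (c - 1)) = fps_nth (fps_hypergeo [1/2, 1] [c] 1) k * x ^ k" for k
    using Beta_pochhammer[of c k] c by (simp add: p_def pochhammer_fact[symmetric])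
  ultimately have "(c - 1) * I N = (\<Sum>k<N. fps_nth (fps_hypergeo [1/2, 1] [c] 1) k * x ^ k)" for N
    by (simp only:)
  moreover have "(\<lambda>N. (c - 1) * I N) \<longlonglongrightarrow> (c - 1) * J" by (intro tendsto_intros IJ)
  ultimately have "(\<lambda>k. fps_nth (fps_hypergeo [1/2, 1] [c] 1) k * x ^ k) sums ((c - 1) * J)"
    by (simp add: sums_def)
  then have "eval_fps (fps_hypergeo [1/2, 1] [c] 1) x = (c - 1) * J"
    by (simp add: eval_fps_def sums_iff)
  moreover have "J = integral {0..1} (\<lambda>u. (1 - u) powr (c - 2) * (1 - x * u) powr (- 1 / 2))"
  proof -
    have "suminf (\<lambda>k. f k u) = (1 - u) powr (c - 2) * (1 - x * u) powr (- 1 / 2)" if "u \<in> {0..1}" for u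
    proof -
      have "\<bar>x * u\<bar> \<le> \<bar>x\<bar>" using that by (auto simp: abs_mult mult_left_le)
      then have "\<bar>x * u\<bar> < 1" using x by linarith
      from sums_mult[OF ps[OF this], of "(1 - u) powr (c - 2)"] show ?thesis
        by (simp add: f_def sums_iff)
    qed
    then have "integral {0..1} (\<lambda>u. suminf (\<lambda>k. f k u)) = integral {0..1} (\<lambda>u. (1 - u) powr (c - 2) * (1 - x * u) powr (- 1 / 2))"
      by (intro Henstock_Kurzweil_Integration.integral_cong)
    then show ?thesis using IJ(2) by (simp add: integral_unique)
  qed
  ultimately show ?thesis by simp
qed

text \<open>
  The Euler integral is continuous in \<open>x\<close> on \<open>{-1..0}\<close>, so the extension by continuity is given by the same
  formula.
\<close>
lemma hyp2F1_at_minus_1: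
  assumes c: "c > 2"
  shows "hyp2F1 (1/2) 1 c (-1) = (c - 1) * integral {0..1} (\<lambda>u. (1 - u) powr (c - 2) * (1 + u) powr (- 1 / 2))"
proof -
  define G where "G x = integral {0..1} (\<lambda>u. (1 - u) powr (c - 2) * (1 - x * u) powr (- 1 / 2))" for x :: real
  have pos: "1 - x * u \<noteq> 0" if "x \<in> {-1..0}" "u \<in> {0..1}" for x u :: real
    using that mult_nonneg_nonneg[of "- x" u] by auto
  have "continuous_on {-1..0} (\<lambda>x. integral (cbox 0 1) (\<lambda>u. (1 - u) powr (c - 2) * (1 - x * u) powr (- 1 / 2)))"
    by (rule integral_continuous_on_param)
       (unfold case_prod_beta, intro continuous_on_mult continuous_on_powr' continuous_on_diff continuous_on_const
          continuous_on_fst continuous_on_snd continuous_on_id, use pos c in \<open>auto simp: mult_nonpos_nonneg intro: order_trans[of _ 0]\<close>)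
  then have "continuous_on {-1..0} G" by (simp add: G_def[abs_def])
  then have G: "(G \<longlongrightarrow> G (-1)) (at (-1) within {-1..0})" by (simp add: continuous_on_def)
  have "((\<lambda>x. (c - 1) * G x) \<longlongrightarrow> (c - 1) * G (-1)) (at (-1) within {-1<..<0})"
    by (intro tendsto_intros tendsto_within_subset[OF G]) auto
  moreover have "at (-1::real) within {-1<..<0} = at (-1) within {-1<..<1}"
    by (rule at_within_nhd[of _ "{..<0}"]) auto
  ultimately have "((\<lambda>x. (c - 1) * G x) \<longlongrightarrow> (c - 1) * G (-1)) (at (-1) within {-1<..<1})" by simp
  moreover have "\<forall>\<^sub>F x in at (-1) within {-1<..<1}. (c - 1) * G x = eval_fps (fps_hypergeo [1/2, 1] [c] 1) x"
    unfolding eventually_at_filter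
    by (intro always_eventually allI impI) (auto simp: hypergeometric_Euler_integral[OF c] G_def)
  ultimately have "(eval_fps (fps_hypergeo [1/2, 1] [c] 1) \<longlongrightarrow> (c - 1) * G (-1)) (at (-1) within {-1<..<1})"
    using tendsto_cong by fastforce
  moreover have "at (-1::real) within {-1<..<1} \<noteq> bot" by (simp add: at_within_eq_bot_iff)
  ultimately have "Lim (at (-1) within {-1<..<1}) (eval_fps (fps_hypergeo [1/2, 1] [c] 1)) = (c - 1) * G (-1)"
    by (intro tendsto_Lim)
  then show ?thesis by (simp add: hyp2F1_def G_def)
qed

text \<open>
  The substitution \<open>u = (1 - s^2) / (1 + s^2)\<close>.
\<close>
lemma Euler_integral_substitution:
  assumes n: "n \<ge> 2"
  shows "integral {0..1} (\<lambda>u. (1 - u) powr ((real n - 1) / 2) * (1 + u) powr (- 1 / 2)) =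
     2 * 2 powr (real n / 2) * integral {0..1} (\<lambda>s. s ^ n * (1 + s\<^sup>2) powr (- real n / 2 - 1))"
proof -
  define f where "f u = (1 - u) powr ((real n - 1) / 2) * (1 + u) powr (- 1 / 2)" for u :: real
  define g where "g s = (1 - s\<^sup>2) / (1 + s\<^sup>2)" for s :: real
  define g' where "g' s = - 4 * s / (1 + s\<^sup>2)\<^sup>2" for s :: real
  have p: "1 + s\<^sup>2 > 0" for s :: real by (simp add: add_pos_nonneg)
  have nz: "1 + s\<^sup>2 \<noteq> 0" for s :: real using p[of s] by simp
  have sub: "g ` {0..1} \<subseteq> {0..1}"
    using p by (auto simp: g_def field_simps power_le_one)
  have cf: "continuous_on {0..1} f"
    unfolding f_def using n
    by (intro continuous_on_mult continuous_on_powr' continuous_on_diff continuous_on_add continuous_on_const continuous_on_id) auto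
  have dg: "(g has_field_derivative g' s) (at s within {0..1})" for s
    unfolding g_def[abs_def] g'_def using nz[of s]
    by (auto intro!: derivative_eq_intros simp: power2_eq_square field_simps)
  have cg: "continuous_on {0..1} g" using dg by (rule DERIV_continuous_on)
  have "((\<lambda>s. g' s *\<^sub>R f (g s)) has_integral (integral {g 0..g 1} f - integral {g 1..g 0} f)) {0..1}"
    by (rule has_integral_substitution_general[OF _ _ sub cf cg dg]) auto
  from has_integral_neg[OF this]
  have "((\<lambda>s. - (g' s * f (g s))) has_integral - (integral {g 0..g 1} f - integral {g 1..g 0} f)) {0..1}"
    by (simp only: real_scaleR_def)
  moreover have "g 0 = 1" "g 1 = 0" by (simp_all add: g_def)
  ultimately have "((\<lambda>s. - (g' s * f (g s))) has_integral integral {0..1} f) {0..1}" by simp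
  moreover have "- (g' s * f (g s)) = 2 * 2 powr (real n / 2) * (s ^ n * (1 + s\<^sup>2) powr (- real n / 2 - 1))"
    if s: "s \<in> {0..1}" for s
  proof (cases "s = 0")
    case False
    then have s0: "s > 0" using s by simp
    define D where "D = 1 + s\<^sup>2"
    define m where "m = (real n - 1) / 2"
    have D: "D > 0" by (simp add: D_def p)
    have 1: "1 - g s = 2 * s\<^sup>2 / D" "1 + g s = 2 / D" using D by (simp_all add: g_def D_def field_simps)
    have 2: "(2 * s\<^sup>2 / D) powr m = 2 powr m * s powr (real n - 1) / D powr m"
    proof -
      have "2 * m = real n - 1" by (simp add: m_def)
      then have "(s\<^sup>2) powr m = s powr (real n - 1)" using s0 by (simp add: powr_powr flip: powr_numeral)
      then show ?thesis using s0 D by (simp add: powr_divide powr_mult)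
    qed
    have 3: "(2 / D) powr (- 1 / 2) = 2 powr (- 1 / 2) / D powr (- 1 / 2)"
      using D by (simp add: powr_divide)
    have "- (g' s * f (g s)) = 4 * s / D\<^sup>2 * ((2 powr m * s powr (real n - 1) / D powr m) * (2 powr (- 1 / 2) / D powr (- 1 / 2)))"
      unfolding f_def 1 m_def[symmetric] 2 3 by (simp add: g'_def D_def)
    also have "\<dots> = (4 * 2 powr m * 2 powr (- 1 / 2)) * (s * s powr (real n - 1)) * (1 / (D\<^sup>2 * D powr m * D powr (- 1 / 2)))"
      by (simp add: mult_ac)
    also have "4 * 2 powr m * 2 powr (- 1 / 2) = 2 * 2 powr (real n / 2)"
    proof -
      have "2 powr m * 2 powr (- 1 / 2) = 2 powr (m + - 1 / 2)" by (rule powr_add[symmetric])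
      also have "m + - 1 / 2 = real n / 2 - 1" by (simp add: m_def field_simps)
      also have "2 powr (real n / 2 - 1) = 2 powr (real n / 2) / 2" by (simp add: powr_diff)
      finally show ?thesis by simp
    qed
    also have "s * s powr (real n - 1) = s ^ n"
      using s0 powr_add[of s 1 "real n - 1"] by (simp add: powr_realpow)
    also have "1 / (D\<^sup>2 * D powr m * D powr (- 1 / 2)) = D powr (- real n / 2 - 1)"
    proof -
      have "D\<^sup>2 * D powr m * D powr (- 1 / 2) = D powr 2 * D powr m * D powr (- 1 / 2)" using D by simp
      also have "\<dots> = D powr (2 + m + - 1 / 2)" by (simp only: powr_add)
      also have "2 + m + - 1 / 2 = real n / 2 + 1" by (simp add: m_def field_simps)
      finally have e: "D\<^sup>2 * D powr m * D powr (- 1 / 2) = D powr (real n / 2 + 1)" .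
      have "- real n / 2 - 1 = - (real n / 2 + 1)" by simp
      then show ?thesis unfolding e by (simp only: powr_minus divide_inverse mult_1_left)
    qed
    finally show ?thesis by (simp add: D_def)
  qed (use n in \<open>simp add: g'_def\<close>)
  ultimately have "((\<lambda>s. 2 * 2 powr (real n / 2) * (s ^ n * (1 + s\<^sup>2) powr (- real n / 2 - 1))) has_integral integral {0..1} f) {0..1}"
    by (rule has_integral_eq[rotated]) 
  from integral_unique[OF this] show ?thesis unfolding f_def by (simp only: integral_mult_right)
qed

text \<open>
  Integration by parts of \<open>s ^ (n - 1) * (1 + s^2) powr (1 - n / 2)\<close> and of \<open>s ^ (n + 1) * (1 + s^2) powr (- n / 2)\<close>,
  with the intermediate integral \<open>L0\<close> eliminated.
\<close>
lemma schwarz_integral_reduction: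
  assumes n: "n \<ge> 2"
  shows "(real n - 1) * schwarz_integral n = real n * 2 powr (- real n / 2)
     - real n * (real n - 2) * integral {0..1} (\<lambda>s. s ^ n * (1 + s\<^sup>2) powr (- real n / 2 - 1))"
proof -
  define L where "L = integral {0..1} (\<lambda>s::real. s ^ n * (1 + s\<^sup>2) powr (- real n / 2 - 1))"
  define L0 where "L0 = integral {0..1} (\<lambda>s::real. s ^ n * (1 + s\<^sup>2) powr (- real n / 2))"
  have int: "((\<lambda>s::real. s ^ m * (1 + s\<^sup>2) powr a) has_integral integral {0..1} (\<lambda>s. s ^ m * (1 + s\<^sup>2) powr a)) {0..1}" for m a
    by (intro integrable_integral integrable_continuous_interval continuous_intros) (auto simp: add_nonneg_eq_0_iff)
  have d: "((\<lambda>s::real. s ^ m * (1 + s\<^sup>2) powr a) has_real_derivative real m * s ^ (m - 1) * (1 + s\<^sup>2) powr a + (a * (1 + s\<^sup>2) powr (a - 1) * (2 * s)) * s ^ m) (at s within {0..1})" for m a s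
    using has_field_derivative_at_within[OF DERIV_mult[OF DERIV_pow DERIV_one_plus_square_powr]] by simp
  have ftc: "((\<lambda>s. real m * s ^ (m - 1) * (1 + s\<^sup>2) powr a + (a * (1 + s\<^sup>2) powr (a - 1) * (2 * s)) * s ^ m) has_integral
      2 powr a) {0..1}" if "m > 0" for m a
    using fundamental_theorem_of_calculus[of 0 1 "\<lambda>s::real. s ^ m * (1 + s\<^sup>2) powr a", OF _ d[unfolded has_real_derivative_iff_has_vector_derivative]] that
    by (simp add: power_0_left)
  obtain k where k: "n = k + 2" using n by (metis add.commute le_Suc_ex)
  have 1: "2 powr (- real n / 2) = L0 + real n * L"
  proof -
    have h: "((\<lambda>s. 1 * (s ^ n * (1 + s\<^sup>2) powr (- real n / 2)) + real n * (s ^ n * (1 + s\<^sup>2) powr (- real n / 2 - 1)))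
      has_integral 1 * L0 + real n * L) {0..1}"
      unfolding L0_def L_def by (intro has_integral_add has_integral_mult_right int)
    have e: "real (n + 1) * s ^ (n + 1 - 1) * (1 + s\<^sup>2) powr (- real n / 2) + (- real n / 2 * (1 + s\<^sup>2) powr (- real n / 2 - 1) * (2 * s)) * s ^ (n + 1)
       = 1 * (s ^ n * (1 + s\<^sup>2) powr (- real n / 2)) + real n * (s ^ n * (1 + s\<^sup>2) powr (- real n / 2 - 1))" for s :: real
      unfolding one_plus_square_powr_Suc[of s "- real n / 2"] by (simp add: power2_eq_square field_simps)
    show ?thesis using has_integral_unique[OF ftc[of "n + 1" "- real n / 2", unfolded e] h] by simp
  qed
  have 2: "2 powr (1 - real n / 2) = (real n - 1) * schwarz_integral n + (2 - real n) * L0"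
  proof -
    have h: "((\<lambda>s. (real n - 1) * (s ^ (n - 2) * (1 + s\<^sup>2) powr (1 - real n / 2)) + (2 - real n) * (s ^ n * (1 + s\<^sup>2) powr (- real n / 2)))
      has_integral (real n - 1) * schwarz_integral n + (2 - real n) * L0) {0..1}"
      unfolding schwarz_integral_def L0_def by (intro has_integral_add has_integral_mult_right int)
    have e: "real (n - 1) * s ^ (n - 1 - 1) * (1 + s\<^sup>2) powr (1 - real n / 2) + ((1 - real n / 2) * (1 + s\<^sup>2) powr (1 - real n / 2 - 1) * (2 * s)) * s ^ (n - 1)
       = (real n - 1) * (s ^ (n - 2) * (1 + s\<^sup>2) powr (1 - real n / 2)) + (2 - real n) * (s ^ n * (1 + s\<^sup>2) powr (- real n / 2))" for s :: real
    proof -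
      have "s ^ n = s * s ^ (n - 1)" unfolding k by simp
      moreover have "(1 + s\<^sup>2) powr (1 - real n / 2 - 1) = (1 + s\<^sup>2) powr (- real n / 2)" by simp
      moreover have "real (n - 1) = real n - 1" "n - 1 - 1 = n - 2" using n by auto
      ultimately show ?thesis by (simp only:) (simp add: algebra_simps)
    qed
    show ?thesis using has_integral_unique[OF ftc[of "n - 1" "1 - real n / 2", unfolded e] h] n by simp
  qed
  have 3: "2 powr (1 - real n / 2) = 2 * 2 powr (- real n / 2)"
    using powr_add[of 2 1 "- real n / 2"] by simp
  show ?thesis using 1 2 3 unfolding L_def[symmetric] by (simp add: algebra_simps)
qed

text \<open>
  The hypergeometric value is \<open>(n + 1) * 2 powr (n / 2)\<close> times the integral that remains after the reduction of
  \<open>schwarz_integral\<close>, and the Gamma factors are those of \<open>student_mass\<close>.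
\<close>
theorem schwarz_const_eq:
  assumes n: "n \<ge> 2"
  shows "schwarz_const n = 2 * schwarz_integral n / student_mass (real n)"
proof -
  define L where "L = integral {0..1} (\<lambda>s::real. s ^ n * (1 + s\<^sup>2) powr (- real n / 2 - 1))"
  define N where "N = real n"
  define F where "F = hyp2F1 (1 / 2) 1 ((3 + N) / 2) (-1)"
  define g where "g = Gamma ((1 + N) / 2)"
  define P where "P = 2 powr (N / 2)"
  have N: "N \<ge> 2" using n by (simp add: N_def)
  have P: "P > 0" by (simp add: P_def)
  have "(3 + N) / 2 - 1 = (N + 1) / 2" "(3 + N) / 2 - 2 = (N - 1) / 2" by (simp_all add: field_simps)
  then have "F = (N + 1) / 2 * integral {0..1} (\<lambda>u. (1 - u) powr ((N - 1) / 2) * (1 + u) powr (- 1 / 2))"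
    unfolding F_def using hyp2F1_at_minus_1[of "(3 + N) / 2"] N by (simp only:) simp
  also have "\<dots> = (N + 1) * P * L"
    using Euler_integral_substitution[OF n] by (simp add: N_def P_def L_def)
  finally have F: "F = (N + 1) * P * L" .
  have "2 powr (- N / 2) = 1 / P" by (simp add: P_def powr_minus_divide)
  then have M: "(N - 1) * schwarz_integral n = N / P - N * (N - 2) * L"
    using schwarz_integral_reduction[OF n] by (simp add: N_def L_def)
  obtain k where k: "n = k + 2" using n by (metis add.commute le_Suc_ex)
  have f: "fact n = N * fact (n - 1)" unfolding N_def k by (simp add: algebra_simps)
  have g0: "g > 0" unfolding g_def using N by (intro Gamma_real_pos) simp
  have g3: "Gamma ((3 + N) / 2) = (1 + N) / 2 * g"
    using Gamma_plus1_pos[of "(1 + N) / 2"] N by (simp add: g_def field_simps)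
  have P2: "P * P = 2 ^ n" unfolding P_def N_def by (simp add: powr_realpow flip: powr_add)
  have P3: "2 powr (3 * N / 2) = P * (P * P)" unfolding P_def by (simp flip: powr_add)
  have m: "student_mass N * ((N - 1) * fact (n - 1)) = P * P * g\<^sup>2"
    using student_mass_closed_form[of k] unfolding P2 g_def N_def k
    by (simp add: add.commute)
  have m0: "student_mass N > 0" using N by (intro student_mass_pos) simp
  have "schwarz_const n = N * fact (n - 1) * (1 + N - (N - 2) * F) / (P * (P * P) * g * ((1 + N) / 2 * g))"
    unfolding schwarz_const_def f N_def[symmetric] F_def[symmetric] g_def[symmetric] g3 P3 ..
  also have "\<dots> = 2 * fact (n - 1) * (N / P - N * (N - 2) * L) / (P * P * g\<^sup>2)"
  proof -
    define K where "K = 1 + N"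
    define X where "X = 1 - (N - 2) * P * L"
    have "1 + N - (N - 2) * F = K * X" unfolding F K_def X_def by (simp add: algebra_simps)
    moreover have "N / P - N * (N - 2) * L = N * X / P" using P by (simp add: X_def field_simps)
    moreover have "K > 0" using N by (simp add: K_def)
    ultimately show ?thesis unfolding K_def[symmetric] using P g0 by (simp add: power2_eq_square mult_ac)
  qed
  also have "\<dots> = 2 * fact (n - 1) * ((N - 1) * schwarz_integral n) / (student_mass N * ((N - 1) * fact (n - 1)))"
    unfolding M m ..
  also have "\<dots> = 2 * schwarz_integral n / student_mass N"
    using N by simp
  finally show ?thesis by (simp add: N_def)
qed

section \<open>The sharp inequality\<close>

text \<open>
  With \<open>b\<close> a unit vector, \<open>(1 - r^2) * cap_mean b r\<close> is the harmonic measure of the hemisphere opposite to \<open>b\<close>,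
  seen from \<open>r *\<^sub>R b\<close>. The factor \<open>1 - r^2\<close> is split off because the rest is regular at \<open>r = 1\<close>.
\<close>
definition cap_mean :: "(real^'n) \<Rightarrow> real \<Rightarrow> real" where
  "cap_mean b r = sphere_mean (\<lambda>z. indicator {..<0} (z \<bullet> b) * (1 + r\<^sup>2 - 2 * r * (z \<bullet> b)) powr (- real CARD('n) / 2))"

text \<open>
  The zonal formula, after the reflection \<open>t \<mapsto> - t\<close>.
\<close>
lemma cap_mean_eq_slope_integral:
  fixes b :: "real^'n"
  assumes b: "b \<in> Basis" and n: "CARD('n) \<ge> 2" and r: "r \<ge> 0"
  shows "ennreal (student_mass (real CARD('n)) * cap_mean b r) = slope_integral CARD('n) r"
proof -
  define a where "a = - real CARD('n) / 2"
  define \<phi> where "\<phi> s = indicator {..<0} s * (1 + r\<^sup>2 - 2 * r * s) powr a" for s :: real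
  have \<phi>m[measurable]: "\<phi> \<in> borel_measurable borel" unfolding \<phi>_def[abs_def] by measurable
  have bd: "\<phi> s \<le> 1" for s
  proof (cases "s < 0")
    case True
    then have "r * s \<le> 0" using r by (simp add: mult_nonneg_nonpos)
    then have "1 \<le> 1 + r\<^sup>2 - 2 * r * s" using zero_le_power2[of r] by linarith
    then have "(1 + r\<^sup>2 - 2 * r * s) powr a \<le> 1 powr a" by (intro powr_mono2') (auto simp: a_def)
    then show ?thesis by (simp add: \<phi>_def indicator_def)
  qed (simp add: \<phi>_def)
  have m: "student_mass (real CARD('n)) > 0" using n by (intro student_mass_pos) simp
  have "ennreal (student_mass (real CARD('n)) * cap_mean b r) =
      (\<integral>\<^sup>+t. ennreal (\<phi> (t / sqrt (1 + t\<^sup>2)) * (1 + t\<^sup>2) powr (- real DIM(real^'n) / 2)) \<partial>lborel)"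
    unfolding cap_mean_def a_def[symmetric] \<phi>_def[symmetric]
    by (rule sphere_mean_zonal[OF b _ \<phi>m _ bd _ m, symmetric])
       (use n nn_integral_student[OF n] in \<open>auto simp: \<phi>_def\<close>)
  also have "\<dots> = (\<integral>\<^sup>+t. ennreal (\<phi> (t / sqrt (1 + t\<^sup>2)) * (1 + t\<^sup>2) powr a) \<partial>lborel)"
    by (simp add: a_def)
  also have "\<dots> = (\<integral>\<^sup>+t. ennreal (\<phi> (- t / sqrt (1 + t\<^sup>2)) * (1 + t\<^sup>2) powr a) \<partial>lborel)"
    by (subst nn_integral_real_affine[where c = "-1" and t = 0]) auto
  also have "\<dots> = slope_integral CARD('n) r"
    unfolding slope_integral_def
  proof (rule nn_integral_cong_AE)
    have eq: "ennreal (\<phi> (- t / sqrt (1 + t\<^sup>2)) * (1 + t\<^sup>2) powr a) =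
       ennreal ((1 + (t + r * sqrt (1 + t\<^sup>2))\<^sup>2) powr (- real CARD('n) / 2)) * indicator {0..} t" if t: "t \<noteq> 0" for t :: real
    proof (cases "t > 0")
      case True
      define q where "q = sqrt (1 + t\<^sup>2)"
      have q: "q > 0" "q\<^sup>2 = 1 + t\<^sup>2" by (simp_all add: q_def add_pos_nonneg add_nonneg_nonneg)
      have "- t / q < 0" using True q by simp
      then have "\<phi> (- t / q) * (1 + t\<^sup>2) powr a = (1 + r\<^sup>2 - 2 * r * (- t / q)) powr a * (1 + t\<^sup>2) powr a"
        by (simp add: \<phi>_def)
      also have "\<dots> = ((1 + r\<^sup>2 - 2 * r * (- t / q)) * (1 + t\<^sup>2)) powr a"
        by (rule powr_mult[symmetric])
      also have "(1 + r\<^sup>2 - 2 * r * (- t / q)) * (1 + t\<^sup>2) = 1 + (t + r * q)\<^sup>2"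
      proof -
        have "(1 + r\<^sup>2 - 2 * r * (- t / q)) * q\<^sup>2 = (1 + r\<^sup>2) * q\<^sup>2 + 2 * r * t * q"
          using q(1) by (simp add: field_simps power2_eq_square)
        also have "\<dots> = q\<^sup>2 + 2 * r * t * q + r\<^sup>2 * q\<^sup>2" by (simp add: algebra_simps)
        also have "\<dots> = 1 + (t + r * q)\<^sup>2" unfolding power2_sum power_mult_distrib using q(2) by (simp add: algebra_simps)
        finally show ?thesis using q(2) by simp
      qed
      finally show ?thesis using True by (simp add: q_def a_def)
    next
      case False
      then have "0 \<le> - t / sqrt (1 + t\<^sup>2)" by (intro divide_nonneg_nonneg) (auto simp: add_nonneg_nonneg)
      then have "\<phi> (- t / sqrt (1 + t\<^sup>2)) = 0" by (simp only: \<phi>_def) simp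
      then show ?thesis using False t by (simp add: indicator_def)
    qed
    show "AE t in lborel. ennreal (\<phi> (- t / sqrt (1 + t\<^sup>2)) * (1 + t\<^sup>2) powr a) =
       ennreal ((1 + (t + r * sqrt (1 + t\<^sup>2))\<^sup>2) powr (- real CARD('n) / 2)) * indicator {0..} t"
      using AE_lborel_singleton[of "0::real"] by (rule AE_mp) (rule AE_I2, rule impI, rule eq)
  qed
  finally show ?thesis .
qed

lemma sphere_mean_equator:
  fixes b :: "real^'n"
  assumes b: "b \<in> Basis" and n: "CARD('n) \<ge> 2"
  shows "sphere_mean (\<lambda>z. indicator {0} (z \<bullet> b)) = 0"
proof -
  define \<phi> where "\<phi> s = indicat_real {0} s" for s :: real
  have \<phi>m[measurable]: "\<phi> \<in> borel_measurable borel" unfolding \<phi>_def[abs_def] by measurable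
  have m: "student_mass (real CARD('n)) > 0" using n by (intro student_mass_pos) simp
  have "(\<integral>\<^sup>+t. ennreal (\<phi> (t / sqrt (1 + t\<^sup>2)) * (1 + t\<^sup>2) powr (- real DIM(real^'n) / 2)) \<partial>lborel) = (\<integral>\<^sup>+t. 0 \<partial>(lborel :: real measure))"
  proof (rule nn_integral_cong_AE)
    have "ennreal (\<phi> (t / sqrt (1 + t\<^sup>2)) * (1 + t\<^sup>2) powr (- real DIM(real^'n) / 2)) = 0" if "t \<noteq> 0" for t :: real
      using that by (simp add: \<phi>_def indicator_def add_nonneg_eq_0_iff)
    then show "AE t in lborel. ennreal (\<phi> (t / sqrt (1 + t\<^sup>2)) * (1 + t\<^sup>2) powr (- real DIM(real^'n) / 2)) = 0"
      using AE_lborel_singleton[of "0::real"] by (elim AE_mp) auto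
  qed
  also have "(\<integral>\<^sup>+t. ennreal (\<phi> (t / sqrt (1 + t\<^sup>2)) * (1 + t\<^sup>2) powr (- real DIM(real^'n) / 2)) \<partial>lborel)
     = ennreal (student_mass (real CARD('n)) * sphere_mean (\<lambda>z. \<phi> (z \<bullet> b)))"
    by (rule sphere_mean_zonal[OF b _ \<phi>m, of 1]) (use n nn_integral_student[OF n] m in \<open>auto simp: \<phi>_def indicator_def\<close>)
  finally have "student_mass (real CARD('n)) * sphere_mean (\<lambda>z. \<phi> (z \<bullet> b)) \<le> 0"
    by (simp add: ennreal_eq_0_iff)
  then have "sphere_mean (\<lambda>z. \<phi> (z \<bullet> b)) \<le> 0" using m by (simp add: mult_le_0_iff)
  moreover have "sphere_mean (\<lambda>z. \<phi> (z \<bullet> b)) \<ge> 0"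
    unfolding sphere_mean_def
    by (intro divide_nonneg_pos Bochner_Integration.integral_nonneg mult_nonneg_nonneg shell_weight_nonneg shell_mass_pos)
       (simp add: \<phi>_def)
  ultimately show ?thesis unfolding \<phi>_def by simp
qed

lemma poisson_kernel_axis:
  fixes b :: "real^'n"
  assumes b: "b \<in> Basis"
  shows "poisson_kernel (r *\<^sub>R b) z = (1 - r\<^sup>2) * (1 + r\<^sup>2 - 2 * r * (z \<bullet> b)) powr (- real CARD('n) / 2)"
proof -
  have "b \<bullet> b = 1" using b by (rule inner_same_Basis)
  then show ?thesis by (simp add: poisson_kernel_def power2_eq_square inner_commute[of b z] mult.assoc)
qed

lemma sphere_mean_poisson_cap:
  fixes b :: "real^'n"
  assumes b: "b \<in> Basis" and r: "0 < r"
  shows "sphere_mean (\<lambda>z. poisson_kernel (r *\<^sub>R b) z * indicator {z. z \<bullet> (r *\<^sub>R b) < 0} z) = (1 - r\<^sup>2) * cap_mean b r"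
  unfolding cap_mean_def sphere_mean_cmult[symmetric] poisson_kernel_axis[OF b]
  by (rule arg_cong[where f = sphere_mean]) (use r in \<open>auto simp: indicator_def mult_less_0_iff fun_eq_iff\<close>)

text \<open>
  A rotation takes \<open>x\<close> to the axis \<open>b\<close>, so the bound depends on \<open>norm x\<close> only. At \<open>x = 0\<close>, where no hemisphere is
  distinguished, it says that the far hemisphere has at most half of the mass.
\<close>
theorem harmonic_schwarz_cap:
  fixes f :: "real^'n \<Rightarrow> real"
  assumes b: "b \<in> (Basis :: (real^'n) set)"
    and f: "harmonic_on f (ball 0 1)" and bd: "\<And>y. norm y < 1 \<Longrightarrow> \<bar>f y\<bar> \<le> 1" and f0: "f 0 = 0"
    and x: "norm x < 1"
  shows "2 * (1 - (norm x)\<^sup>2) * cap_mean b (norm x) \<le> 1 - f x"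
proof (cases "x = 0")
  case True
  have B: "sphere_bounded (indicator {z. z \<bullet> b < 0} :: real^'n \<Rightarrow> real)" "sphere_bounded (indicator {z. z \<bullet> b \<ge> 0} :: real^'n \<Rightarrow> real)"
    by (rule sphere_bounded_indicator, measurable)+
  have "cap_mean b 0 = sphere_mean (indicator {z. z \<bullet> b < 0})"
    unfolding cap_mean_def by (rule arg_cong[where f = sphere_mean]) (auto simp: indicator_def)
  moreover have "sphere_mean (indicator {z. z \<bullet> b < 0}) + sphere_mean (indicator {z. z \<bullet> b \<ge> 0}) = (1::real)"
  proof -
    have "(\<lambda>z. indicator {z. z \<bullet> b < 0} z + indicator {z. z \<bullet> b \<ge> 0} z) = (\<lambda>z. 1 :: real)"
      by (auto simp: indicator_def)
    then show ?thesis using sphere_mean_add[OF B] sphere_mean_const[of "1::real", where 'a = "real^'n"] by simp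
  qed
  ultimately have "2 * cap_mean b 0 \<le> 1" using sphere_mean_halves[of b] by linarith
  then show ?thesis using True f0 by simp
next
  case False
  define r where "r = norm x"
  have r: "0 < r" using False by (simp add: r_def)
  have nb: "norm (r *\<^sub>R b) = norm x" using b by (simp add: r_def)
  then obtain T where T: "orthogonal_transformation T" "T (r *\<^sub>R b) = x"
    using orthogonal_transformation_exists by metis
  have Tin: "T z \<bullet> x = z \<bullet> (r *\<^sub>R b)" for z
    using T unfolding orthogonal_transformation_def by metis
  define F where "F = (\<lambda>z. poisson_kernel x z * indicator {z. z \<bullet> x < 0} z)"
  have "sphere_bounded F" unfolding F_def
    by (intro sphere_bounded_mult sphere_bounded_poisson_kernel[OF x] sphere_bounded_indicator) measurable
  then have Fm: "(\<lambda>y. F (to_sphere y)) \<in> borel_measurable borel" by (simp add: sphere_bounded_def)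
  have "F (T z) = poisson_kernel (r *\<^sub>R b) z * indicator {z. z \<bullet> (r *\<^sub>R b) < 0} z" for z
    unfolding F_def using poisson_kernel_isometry[OF T(1), of "r *\<^sub>R b" z] T(2)
    by (simp only: indicator_def mem_Collect_eq Tin)
  then have "(1 - r\<^sup>2) * cap_mean b r = sphere_mean F"
    using sphere_mean_rotate[OF T(1) Fm] sphere_mean_poisson_cap[OF b r] by simp
  then show ?thesis
    using harmonic_schwarz_bound[OF f bd f0 x] unfolding F_def r_def by (simp only: mult.assoc)
qed

text \<open>
  An odd continuous approximation of the sign that stays strictly inside \<open>{-1<..<1}\<close>: oddness gives \<open>u 0 = 0\<close>,
  continuity makes the Poisson integral harmonic, and the strict bound keeps the image in the open ball.
\<close>
definition smooth_sign :: "nat \<Rightarrow> real \<Rightarrow> real" where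
  "smooth_sign m s = real m * s / (1 + real m * \<bar>s\<bar>)"

lemma smooth_sign_abs_le: "\<bar>s\<bar> \<le> 1 \<Longrightarrow> \<bar>smooth_sign m s\<bar> \<le> real m / (1 + real m)"
proof -
  assume s: "\<bar>s\<bar> \<le> 1"
  have p: "1 + real m * \<bar>s\<bar> > 0" by (simp add: add_pos_nonneg)
  have "real m * \<bar>s\<bar> \<le> real m" using s by (simp add: mult_left_le)
  then have "real m * \<bar>s\<bar> * (1 + real m) \<le> real m * (1 + real m * \<bar>s\<bar>)" by (simp add: algebra_simps)
  then show ?thesis using p by (simp add: smooth_sign_def abs_mult field_simps)
qed

lemma smooth_sign_tendsto: "(\<lambda>m. smooth_sign m s) \<longlonglongrightarrow> sgn s"
proof (cases "s = 0")
  case False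
  have "(\<lambda>m. s / (inverse (real (Suc m)) + \<bar>s\<bar>)) \<longlonglongrightarrow> s / (0 + \<bar>s\<bar>)"
    by (intro tendsto_intros LIMSEQ_inverse_real_of_nat) (use False in auto)
  moreover have "s / (inverse (real (Suc m)) + \<bar>s\<bar>) = smooth_sign (Suc m) s" for m
  proof -
    have "real (Suc m) > 0" by simp
    then show ?thesis unfolding smooth_sign_def by (simp add: field_simps)
  qed
  moreover have "s / (0 + \<bar>s\<bar>) = sgn s" using False by (simp add: sgn_if)
  ultimately have "(\<lambda>m. smooth_sign (Suc m) s) \<longlonglongrightarrow> sgn s" by simp
  then show ?thesis by (rule LIMSEQ_imp_Suc)
qed (simp add: smooth_sign_def)

lemma continuous_smooth_sign: "continuous_on S (\<lambda>z. smooth_sign m (z \<bullet> b))" for b :: "'a::euclidean_space"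
proof -
  have "1 + real m * \<bar>s\<bar> \<noteq> 0" for s :: real using add_pos_nonneg[of 1 "real m * \<bar>s\<bar>"] by simp
  then show ?thesis unfolding smooth_sign_def by (intro continuous_intros) auto
qed

text \<open>
  These maps into a line approximate the extremal function, whose boundary values are the sign of \<open>z \<bullet> b\<close>.
\<close>
definition schwarz_map :: "nat \<Rightarrow> real^'n \<Rightarrow> real^'n \<Rightarrow> real^'n" where
  "schwarz_map m b x = sphere_mean (\<lambda>z. poisson_kernel x z * smooth_sign m (z \<bullet> b)) *\<^sub>R b"

lemma schwarz_map_harmonic: "harmonic_map_on (schwarz_map m b) (ball 0 1)"
  unfolding harmonic_map_on_def
proof
  fix i
  have "harmonic_on (\<lambda>x. sphere_mean (\<lambda>z. poisson_kernel x z * (smooth_sign m (z \<bullet> b) * b $ i))) (ball 0 1)"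
    by (intro harmonic_poisson_integral continuous_intros continuous_smooth_sign)
  moreover have "sphere_mean (\<lambda>z. poisson_kernel x z * (smooth_sign m (z \<bullet> b) * b $ i)) = schwarz_map m b x $ i" for x
    using sphere_mean_cmult[of "b $ i" "\<lambda>z. poisson_kernel x z * smooth_sign m (z \<bullet> b)"]
    by (simp add: schwarz_map_def mult_ac)
  ultimately show "harmonic_on (\<lambda>x. schwarz_map m b x $ i) (ball 0 1)" by simp
qed

lemma schwarz_map_in_ball:
  fixes b :: "real^'n"
  assumes b: "b \<in> Basis" and x: "norm x < 1"
  shows "norm (schwarz_map m b x) < 1"
proof -
  let ?q = "real m / (1 + real m)"
  have "\<bar>sphere_mean (\<lambda>z. poisson_kernel x z * smooth_sign m (z \<bullet> b))\<bar> \<le> sphere_mean (\<lambda>z. ?q * poisson_kernel x z)"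
  proof (rule sphere_mean_abs_le)
    show "sphere_bounded (\<lambda>z. poisson_kernel x z * smooth_sign m (z \<bullet> b))"
      by (intro sphere_bounded_mult sphere_bounded_poisson_kernel[OF x] sphere_bounded_continuous continuous_smooth_sign)
    show "sphere_bounded (\<lambda>z. ?q * poisson_kernel x z)"
      by (intro sphere_bounded_mult sphere_bounded_poisson_kernel[OF x] sphere_bounded_const)
    fix z :: "real^'n" assume z: "norm z = 1"
    have "\<bar>z \<bullet> b\<bar> \<le> 1" using Cauchy_Schwarz_ineq2[of z b] z b by simp
    from mult_left_mono[OF smooth_sign_abs_le[OF this] poisson_kernel_nonneg[OF x, of z]]
    show "\<bar>poisson_kernel x z * smooth_sign m (z \<bullet> b)\<bar> \<le> ?q * poisson_kernel x z"
      using poisson_kernel_nonneg[OF x, of z] by (simp add: abs_mult mult.commute)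
  qed
  also have "\<dots> = ?q" by (simp only: sphere_mean_cmult sphere_mean_poisson_kernel[OF x] mult_1_right)
  also have "\<dots> < 1" by simp
  finally show ?thesis using b by (simp add: schwarz_map_def)
qed

lemma schwarz_map_0: "schwarz_map m b 0 = 0"
proof -
  have o: "orthogonal_transformation (uminus :: real^'n \<Rightarrow> real^'n)"
    by (auto simp: orthogonal_transformation_def intro!: linearI)
  have "(\<lambda>y. smooth_sign m (to_sphere y \<bullet> b)) \<in> borel_measurable borel"
    using sphere_bounded_continuous[OF continuous_smooth_sign[of "cball 0 1" m b]] by (simp add: sphere_bounded_def)
  from sphere_mean_rotate[OF o this]
  have "sphere_mean (\<lambda>z. smooth_sign m (- z \<bullet> b)) = sphere_mean (\<lambda>z. smooth_sign m (z \<bullet> b))" .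
  moreover have "smooth_sign m (- z \<bullet> b) = -1 * smooth_sign m (z \<bullet> b)" for z
    by (simp add: smooth_sign_def)
  ultimately have "sphere_mean (\<lambda>z. smooth_sign m (z \<bullet> b)) = 0"
    using sphere_mean_cmult[of "-1" "\<lambda>z. smooth_sign m (z \<bullet> b)"] by simp
  then show ?thesis by (simp add: schwarz_map_def)
qed

text \<open>
  Dominated convergence turns \<open>smooth_sign\<close> into the sign function; the equator, where the sign is 0,
  has measure 0.
\<close>
lemma schwarz_map_limit:
  fixes b :: "real^'n"
  assumes b: "b \<in> Basis" and n: "CARD('n) \<ge> 2" and r: "0 < r" "r < 1"
  shows "(\<lambda>m. 1 - sphere_mean (\<lambda>z. poisson_kernel (r *\<^sub>R b) z * smooth_sign m (z \<bullet> b))) \<longlonglongrightarrow> 2 * (1 - r\<^sup>2) * cap_mean b r"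
proof -
  let ?x = "r *\<^sub>R b"
  have x: "norm ?x < 1" using b r by simp
  note Q = sphere_bounded_poisson_kernel[OF x]
  define N where "N = {z. z \<bullet> ?x < 0}"
  define E where "E = {z. z \<bullet> b = 0}"
  have [measurable]: "N \<in> sets borel" "E \<in> sets borel" unfolding N_def E_def by measurable
  note B = sphere_bounded_mult sphere_bounded_diff sphere_bounded_const Q sphere_bounded_indicator[of N] sphere_bounded_indicator[of E]
  define c where "c = (1 - r\<^sup>2) * (1 + r\<^sup>2) powr (- real CARD('n) / 2)"
  have sg: "sphere_bounded (\<lambda>z. sgn (z \<bullet> b))"
    unfolding sphere_bounded_def by (auto intro!: exI[of _ 1] simp: sgn_if)
  have "(\<lambda>m. sphere_mean (\<lambda>z. poisson_kernel ?x z * smooth_sign m (z \<bullet> b))) \<longlonglongrightarrow> sphere_mean (\<lambda>z. poisson_kernel ?x z * sgn (z \<bullet> b))"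
  proof (rule sphere_mean_tendsto[where H = "poisson_kernel ?x"])
    show "sphere_bounded (\<lambda>z. poisson_kernel ?x z * smooth_sign m (z \<bullet> b))" for m
      by (intro sphere_bounded_mult Q sphere_bounded_continuous continuous_smooth_sign)
    show "sphere_bounded (\<lambda>z. poisson_kernel ?x z * sgn (z \<bullet> b))" by (intro sphere_bounded_mult Q sg)
    fix m and z :: "real^'n" assume z: "norm z = 1"
    have "\<bar>z \<bullet> b\<bar> \<le> 1" using Cauchy_Schwarz_ineq2[of z b] z b by simp
    from smooth_sign_abs_le[OF this, of m] have "\<bar>smooth_sign m (z \<bullet> b)\<bar> \<le> 1"
      by (rule order_trans) simp
    from mult_left_mono[OF this poisson_kernel_nonneg[OF x, of z]]
    show "\<bar>poisson_kernel ?x z * smooth_sign m (z \<bullet> b)\<bar> \<le> poisson_kernel ?x z"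
      using poisson_kernel_nonneg[OF x, of z] by (simp add: abs_mult)
  qed (use Q in \<open>auto intro!: tendsto_intros smooth_sign_tendsto\<close>)
  then have "(\<lambda>m. 1 - sphere_mean (\<lambda>z. poisson_kernel ?x z * smooth_sign m (z \<bullet> b))) \<longlonglongrightarrow> 1 - sphere_mean (\<lambda>z. poisson_kernel ?x z * sgn (z \<bullet> b))"
    by (intro tendsto_intros)
  also have "sphere_mean (\<lambda>z. poisson_kernel ?x z * sgn (z \<bullet> b)) =
      sphere_mean (\<lambda>z. (poisson_kernel ?x z - 2 * (poisson_kernel ?x z * indicator N z)) - c * indicator E z)"
  proof (rule arg_cong[where f = sphere_mean], rule ext)
    fix z
    have "z \<bullet> ?x < 0 \<longleftrightarrow> z \<bullet> b < 0" using r by (simp add: mult_less_0_iff)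
    moreover have "poisson_kernel ?x z = c" if "z \<bullet> b = 0"
      using that by (simp add: poisson_kernel_axis[OF b] c_def)
    ultimately show "poisson_kernel ?x z * sgn (z \<bullet> b) = (poisson_kernel ?x z - 2 * (poisson_kernel ?x z * indicator N z)) - c * indicator E z"
      by (auto simp: N_def E_def sgn_if indicator_def)
  qed
  also have "\<dots> = sphere_mean (\<lambda>z. poisson_kernel ?x z - 2 * (poisson_kernel ?x z * indicator N z)) - sphere_mean (\<lambda>z. c * indicator E z)"
    by (intro sphere_mean_diff B) measurable
  also have "sphere_mean (\<lambda>z. poisson_kernel ?x z - 2 * (poisson_kernel ?x z * indicator N z)) =
     sphere_mean (poisson_kernel ?x) - sphere_mean (\<lambda>z. 2 * (poisson_kernel ?x z * indicator N z))"
    by (intro sphere_mean_diff B) measurable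
  also have "sphere_mean (\<lambda>z. c * indicator E z) = 0"
  proof -
    have "(\<lambda>z. indicator {0} (z \<bullet> b) :: real) = indicator E" by (auto simp: E_def indicator_def)
    then show ?thesis using sphere_mean_equator[OF b n] by (simp add: sphere_mean_cmult)
  qed
  also have "1 - (sphere_mean (poisson_kernel ?x) - sphere_mean (\<lambda>z. 2 * (poisson_kernel ?x z * indicator N z)) - 0)
      = 2 * (1 - r\<^sup>2) * cap_mean b r"
    unfolding sphere_mean_cmult N_def sphere_mean_poisson_cap[OF b r(1)] sphere_mean_poisson_kernel[OF x] by simp
  finally show ?thesis .
qed

text \<open>
  The two estimates on \<open>slope_integral\<close> compare \<open>cap_mean\<close> at \<open>r\<close> with its value at 1. The first gives the
  inequality, the second its optimality.
\<close>
lemma cap_mean_bounds: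
  fixes b :: "real^'n"
  assumes b: "b \<in> Basis" and n: "CARD('n) \<ge> 2"
  shows "0 \<le> r \<Longrightarrow> r \<le> 1 \<Longrightarrow> schwarz_const CARD('n) \<le> 2 * (1 + r) * cap_mean b r"
    and "0 < r \<Longrightarrow> r \<le> 1 \<Longrightarrow> 4 * cap_mean b r \<le> r powr (- real CARD('n)) * schwarz_const CARD('n)"
proof -
  define B where "B = student_mass (real CARD('n))"
  define M where "M = schwarz_integral CARD('n)"
  have B: "B > 0" unfolding B_def using n by (intro student_mass_pos) simp
  have M: "M \<ge> 0" unfolding M_def by (rule schwarz_integral_nonneg)
  have C: "schwarz_const CARD('n) = 2 * M / B" unfolding M_def B_def by (rule schwarz_const_eq[OF n])
  have cm0: "cap_mean b r \<ge> 0" for r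
    unfolding cap_mean_def sphere_mean_def
    by (intro divide_nonneg_pos Bochner_Integration.integral_nonneg mult_nonneg_nonneg shell_weight_nonneg shell_mass_pos) auto
  show "schwarz_const CARD('n) \<le> 2 * (1 + r) * cap_mean b r" if r: "0 \<le> r" "r \<le> 1"
  proof -
    have "ennreal (2 / (1 + r)) * ennreal (M / 2) \<le> ennreal (B * cap_mean b r)"
      using slope_integral_lower[OF r, of "CARD('n)"]
      by (simp add: cap_mean_eq_slope_integral[OF b n r(1)] slope_integral_1[OF n] B_def M_def)
    then have "2 / (1 + r) * (M / 2) \<le> B * cap_mean b r"
      using r M B cm0[of r] by (simp flip: ennreal_mult)
    then have "M \<le> (1 + r) * (B * cap_mean b r)" using r by (simp add: field_simps)
    then show ?thesis using B unfolding C by (simp add: field_simps)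
  qed
  show "4 * cap_mean b r \<le> r powr (- real CARD('n)) * schwarz_const CARD('n)" if r: "0 < r" "r \<le> 1"
  proof -
    have r0: "0 \<le> r" using r by simp
    have "ennreal (B * cap_mean b r) \<le> ennreal (r powr (- real CARD('n))) * ennreal (M / 2)"
      using slope_integral_upper[OF r, of "CARD('n)"]
      by (simp add: cap_mean_eq_slope_integral[OF b n r0] slope_integral_1[OF n] B_def M_def)
    then have "B * cap_mean b r \<le> r powr (- real CARD('n)) * (M / 2)"
      using M by (simp flip: ennreal_mult)
    then show ?thesis using B unfolding C by (simp add: field_simps)
  qed
qed

theorem theorem2p3:
  assumes "CARD('n::finite) \<ge> 2"
  shows "(\<forall>u :: real ^ 'n \<Rightarrow> real ^ 'n.
            harmonic_map_on u (ball 0 1) \<and> u ` ball 0 1 \<subseteq> ball 0 1 \<and> u 0 = 0 \<longrightarrow>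
            (\<forall>x\<in>ball 0 1. (1 - norm (u x)) / (1 - norm x) \<ge> schwarz_const CARD('n))) \<and>
         (\<forall>C :: real.
            (\<forall>u :: real ^ 'n \<Rightarrow> real ^ 'n.
               harmonic_map_on u (ball 0 1) \<and> u ` ball 0 1 \<subseteq> ball 0 1 \<and> u 0 = 0 \<longrightarrow>
               (\<forall>x\<in>ball 0 1. (1 - norm (u x)) / (1 - norm x) \<ge> C)) \<longrightarrow>
            C \<le> schwarz_const CARD('n))"
proof (intro conjI allI impI ballI)
  fix u :: "real^'n \<Rightarrow> real^'n" and x :: "real^'n"
  assume u: "harmonic_map_on u (ball 0 1) \<and> u ` ball 0 1 \<subseteq> ball 0 1 \<and> u 0 = 0" and "x \<in> ball 0 1"
  then have x: "norm x < 1" by simp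
  obtain b :: "real^'n" where b: "b \<in> Basis" using nonempty_Basis by blast
  define e where "e = (if u x = 0 then b else u x /\<^sub>R norm (u x))"
  have e1: "norm e = 1" using b by (simp add: e_def)
  have eu: "e \<bullet> u x = norm (u x)"
    by (auto simp: e_def power2_norm_eq_inner[symmetric] power2_eq_square)
  define f where "f y = e \<bullet> u y" for y
  have "harmonic_on f (ball 0 1)"
  proof -
    have fin: "harmonic_on (\<lambda>y. \<Sum>i\<in>I. e $ i * u y $ i) (ball 0 1)" if "finite I" for I
      using that
    proof induction
      case empty
      then show ?case using harmonic_on_diff[of "\<lambda>y. u y $ undefined" "ball 0 1" "\<lambda>y. u y $ undefined"] u
        by (simp add: harmonic_map_on_def)
    next
      case (insert i I)
      have "harmonic_on (\<lambda>y. e $ i * u y $ i + (\<Sum>i\<in>I. e $ i * u y $ i)) (ball 0 1)"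
        by (intro harmonic_on_add harmonic_on_cmult insert.IH) (use u in \<open>simp add: harmonic_map_on_def\<close>)
      then show ?case using insert by simp
    qed
    have "f = (\<lambda>y. \<Sum>i\<in>UNIV. e $ i * u y $ i)" by (simp add: f_def[abs_def] inner_vec_def)
    then show ?thesis using fin[of UNIV] by simp
  qed
  moreover have "\<bar>f y\<bar> \<le> 1" if "norm y < 1" for y
  proof -
    have "norm (u y) < 1" using u that by (auto simp: image_subset_iff)
    then show ?thesis using Cauchy_Schwarz_ineq2[of e "u y"] e1 by (simp add: f_def)
  qed
  moreover have "f 0 = 0" using u by (simp add: f_def)
  ultimately have main: "2 * (1 - (norm x)\<^sup>2) * cap_mean b (norm x) \<le> 1 - norm (u x)"
    using harmonic_schwarz_cap[OF b, of f x] x eu by (simp add: f_def)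
  have "schwarz_const CARD('n) * (1 - norm x) \<le> 2 * (1 + norm x) * cap_mean b (norm x) * (1 - norm x)"
    using cap_mean_bounds(1)[OF b assms, of "norm x"] x by (intro mult_right_mono) auto
  also have "\<dots> = 2 * (1 - (norm x)\<^sup>2) * cap_mean b (norm x)"
    by (simp add: power2_eq_square algebra_simps)
  also note main
  finally show "(1 - norm (u x)) / (1 - norm x) \<ge> schwarz_const CARD('n)"
    using x by (simp add: field_simps)
next
  fix C :: real
  assume C: "\<forall>u :: real ^ 'n \<Rightarrow> real ^ 'n.
               harmonic_map_on u (ball 0 1) \<and> u ` ball 0 1 \<subseteq> ball 0 1 \<and> u 0 = 0 \<longrightarrow>
               (\<forall>x\<in>ball 0 1. (1 - norm (u x)) / (1 - norm x) \<ge> C)"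
  obtain b :: "real^'n" where b: "b \<in> Basis" using nonempty_Basis by blast
  let ?S = "schwarz_const CARD('n)"
  have le: "C \<le> (1 + r) / 2 * (r powr (- real CARD('n)) * ?S)" if r: "0 < r" "r < 1" for r
  proof -
    let ?x = "r *\<^sub>R b"
    have nx: "norm ?x = r" using b r by simp
    have "C * (1 - r) \<le> 2 * (1 - r\<^sup>2) * cap_mean b r"
    proof (rule LIMSEQ_le_const[OF schwarz_map_limit[OF b assms r]], intro exI allI impI)
      fix m :: nat
      have "C \<le> (1 - norm (schwarz_map m b ?x)) / (1 - norm ?x)"
      proof (rule C[rule_format])
        show "harmonic_map_on (schwarz_map m b) (ball 0 1) \<and> schwarz_map m b ` ball 0 1 \<subseteq> ball 0 1 \<and> schwarz_map m b 0 = 0"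
          by (simp add: schwarz_map_harmonic schwarz_map_in_ball[OF b] schwarz_map_0 image_subset_iff)
      qed (use nx r in simp)
      then have "C * (1 - r) \<le> 1 - norm (schwarz_map m b ?x)" using r nx by (simp add: field_simps)
      also have "\<dots> \<le> 1 - sphere_mean (\<lambda>z. poisson_kernel ?x z * smooth_sign m (z \<bullet> b))"
        using b by (simp add: schwarz_map_def)
      finally show "C * (1 - r) \<le> 1 - sphere_mean (\<lambda>z. poisson_kernel ?x z * smooth_sign m (z \<bullet> b))" .
    qed
    also have "\<dots> = 2 * (1 + r) * cap_mean b r * (1 - r)" by (simp add: power2_eq_square algebra_simps)
    finally have "C \<le> 2 * (1 + r) * cap_mean b r" using r by simp
    also have "\<dots> = (1 + r) / 2 * (4 * cap_mean b r)" by simp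
    also have "\<dots> \<le> (1 + r) / 2 * (r powr (- real CARD('n)) * ?S)"
      using cap_mean_bounds(2)[OF b assms, of r] r by (intro mult_left_mono) auto
    finally show ?thesis .
  qed
  define s where "s m = 1 - inverse (real (Suc (Suc m)))" for m :: nat
  have s: "0 < s m" "s m < 1" for m by (auto simp: s_def field_simps)
  have "s \<longlonglongrightarrow> 1 - 0" unfolding s_def
    by (intro tendsto_diff tendsto_const LIMSEQ_Suc[OF LIMSEQ_inverse_real_of_nat])
  then have "(\<lambda>m. (1 + s m) / 2 * (s m powr (- real CARD('n)) * ?S)) \<longlonglongrightarrow> (1 + 1) / 2 * (1 powr (- real CARD('n)) * ?S)"
    by (intro tendsto_intros) auto
  then have "C \<le> (1 + 1) / 2 * (1 powr (- real CARD('n)) * ?S)"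
    by (rule LIMSEQ_le_const) (use le[OF s] in auto)
  then show "C \<le> ?S" by simp
qed

end
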